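(* Let $\{X_n:n\ge 0\}$ be a time-homogeneous Markov chain on $(S,\mathcal{B})$ satisfying conditions (A1), (A2), (A3) stated in the context. Then $\{X_n\}$ has a unique stationary probability measure $\pi$, and $\int V\,d\pi<\infty$. Assume in addition that the chain is reversible with respect to $\pi$, that is, $\int_S Pf(x)g(x)\,\pi(dx)=\int_S f(x)Pg(x)\,\pi(dx)$ for all $f,g\in L^2(\pi)$, and positive, that is, $\int_S Pf(x)f(x)\,\pi(dx)\ge 0$ for all $f\in L^2(\pi)$. Let $$\rho=\begin{cases}\lambda, & \text{if } C \text{ is an atom},\\ R_0^{-1}, & \text{if } C \text{ is not an atom},\end{cases}$$ and, for $\rho<\gamma<1$, let $$M=\begin{cases}M_{\mathrm{at}}\big(\gamma,\,1+\tfrac{1}{\gamma-\rho}\big), & \text{if } C \text{ is an atom},\\ M_{\mathrm{non}}\big(\gamma,\,1+\tfrac{\sqrt{\tilde\beta}}{\gamma-\rho}\big), & \text{if } C \text{ is not an atom}.\end{cases}$$ Then $\rho<1$, and for every $\gamma$ with $\rho<\gamma<1$ we have $M<\infty$ and $$\sup_{|g|\le V}\left|(P^ng)(x)-\int g\,d\pi\right|\le M\,V(x)\,\gamma^n\qquad\text{for all }x\in S\text{ and all }n\ge 0,$$ where the supremum is over all measurable $g:S\to\mathbf{R}$ with $|g(y)|\le V(y)$ for all $y\in S$. In particular, $P^ng(x)$ and $\int g\,d\pi$ are both well defined for every measurable $g$ with $\sup\{|g(x)|/V(x):x\in S\}<\infty$.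
   Context: $P(x,A)$ ($x\in S$, $A\in\mathcal{B}$) is the transition probability of the chain, and $P$ also denotes the operator $Pg(x)=\int g(y)P(x,dy)$. Assumptions. (A1) Minorization: there exist $C\in\mathcal{B}$, $\tilde\beta>0$ and a probability measure $\nu$ on $(S,\mathcal{B})$ with $P(x,A)\ge\tilde\beta\,\nu(A)$ for all $x\in C$, $A\in\mathcal{B}$. (A2) Drift: there exist a measurable $V:S\to[1,\infty)$ and constants $0<\lambda<1$, $K<\infty$ with $PV(x)\le\lambda V(x)$ if $x\notin C$ and $PV(x)\le K$ if $x\in C$. (A3) Strong aperiodicity: there exists $\beta>0$ with $\tilde\beta\,\nu(C)\ge\beta$. $C$ is an atom if $P(x,\cdot)=P(y,\cdot)$ for all $x,y\in C$; in this case it is assumed that $\tilde\beta=1$ and $\nu=P(x,\cdot)$ for any $x\in C$. If $C$ is not an atom then $\tilde\beta<1$. Non-atomic case ($\tilde\beta<1$): put $\alpha_1=1+\big(\log\frac{K-\tilde\beta}{1-\tilde\beta}\big)/(\log\lambda^{-1})$. The number $\alpha_2$ is $1+\big(\log\frac{K}{\tilde\beta}\big)/(\log\lambda^{-1})$; alternatively, one may take $\alpha_2=1$ if $\nu(C)=1$, or, more generally, $\alpha_2=1+(\log\widetilde K)/(\log\lambda^{-1})$ if $\nu(C)+\int_{S\setminus C}V\,d\nu\le\widetilde K<\infty$. Put $R_0=\min(\lambda^{-1},(1-\tilde\beta)^{-1/\alpha_1})$. For a real number $\kappa$ define $$M_{\mathrm{at}}(\gamma,\kappa)=\frac{\max(\lambda,K-\lambda/\gamma)}{\gamma-\lambda}+\frac{K(K-\lambda/\gamma)}{\gamma(\gamma-\lambda)}\kappa+\frac{(K-\lambda/\gamma)\max(\lambda,K-\lambda)}{(\gamma-\lambda)(1-\lambda)}+\frac{\lambda(K-1)}{(\gamma-\lambda)(1-\lambda)}$$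 and, with $D=1-(1-\tilde\beta)\gamma^{-\alpha_1}$, $$\begin{aligned}M_{\mathrm{non}}(\gamma,\kappa)={}&\frac{\max(\lambda,K-\lambda/\gamma)}{\gamma-\lambda}+\frac{K[K\gamma-\lambda-\tilde\beta(\gamma-\lambda)]}{\gamma^2(\gamma-\lambda)D}+\frac{\tilde\beta\gamma^{-\alpha_2-2}K(K\gamma-\lambda)}{(\gamma-\lambda)D^2}\kappa\\&+\frac{\gamma^{-\alpha_2-1}(K\gamma-\lambda)}{(\gamma-\lambda)D^2}\left(\frac{\tilde\beta\max(\lambda,K-\lambda)}{1-\lambda}+\frac{(1-\tilde\beta)(\gamma^{-\alpha_1}-1)}{\gamma^{-1}-1}\right)+\frac{\gamma^{-\alpha_2}\lambda(K-1)}{(1-\lambda)(\gamma-\lambda)D}\\&+\frac{K-\lambda-\tilde\beta(1-\lambda)}{(1-\lambda)(1-\gamma)D}\left((\gamma^{-\alpha_2}-1)+\frac{(1-\tilde\beta)(\gamma^{-\alpha_1}-1)}{\tilde\beta}\right).\end{aligned}$$ *)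

theory Defs
  imports "HOL-Probability.Probability"
begin

text \<open>
  The state space is a measure \<open>S\<close> of which only \<open>space S\<close> and \<open>sets S\<close> are used; a
  time-homogeneous Markov chain on it is given by its transition probability, a measurable map
  \<open>P \<in> S \<rightarrow>\<^sub>M prob_algebra S\<close>, where \<open>P x\<close> is the measure $P(x,\cdot)$.
\<close>

text \<open>Where \<open>g\<close> is not integrable the Bochner integral below is \<open>0\<close>, so integrability has to be
  asserted separately. The power $P^n$ is \<open>trans_op P ^^ n\<close>.\<close>

definition trans_op :: "('a \<Rightarrow> 'a measure) \<Rightarrow> ('a \<Rightarrow> real) \<Rightarrow> 'a \<Rightarrow> real" where
  "trans_op P g x = (\<integral>y. g y \<partial>P x)"

definition minorization ::
  "'a measure \<Rightarrow> ('a \<Rightarrow> 'a measure) \<Rightarrow> 'a set \<Rightarrow> real \<Rightarrow> 'a measure \<Rightarrow> bool" where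
  "minorization S P C \<beta>t \<nu> \<longleftrightarrow>
     C \<in> sets S \<and> 0 < \<beta>t \<and> \<nu> \<in> space (prob_algebra S) \<and>
     (\<forall>x\<in>C. \<forall>A\<in>sets S. measure (P x) A \<ge> \<beta>t * measure \<nu> A)"

text \<open>$PV$ is taken in $[0,\infty]$, so that the bounds include the finiteness of $PV$.\<close>

definition drift ::
  "'a measure \<Rightarrow> ('a \<Rightarrow> 'a measure) \<Rightarrow> 'a set \<Rightarrow> ('a \<Rightarrow> real) \<Rightarrow> real \<Rightarrow> real \<Rightarrow> bool" where
  "drift S P C V lam K \<longleftrightarrow>
     V \<in> borel_measurable S \<and> (\<forall>x\<in>space S. 1 \<le> V x) \<and> 0 < lam \<and> lam < 1 \<and>
     (\<forall>x\<in>space S - C. (\<integral>\<^sup>+y. ennreal (V y) \<partial>P x) \<le> ennreal (lam * V x)) \<and>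
     (\<forall>x\<in>C. (\<integral>\<^sup>+y. ennreal (V y) \<partial>P x) \<le> ennreal K)"

definition strong_aperiodicity :: "'a set \<Rightarrow> real \<Rightarrow> 'a measure \<Rightarrow> bool" where
  "strong_aperiodicity C \<beta>t \<nu> \<longleftrightarrow> (\<exists>\<beta>>0. \<beta>t * measure \<nu> C \<ge> \<beta>)"

definition is_atom :: "('a \<Rightarrow> 'a measure) \<Rightarrow> 'a set \<Rightarrow> bool" where
  "is_atom P C \<longleftrightarrow> (\<forall>x\<in>C. \<forall>y\<in>C. P x = P y)"

definition atom_convention ::
  "('a \<Rightarrow> 'a measure) \<Rightarrow> 'a set \<Rightarrow> real \<Rightarrow> 'a measure \<Rightarrow> bool" where
  "atom_convention P C \<beta>t \<nu> \<longleftrightarrow>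
     (if is_atom P C then \<beta>t = 1 \<and> (\<forall>x\<in>C. \<nu> = P x) else \<beta>t < 1)"

definition stationary :: "'a measure \<Rightarrow> ('a \<Rightarrow> 'a measure) \<Rightarrow> 'a measure \<Rightarrow> bool" where
  "stationary S P \<pi> \<longleftrightarrow>
     \<pi> \<in> space (prob_algebra S) \<and>
     (\<forall>A\<in>sets S. emeasure \<pi> A = (\<integral>\<^sup>+x. emeasure (P x) A \<partial>\<pi>))"

definition L2 :: "'a measure \<Rightarrow> ('a \<Rightarrow> real) set" where
  "L2 \<pi> = {f \<in> borel_measurable \<pi>. integrable \<pi> (\<lambda>x. (f x)\<^sup>2)}"

definition reversible :: "('a \<Rightarrow> 'a measure) \<Rightarrow> 'a measure \<Rightarrow> bool" where
  "reversible P \<pi> \<longleftrightarrow>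
     (\<forall>f\<in>L2 \<pi>. \<forall>g\<in>L2 \<pi>.
        (\<integral>x. trans_op P f x * g x \<partial>\<pi>) = (\<integral>x. f x * trans_op P g x \<partial>\<pi>))"

definition positive_chain :: "('a \<Rightarrow> 'a measure) \<Rightarrow> 'a measure \<Rightarrow> bool" where
  "positive_chain P \<pi> \<longleftrightarrow> (\<forall>f\<in>L2 \<pi>. (\<integral>x. trans_op P f x * f x \<partial>\<pi>) \<ge> 0)"

definition alpha1 :: "real \<Rightarrow> real \<Rightarrow> real \<Rightarrow> real" where
  "alpha1 lam K \<beta>t = 1 + ln ((K - \<beta>t) / (1 - \<beta>t)) / ln (1 / lam)"

text \<open>The admissible choices of $\alpha_2$.\<close>

definition alpha2_choice ::
  "'a measure \<Rightarrow> 'a set \<Rightarrow> ('a \<Rightarrow> real) \<Rightarrow> real \<Rightarrow> real \<Rightarrow> real \<Rightarrow> 'a measure \<Rightarrow> real \<Rightarrow> bool" where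
  "alpha2_choice S C V lam K \<beta>t \<nu> \<alpha>2 \<longleftrightarrow>
     \<alpha>2 = 1 + ln (K / \<beta>t) / ln (1 / lam) \<or>
     (measure \<nu> C = 1 \<and> \<alpha>2 = 1) \<or>
     (\<exists>Kt::real. emeasure \<nu> C + (\<integral>\<^sup>+x\<in>space S - C. ennreal (V x) \<partial>\<nu>) \<le> ennreal Kt \<and>
        \<alpha>2 = 1 + ln Kt / ln (1 / lam))"

definition R0 :: "real \<Rightarrow> real \<Rightarrow> real \<Rightarrow> real" where
  "R0 lam K \<beta>t = min (1 / lam) ((1 - \<beta>t) powr (- 1 / alpha1 lam K \<beta>t))"

definition M_at :: "real \<Rightarrow> real \<Rightarrow> real \<Rightarrow> real \<Rightarrow> real" where
  "M_at lam K \<gamma> \<kappa> =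
     max lam (K - lam / \<gamma>) / (\<gamma> - lam)
     + K * (K - lam / \<gamma>) / (\<gamma> * (\<gamma> - lam)) * \<kappa>
     + (K - lam / \<gamma>) * max lam (K - lam) / ((\<gamma> - lam) * (1 - lam))
     + lam * (K - 1) / ((\<gamma> - lam) * (1 - lam))"

definition D_non :: "real \<Rightarrow> real \<Rightarrow> real \<Rightarrow> real \<Rightarrow> real" where
  "D_non lam K \<beta>t \<gamma> = 1 - (1 - \<beta>t) * \<gamma> powr (- alpha1 lam K \<beta>t)"

definition M_non :: "real \<Rightarrow> real \<Rightarrow> real \<Rightarrow> real \<Rightarrow> real \<Rightarrow> real \<Rightarrow> real" where
  "M_non lam K \<beta>t \<alpha>2 \<gamma> \<kappa> =
     (let \<alpha>1 = alpha1 lam K \<beta>t; D = D_non lam K \<beta>t \<gamma> in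
       max lam (K - lam / \<gamma>) / (\<gamma> - lam)
       + K * (K * \<gamma> - lam - \<beta>t * (\<gamma> - lam)) / (\<gamma>\<^sup>2 * (\<gamma> - lam) * D)
       + \<beta>t * \<gamma> powr (- \<alpha>2 - 2) * K * (K * \<gamma> - lam) / ((\<gamma> - lam) * D\<^sup>2) * \<kappa>
       + \<gamma> powr (- \<alpha>2 - 1) * (K * \<gamma> - lam) / ((\<gamma> - lam) * D\<^sup>2)
         * (\<beta>t * max lam (K - lam) / (1 - lam)
            + (1 - \<beta>t) * (\<gamma> powr (- \<alpha>1) - 1) / (1 / \<gamma> - 1))
       + \<gamma> powr (- \<alpha>2) * lam * (K - 1) / ((1 - lam) * (\<gamma> - lam) * D)
       + (K - lam - \<beta>t * (1 - lam)) / ((1 - lam) * (1 - \<gamma>) * D)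
         * ((\<gamma> powr (- \<alpha>2) - 1) + (1 - \<beta>t) * (\<gamma> powr (- \<alpha>1) - 1) / \<beta>t))"

definition rate :: "('a \<Rightarrow> 'a measure) \<Rightarrow> 'a set \<Rightarrow> real \<Rightarrow> real \<Rightarrow> real \<Rightarrow> real" where
  "rate P C lam K \<beta>t = (if is_atom P C then lam else inverse (R0 lam K \<beta>t))"

text \<open>
  Since \<open>x / 0 = 0\<close> on the reals, finiteness of $M$ would be vacuous for a real-valued constant.
  It is therefore extended real, with value \<open>\<infinity>\<close> unless every denominator in the formula
  is positive.
\<close>

definition bound_const ::
  "('a \<Rightarrow> 'a measure) \<Rightarrow> 'a set \<Rightarrow> real \<Rightarrow> real \<Rightarrow> real \<Rightarrow> real \<Rightarrow> real \<Rightarrow> ereal" where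
  "bound_const P C lam K \<beta>t \<alpha>2 \<gamma> =
     (let \<rho> = rate P C lam K \<beta>t in
      if is_atom P C then
        (if 0 < \<gamma> \<and> 0 < \<gamma> - lam \<and> 0 < 1 - lam \<and> 0 < \<gamma> - \<rho>
         then ereal (M_at lam K \<gamma> (1 + 1 / (\<gamma> - \<rho>))) else \<infinity>)
      else
        (if 0 < \<gamma> \<and> 0 < \<gamma> - lam \<and> 0 < 1 - lam \<and> 0 < 1 - \<gamma> \<and> 0 < 1 / \<gamma> - 1 \<and> 0 < \<beta>t \<and>
            0 < D_non lam K \<beta>t \<gamma> \<and> 0 < \<gamma> - \<rho>
         then ereal (M_non lam K \<beta>t \<alpha>2 \<gamma> (1 + sqrt \<beta>t / (\<gamma> - \<rho>))) else \<infinity>))"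

end

theory Submission
  imports Defs
begin

text \<open>
  Split the transition probability on \<open>C\<close> as \<open>P(x, \<cdot>) = Q(x, \<cdot>) + \<beta>t \<nu>\<close>: at each visit to \<open>C\<close> the
  chain regenerates, with distribution \<open>\<nu>\<close>, with probability \<open>\<beta>t\<close>. The taboo operator \<open>Q\<close> describes the
  chain killed at its first regeneration. It is positive and linear, all probabilities of interest
  are of the form \<open>Q\<^sup>n f\<close> or \<open>\<nu> Q\<^sup>n f\<close>, and the first-entrance and last-exit decompositions of the
  path are algebraic identities between these (\<open>first_entrance\<close>, \<open>last_exit\<close>).

  Put \<open>r = 1 / \<gamma>\<close>. The drift condition bounds all potentials \<open>\<Sum> r\<^sup>n Q\<^sup>n f\<close> that occur, because a
  nonnegative supersolution \<open>W \<ge> f + r Q W\<close> dominates the potential of \<open>f\<close>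
  (\<open>potential_le_supersolution\<close>). The supersolutions are built from \<open>V\<close> and from the power of \<open>V\<close> that
  controls the moment of order \<open>r\<close> of the hitting time of \<open>C\<close>; Jensen's inequality for this power is the origin of
  \<open>\<alpha>1\<close>, \<open>\<alpha>2\<close> and \<open>R\<^sub>0\<close>. By the same bounds, the normalised occupation measure
  \<open>\<Sum> \<nu> Q\<^sup>n\<close> of a cycle is the unique stationary distribution and integrates \<open>V\<close>.

  It remains to control the renewal sequence \<open>u\<^sub>0 = 1\<close>, \<open>u\<^bsub>k+1\<^esub> = \<beta>t \<nu> P\<^sup>k 1\<^sub>C\<close>, whose limit is
  \<open>\<beta>t \<pi>(C)\<close>, and here reversibility and positivity enter. Let \<open>h = 1\<^sub>C - \<pi>(C)\<close> and
  \<open>c\<^sub>k = \<langle>P\<^sup>k h, h\<rangle>\<close> in \<open>L\<^sup>2(\<pi>)\<close>. Then \<open>c\<^sub>k \<ge> 0\<close>, by reversibility for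
  even \<open>k\<close> and by positivity for odd \<open>k\<close>. The last-exit decomposition of the constant
  function \<open>1\<close>, integrated over \<open>C\<close>, bounds a convolution of \<open>c\<close> with nonnegative weights by the tail of the cycle
  length, which is \<open>O(r\<^sup>-\<^sup>n)\<close>; as no term is negative, \<open>c\<^sub>n\<close> itself is \<open>O(r\<^sup>-\<^sup>n)\<close> (\<open>cov_decay\<close>).
  By the Cauchy-Schwarz inequality \<open>c\<^bsub>2n\<^esub> = \<parallel>P\<^sup>n h\<parallel>\<^sup>2\<close> is log-convex, which turns the implied constant into
  \<open>c\<^sub>0 \<le> \<pi>(C)\<close> (\<open>cov_even_decay\<close>). Since \<open>\<nu> \<le> \<pi> / (\<beta>t \<pi>(C))\<close>, the error of the renewal sequence
  follows (\<open>renewal_error\<close>).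

  The error of \<open>P\<^sup>n g\<close> is finally the part of the path before the first regeneration, plus two
  convolutions, with the time of the first regeneration and with the last incomplete cycle, of the error of the
  renewal sequence (\<open>weighted_convolution_error\<close>, \<open>geometric_error\<close>). Inserting the potential bounds gives the
  explicit constants (\<open>geometric_rate_atom\<close>, \<open>geometric_rate_nonatom\<close>).
\<close>

section \<open>The chain and its taboo operator on functions dominated by the drift function\<close>

locale drift_chain =
  fixes S :: "'a measure" and P :: "'a \<Rightarrow> 'a measure" and C :: "'a set"
    and \<nu> :: "'a measure" and V :: "'a \<Rightarrow> real" and \<beta>t lam K :: real
  assumes kernel: "P \<in> S \<rightarrow>\<^sub>M prob_algebra S"
    and minor: "minorization S P C \<beta>t \<nu>"
    and drift: "drift S P C V lam K"
    and nu_C: "0 < measure \<nu> C"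
    and bt_le_1: "\<beta>t \<le> 1"
begin

lemma C_sets [measurable]: "C \<in> sets S"
  using minor by (simp add: minorization_def)

lemma bt_pos: "0 < \<beta>t"
  using minor by (simp add: minorization_def)

lemma lam_pos: "0 < lam" and lam_less_1: "lam < 1"
  using drift by (simp_all add: drift_def)

lemma V_meas [measurable]: "V \<in> borel_measurable S"
  using drift by (simp add: drift_def)

lemma V_ge_1: "x \<in> space S \<Longrightarrow> 1 \<le> V x"
  using drift by (simp add: drift_def)

lemma C_sub: "x \<in> C \<Longrightarrow> x \<in> space S"
  using C_sets sets.sets_into_space by blast

lemma sets_P: "x \<in> space S \<Longrightarrow> sets (P x) = sets S"
  and prob_P: "x \<in> space S \<Longrightarrow> prob_space (P x)"
  using measurable_space[OF kernel] by (auto simp: space_prob_algebra)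

lemma space_P: "x \<in> space S \<Longrightarrow> space (P x) = space S"
  using sets_P sets_eq_imp_space_eq by blast

lemma sets_nu [measurable_cong]: "sets \<nu> = sets S"
  and prob_nu: "prob_space \<nu>"
  using minor by (auto simp: minorization_def space_prob_algebra)

lemma space_nu: "space \<nu> = space S"
  using sets_nu sets_eq_imp_space_eq by blast

lemma C_nonempty: "C \<noteq> {}"
  using nu_C by auto

lemma scaled_nu_le_P:
  assumes x: "x \<in> C"
  shows "scale_measure (ennreal \<beta>t) \<nu> \<le> P x"
proof -
  interpret p: prob_space "P x" by (rule prob_P[OF C_sub[OF x]])
  interpret n: prob_space \<nu> by (rule prob_nu)
  have "ennreal \<beta>t * emeasure \<nu> A \<le> emeasure (P x) A" if "A \<in> sets S" for A
    using minor x that bt_pos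
    by (auto simp: minorization_def p.emeasure_eq_measure n.emeasure_eq_measure
        ennreal_mult'[symmetric] intro!: ennreal_leI)
  then show ?thesis
    by (subst le_measure) (auto simp: sets_nu sets_P[OF C_sub[OF x]])
qed

lemma nn_integral_nu_le_P:
  assumes x: "x \<in> C" and f: "f \<in> borel_measurable S"
  shows "ennreal \<beta>t * (\<integral>\<^sup>+y. f y \<partial>\<nu>) \<le> (\<integral>\<^sup>+y. f y \<partial>P x)"
proof -
  have "ennreal \<beta>t * (\<integral>\<^sup>+y. f y \<partial>\<nu>) = (\<integral>\<^sup>+y. f y \<partial>scale_measure (ennreal \<beta>t) \<nu>)"
    using f by (subst nn_integral_scale_measure) (auto cong: measurable_cong_sets simp: sets_nu)
  also have "\<dots> \<le> (\<integral>\<^sup>+y. f y \<partial>P x)"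
    using scaled_nu_le_P[OF x] sets_P[OF C_sub[OF x]]
    by (intro nn_integral_mono_measure) (auto simp: sets_nu)
  finally show ?thesis .
qed

lemma nn_V_le:
  "x \<in> space S - C \<Longrightarrow> (\<integral>\<^sup>+y. ennreal (V y) \<partial>P x) \<le> ennreal (lam * V x)"
  "x \<in> C \<Longrightarrow> (\<integral>\<^sup>+y. ennreal (V y) \<partial>P x) \<le> ennreal K"
  using drift by (auto simp: drift_def)

lemma integrable_V_P:
  assumes "x \<in> space S" shows "integrable (P x) V"
proof (rule integrableI_nonneg)
  show "V \<in> borel_measurable (P x)"
    using V_meas measurable_cong_sets[OF sets_P[OF assms] refl] by blast
  show "AE y in P x. 0 \<le> V y"
    using V_ge_1 by (intro AE_I2) (force simp: space_P[OF assms])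
  show "(\<integral>\<^sup>+y. ennreal (V y) \<partial>P x) < \<infinity>"
    using nn_V_le[of x] assms
    by (cases "x \<in> C") (auto intro: le_less_trans[OF _ ennreal_less_top])
qed

lemma integrable_V_nu: "integrable \<nu> V"
proof (rule integrableI_nonneg)
  show "V \<in> borel_measurable \<nu>" by measurable
  show "AE y in \<nu>. 0 \<le> V y"
    using V_ge_1 by (intro AE_I2) (force simp: space_nu)
  obtain x where x: "x \<in> C" using C_nonempty by blast
  have "ennreal \<beta>t * (\<integral>\<^sup>+y. ennreal (V y) \<partial>\<nu>) \<le> ennreal K"
    by (rule order_trans[OF nn_integral_nu_le_P[OF x] nn_V_le(2)[OF x]]) simp
  then show "(\<integral>\<^sup>+y. ennreal (V y) \<partial>\<nu>) < \<infinity>"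
    using bt_pos by (auto simp: ennreal_mult_eq_top_iff top_unique less_top[symmetric])
qed

text \<open>
  The functions on which all operators act: \<open>V\<close> is integrable for every \<open>P x\<close> and for \<open>\<nu>\<close>.
\<close>

definition dominated :: "('a \<Rightarrow> real) \<Rightarrow> bool" where
  "dominated f \<longleftrightarrow> f \<in> borel_measurable S \<and> (\<exists>c. \<forall>x\<in>space S. \<bar>f x\<bar> \<le> c * V x)"

lemma dominatedI:
  "f \<in> borel_measurable S \<Longrightarrow> (\<And>x. x \<in> space S \<Longrightarrow> \<bar>f x\<bar> \<le> c * V x) \<Longrightarrow> dominated f"
  unfolding dominated_def by blast

lemma dominated_meas: "dominated f \<Longrightarrow> f \<in> borel_measurable S"
  by (simp add: dominated_def)

lemma dominatedE:
  assumes "dominated f"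
  obtains c where "0 \<le> c" "\<And>x. x \<in> space S \<Longrightarrow> \<bar>f x\<bar> \<le> c * V x"
proof -
  obtain c where c: "\<And>x. x \<in> space S \<Longrightarrow> \<bar>f x\<bar> \<le> c * V x"
    using assms by (auto simp: dominated_def)
  have "\<bar>f x\<bar> \<le> max 0 c * V x" if "x \<in> space S" for x
    using c[OF that] V_ge_1[OF that] mult_right_mono[of c "max 0 c" "V x"] by linarith
  with that[of "max 0 c"] show ?thesis by simp
qed

lemma dominated_V [simp, intro]: "dominated V"
  by (rule dominatedI[where c=1]) (use V_ge_1 in force)+

lemma dominated_bounded:
  assumes "f \<in> borel_measurable S" "\<And>x. x \<in> space S \<Longrightarrow> \<bar>f x\<bar> \<le> c"
  shows "dominated f"
proof (rule dominatedI[where c="max 0 c"])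
  fix x assume x: "x \<in> space S"
  show "\<bar>f x\<bar> \<le> max 0 c * V x"
    using assms(2)[OF x] V_ge_1[OF x] mult_left_mono[of 1 "V x" "max 0 c"] by linarith
qed (fact assms)

lemma dominated_const [simp, intro]: "dominated (\<lambda>x. c)"
  by (rule dominated_bounded[where c="\<bar>c\<bar>"]) auto

lemma dominated_indicator [intro]: "A \<in> sets S \<Longrightarrow> dominated (indicator A)"
  by (rule dominated_bounded[where c=1]) (auto simp: indicator_def)

lemma dominated_indC [simp, intro]: "dominated (indicator C)"
  by (rule dominated_indicator) simp

lemma dominated_add [intro]:
  assumes "dominated f" "dominated g" shows "dominated (\<lambda>x. f x + g x)"
proof -
  obtain c where c: "\<And>x. x \<in> space S \<Longrightarrow> \<bar>f x\<bar> \<le> c * V x"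
    using assms(1) by (metis dominatedE)
  obtain d where d: "\<And>x. x \<in> space S \<Longrightarrow> \<bar>g x\<bar> \<le> d * V x"
    using assms(2) by (metis dominatedE)
  have "\<bar>f x + g x\<bar> \<le> (c + d) * V x" if "x \<in> space S" for x
    using c[OF that] d[OF that] by (simp add: distrib_right)
  then show ?thesis
    using assms[THEN dominated_meas] by (intro dominatedI[where c="c+d"]) auto
qed

lemma dominated_cmult [intro]:
  assumes "dominated f" shows "dominated (\<lambda>x. c * f x)"
proof -
  obtain d where "\<And>x. x \<in> space S \<Longrightarrow> \<bar>f x\<bar> \<le> d * V x"
    using assms by (metis dominatedE)
  then have "\<bar>c * f x\<bar> \<le> (\<bar>c\<bar> * d) * V x" if "x \<in> space S" for x
    using that by (simp add: abs_mult mult.assoc mult_left_mono)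
  then show ?thesis
    using assms[THEN dominated_meas] by (intro dominatedI[where c="\<bar>c\<bar> * d"]) auto
qed

lemma dominated_diff [intro]:
  assumes "dominated f" "dominated g" shows "dominated (\<lambda>x. f x - g x)"
  using dominated_add[OF assms(1) dominated_cmult[OF assms(2), of "-1"]] by simp

lemma dominated_sum [intro]:
  "(\<And>i. i \<in> I \<Longrightarrow> dominated (f i)) \<Longrightarrow> dominated (\<lambda>x. \<Sum>i\<in>I. f i x)"
  by (induction I rule: infinite_finite_induct) (simp_all add: dominated_add)

lemma dominated_mono:
  assumes "dominated g" "f \<in> borel_measurable S" "\<And>x. x \<in> space S \<Longrightarrow> \<bar>f x\<bar> \<le> g x"
  shows "dominated f"
proof -
  obtain d where "\<And>x. x \<in> space S \<Longrightarrow> \<bar>g x\<bar> \<le> d * V x"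
    using assms(1) by (metis dominatedE)
  then have "\<bar>f x\<bar> \<le> d * V x" if "x \<in> space S" for x
    using assms(3)[OF that] that by fastforce
  then show ?thesis
    by (intro dominatedI[OF assms(2)])
qed

lemma integrable_dominated:
  assumes "dominated f"
    and M: "sets M = sets S" "integrable M V"
  shows "integrable M f"
proof -
  obtain c where c: "\<And>x. x \<in> space S \<Longrightarrow> \<bar>f x\<bar> \<le> c * V x"
    using assms(1) by (metis dominatedE)
  have "integrable M (\<lambda>x. c * V x)" using M(2) by simp
  then show ?thesis
  proof (rule Bochner_Integration.integrable_bound)
    show "f \<in> borel_measurable M"
      using dominated_meas[OF assms(1)] M(1) by (simp cong: measurable_cong_sets)
    show "AE x in M. norm (f x) \<le> norm (c * V x)"
      using c sets_eq_imp_space_eq[OF M(1)] by (intro AE_I2) force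
  qed
qed

lemma integrable_P: "x \<in> space S \<Longrightarrow> dominated f \<Longrightarrow> integrable (P x) f"
  by (rule integrable_dominated[OF _ sets_P integrable_V_P])

lemma integrable_nu: "dominated f \<Longrightarrow> integrable \<nu> f"
  by (rule integrable_dominated[OF _ sets_nu integrable_V_nu])

definition nui :: "('a \<Rightarrow> real) \<Rightarrow> real" where
  "nui f = (\<integral>y. f y \<partial>\<nu>)"

text \<open>Cut to \<open>0\<close> off the state space, so that linearity is an equation between functions.\<close>

definition step :: "('a \<Rightarrow> real) \<Rightarrow> 'a \<Rightarrow> real" where
  "step f x = (if x \<in> space S then \<integral>y. f y \<partial>P x else 0)"

text \<open>
  The chain killed when it regenerates: in $C$ the minorization splits off the part
  \<open>\<beta>t \<nu>\<close> of the transition probability, and what remains is a sub-Markov operator.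
\<close>

definition taboo :: "('a \<Rightarrow> real) \<Rightarrow> 'a \<Rightarrow> real" where
  "taboo f x = step f x - \<beta>t * nui f * indicator C x"

lemma nui_add: "dominated f \<Longrightarrow> dominated g \<Longrightarrow> nui (\<lambda>x. f x + g x) = nui f + nui g"
  by (simp add: nui_def integrable_nu)

lemma nui_diff: "dominated f \<Longrightarrow> dominated g \<Longrightarrow> nui (\<lambda>x. f x - g x) = nui f - nui g"
  by (simp add: nui_def integrable_nu)

lemma nui_cmult: "nui (\<lambda>x. c * f x) = c * nui f"
  by (simp add: nui_def)

lemma nui_const [simp]: "nui (\<lambda>x. c) = c"
  by (simp add: nui_def prob_space.prob_space[OF prob_nu])

lemma nui_sum: "(\<And>i. i \<in> I \<Longrightarrow> dominated (f i)) \<Longrightarrow> nui (\<lambda>x. \<Sum>i\<in>I. f i x) = (\<Sum>i\<in>I. nui (f i))"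
  by (simp add: nui_def integrable_nu)

lemma nui_mono:
  "dominated f \<Longrightarrow> dominated g \<Longrightarrow> (\<And>x. x \<in> space S \<Longrightarrow> f x \<le> g x) \<Longrightarrow> nui f \<le> nui g"
  unfolding nui_def by (rule integral_mono) (auto simp: integrable_nu space_nu)

lemma nui_cong: "(\<And>x. x \<in> space S \<Longrightarrow> f x = g x) \<Longrightarrow> nui f = nui g"
  unfolding nui_def by (rule Bochner_Integration.integral_cong) (auto simp: space_nu)

lemma nui_nonneg: "(\<And>x. x \<in> space S \<Longrightarrow> 0 \<le> f x) \<Longrightarrow> 0 \<le> nui f"
  unfolding nui_def by (rule Bochner_Integration.integral_nonneg) (auto simp: space_nu)

lemma step_add: "dominated f \<Longrightarrow> dominated g \<Longrightarrow> step (\<lambda>x. f x + g x) = (\<lambda>x. step f x + step g x)"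
  by (rule ext) (simp add: step_def integrable_P)

lemma step_cmult: "step (\<lambda>x. c * f x) = (\<lambda>x. c * step f x)"
  by (rule ext) (simp add: step_def)

lemma step_const: "x \<in> space S \<Longrightarrow> step (\<lambda>x. c) x = c"
  by (simp add: step_def prob_space.prob_space[OF prob_P])

lemma step_mono:
  "dominated f \<Longrightarrow> dominated g \<Longrightarrow> (\<And>x. x \<in> space S \<Longrightarrow> f x \<le> g x) \<Longrightarrow> step f x \<le> step g x"
  unfolding step_def
  by (cases "x \<in> space S") (simp, rule integral_mono, simp_all add: integrable_P space_P)

lemma step_cong: "(\<And>x. x \<in> space S \<Longrightarrow> f x = g x) \<Longrightarrow> step f = step g"
  unfolding step_def
  by (rule ext, simp, intro impI Bochner_Integration.integral_cong) (simp_all add: space_P)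

lemma V_nonneg: "x \<in> space S \<Longrightarrow> 0 \<le> V x"
  using V_ge_1[of x] by linarith

lemma K_ge_1: "1 \<le> K"
proof -
  obtain x where x: "x \<in> C" using C_nonempty by blast
  note xs = C_sub[OF x]
  interpret p: prob_space "P x" by (rule prob_P[OF xs])
  have "(\<integral>\<^sup>+y. 1 \<partial>P x) \<le> (\<integral>\<^sup>+y. ennreal (V y) \<partial>P x)"
    using V_ge_1 by (intro nn_integral_mono) (auto simp: space_P[OF xs])
  then have "1 \<le> (\<integral>\<^sup>+y. ennreal (V y) \<partial>P x)"
    using p.emeasure_space_1 by simp
  also have "\<dots> \<le> ennreal K" by (rule nn_V_le(2)[OF x])
  finally show ?thesis
    by (cases "0 \<le> K") (auto simp: ennreal_neg simp flip: ennreal_1)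
qed

lemma integral_V_eq: "x \<in> space S \<Longrightarrow> ennreal (step V x) = (\<integral>\<^sup>+y. ennreal (V y) \<partial>P x)"
  using V_nonneg
  by (subst nn_integral_eq_integral) (auto simp: step_def integrable_V_P space_P)

lemma step_V_off_C:
  assumes "x \<in> space S" "x \<notin> C" shows "step V x \<le> lam * V x"
proof -
  have "ennreal (step V x) \<le> ennreal (lam * V x)"
    using nn_V_le(1)[of x] assms by (simp add: integral_V_eq)
  then show ?thesis using lam_pos V_nonneg[OF assms(1)] by (simp add: ennreal_le_iff)
qed

lemma step_V_on_C:
  assumes "x \<in> C" shows "step V x \<le> K"
proof -
  have "ennreal (step V x) \<le> ennreal K"
    using nn_V_le(2)[OF assms] C_sub[OF assms] by (simp add: integral_V_eq)
  then show ?thesis using K_ge_1 by (simp add: ennreal_le_iff)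
qed

lemma step_meas: 
  assumes "f \<in> borel_measurable S" shows "step f \<in> borel_measurable S"
proof -
  have "(\<lambda>M. integral\<^sup>L M f) \<in> borel_measurable (subprob_algebra S)"
    using assms by measurable
  from measurable_compose[OF measurable_prob_algebraD[OF kernel] this]
  show ?thesis by (auto simp: step_def cong: measurable_cong)
qed

lemma dominated_step [simp, intro]:
  assumes f: "dominated f" shows "dominated (step f)"
proof -
  obtain c where c: "0 \<le> c" "\<And>x. x \<in> space S \<Longrightarrow> \<bar>f x\<bar> \<le> c * V x"
    using f by (metis dominatedE)
  have "\<bar>step f x\<bar> \<le> c * max lam K * V x" if x: "x \<in> space S" for x
  proof -
    have "step f x \<le> step (\<lambda>x. c * V x) x" "step (\<lambda>x. (-c) * V x) x \<le> step f x"
      using c(2) by (intro step_mono f dominated_cmult dominated_V; force)+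
    then have "\<bar>step f x\<bar> \<le> c * step V x"
      unfolding step_cmult by (simp add: abs_le_iff)
    also have "step V x \<le> max lam K * V x"
    proof (cases "x \<in> C")
      case True
      have "K * 1 \<le> max lam K * V x" 
        using V_ge_1[OF x] K_ge_1 by (intro mult_mono) auto
      then show ?thesis using step_V_on_C[OF True] by simp
    next
      case False
      have "lam * V x \<le> max lam K * V x" 
        using V_nonneg[OF x] by (intro mult_right_mono) auto
      then show ?thesis using step_V_off_C[OF x False] by simp
    qed
    finally show ?thesis using c(1) by (simp add: mult.assoc mult_left_mono)
  qed
  then show ?thesis
    using step_meas[OF dominated_meas[OF f]] by (intro dominatedI[where c="c * max lam K"])
qed

lemma step_sum:
  assumes "\<And>i. i \<in> I \<Longrightarrow> dominated (f i)"
  shows "step (\<lambda>x. \<Sum>i\<in>I. f i x) = (\<lambda>x. \<Sum>i\<in>I. step (f i) x)"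
  using assms
proof (induction I rule: infinite_finite_induct)
  case (insert i I)
  then show ?case by (simp add: step_add dominated_sum)
qed (auto simp: step_def)

lemma taboo_add:
  "dominated f \<Longrightarrow> dominated g \<Longrightarrow> taboo (\<lambda>x. f x + g x) = (\<lambda>x. taboo f x + taboo g x)"
  unfolding taboo_def by (rule ext) (simp add: step_add nui_add algebra_simps)

lemma taboo_cmult: "taboo (\<lambda>x. c * f x) = (\<lambda>x. c * taboo f x)"
  unfolding taboo_def by (rule ext) (simp add: step_cmult nui_cmult algebra_simps)

lemma dominated_taboo [simp, intro]: "dominated f \<Longrightarrow> dominated (taboo f)"
  unfolding taboo_def[abs_def] by (intro dominated_diff dominated_step dominated_cmult) auto

lemma taboo_cong: "(\<And>x. x \<in> space S \<Longrightarrow> f x = g x) \<Longrightarrow> taboo f = taboo g"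
  unfolding taboo_def[abs_def] using step_cong[of f g] nui_cong[of f g] by simp

lemma taboo_sum:
  assumes "\<And>i. i \<in> I \<Longrightarrow> dominated (f i)"
  shows "taboo (\<lambda>x. \<Sum>i\<in>I. f i x) = (\<lambda>x. \<Sum>i\<in>I. taboo (f i) x)"
  unfolding taboo_def[abs_def] using assms
  by (simp add: step_sum nui_sum sum_subtractf sum_distrib_left sum_distrib_right)

text \<open>Positivity of the killed operator is the minorization condition.\<close>

lemma taboo_nonneg:
  assumes f: "dominated f" and nn: "\<And>x. x \<in> space S \<Longrightarrow> 0 \<le> f x" and x: "x \<in> space S"
  shows "0 \<le> taboo f x"
proof (cases "x \<in> C")
  case True
  have "ennreal (\<beta>t * nui f) = ennreal \<beta>t * (\<integral>\<^sup>+y. ennreal (f y) \<partial>\<nu>)"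
    unfolding nui_def using nn bt_pos integrable_nu[OF f]
    by (subst nn_integral_eq_integral) (auto simp: space_nu ennreal_mult')
  also have "\<dots> \<le> (\<integral>\<^sup>+y. ennreal (f y) \<partial>P x)"
    using dominated_meas[OF f] by (intro nn_integral_nu_le_P[OF True]) auto
  also have "\<dots> = ennreal (step f x)"
    using nn integrable_P[OF x f]
    by (subst nn_integral_eq_integral) (auto simp: space_P[OF x] step_def x)
  finally have "\<beta>t * nui f \<le> step f x"
    using step_mono[of "\<lambda>x. 0" f x] nn f step_const[OF x, of 0]
    by (subst (asm) ennreal_le_iff) auto
  then show ?thesis by (simp add: taboo_def True)
next
  case False
  then show ?thesis
    using step_mono[of "\<lambda>x. 0" f x] nn f step_const[OF x, of 0] by (auto simp: taboo_def)
qed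

lemma taboo_mono:
  assumes "dominated f" "dominated g" "\<And>x. x \<in> space S \<Longrightarrow> f x \<le> g x" "x \<in> space S"
  shows "taboo f x \<le> taboo g x"
proof -
  have "0 \<le> taboo (\<lambda>x. g x + (-1) * f x) x"
    using assms by (intro taboo_nonneg dominated_add dominated_cmult) auto
  then show ?thesis
    using taboo_add[OF assms(2) dominated_cmult[OF assms(1), of "-1"]] by (simp add: taboo_cmult[of "-1", simplified])
qed

lemma dominated_taboo_pow [simp, intro]: "dominated f \<Longrightarrow> dominated ((taboo ^^ n) f)"
  by (induction n) auto

lemma dominated_step_pow [simp, intro]: "dominated f \<Longrightarrow> dominated ((step ^^ n) f)"
  by (induction n) auto

lemma taboo_pow_add:
  "dominated f \<Longrightarrow> dominated g \<Longrightarrow>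
    (taboo ^^ n) (\<lambda>x. f x + g x) = (\<lambda>x. (taboo ^^ n) f x + (taboo ^^ n) g x)"
  by (induction n) (auto simp: taboo_add)

lemma taboo_pow_cmult: "(taboo ^^ n) (\<lambda>x. c * f x) = (\<lambda>x. c * (taboo ^^ n) f x)"
  by (induction n) (auto simp: taboo_cmult)

lemma taboo_pow_diff:
  "dominated f \<Longrightarrow> dominated g \<Longrightarrow>
    (taboo ^^ n) (\<lambda>x. f x - g x) = (\<lambda>x. (taboo ^^ n) f x - (taboo ^^ n) g x)"
  using taboo_pow_add[of f "\<lambda>x. (-1) * g x" n] taboo_pow_cmult[of n "-1" g]
  by (simp add: dominated_cmult[of g "-1", simplified])

lemma taboo_pow_mono:
  assumes "dominated f" "dominated g" "\<And>x. x \<in> space S \<Longrightarrow> f x \<le> g x" "x \<in> space S"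
  shows "(taboo ^^ n) f x \<le> (taboo ^^ n) g x"
  using assms(4)
proof (induction n arbitrary: x)
  case (Suc n)
  then show ?case using assms by (auto intro!: taboo_mono)
qed (use assms in auto)

lemma taboo_zero: "taboo (\<lambda>x. 0) = (\<lambda>x. 0)"
  by (auto simp: taboo_def step_def fun_eq_iff)

lemma taboo_pow_nonneg:
  assumes "dominated f" "\<And>x. x \<in> space S \<Longrightarrow> 0 \<le> f x" "x \<in> space S"
  shows "0 \<le> (taboo ^^ n) f x"
proof -
  have "(taboo ^^ n) (\<lambda>x. 0) = (\<lambda>x. 0)" by (induction n) (auto simp: taboo_zero)
  then show ?thesis using taboo_pow_mono[of "\<lambda>x. 0" f x n] assms by auto
qed

lemma abs_taboo_pow_le:
  assumes "dominated f" "dominated g" "\<And>x. x \<in> space S \<Longrightarrow> \<bar>f x\<bar> \<le> g x" "x \<in> space S"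
  shows "\<bar>(taboo ^^ n) f x\<bar> \<le> (taboo ^^ n) g x"
proof -
  have *: "f x \<le> g x" "(-1) * g x \<le> f x" if "x \<in> space S" for x
    using assms(3)[OF that] by auto
  have "(taboo ^^ n) f x \<le> (taboo ^^ n) g x" "(taboo ^^ n) (\<lambda>x. (-1) * g x) x \<le> (taboo ^^ n) f x"
    using assms * by (intro taboo_pow_mono dominated_cmult; force)+
  then show ?thesis unfolding taboo_pow_cmult by linarith
qed

lemma step_eq_taboo: "step f = (\<lambda>x. taboo f x + \<beta>t * nui f * indicator C x)"
  by (simp add: taboo_def)

lemma taboo_one: "x \<in> space S \<Longrightarrow> taboo (\<lambda>x. 1) x = 1 - \<beta>t * indicator C x"
  by (simp add: taboo_def step_const)

section \<open>First-entrance and last-exit decompositions\<close>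

text \<open>
  The path is cut at its last regeneration before time \<open>n\<close> in \<open>last_exit\<close>, at its first one in
  \<open>first_entrance\<close>. Both iterate \<open>P = Q + \<beta>t 1\<^sub>C \<nu>\<close>, on the left and on the right respectively.
\<close>

lemma last_exit:
  assumes g: "dominated g" and x: "x \<in> space S"
  shows "(step ^^ n) g x =
    (taboo ^^ n) g x + (\<Sum>k<n. \<beta>t * (step ^^ k) (indicator C) x * nui ((taboo ^^ (n - Suc k)) g))"
  using x
proof (induction n arbitrary: x)
  case (Suc n)
  let ?f = "\<lambda>k x. \<beta>t * nui ((taboo ^^ (n - Suc k)) g) * (step ^^ k) (indicator C) x"
  have "(step ^^ Suc n) g = step (\<lambda>x. (taboo ^^ n) g x + (\<Sum>k<n. ?f k x))"
    using Suc.IH by (simp, intro step_cong) (simp add: mult_ac)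
  also have "\<dots> = (\<lambda>x. step ((taboo ^^ n) g) x + (\<Sum>k<n. step (?f k) x))"
    using g by (subst step_add, simp, force, subst step_sum) (auto intro!: dominated_cmult)
  also have "\<dots> = (\<lambda>x. (taboo ^^ Suc n) g x + \<beta>t * nui ((taboo ^^ n) g) * indicator C x
      + (\<Sum>k<n. \<beta>t * nui ((taboo ^^ (n - Suc k)) g) * (step ^^ Suc k) (indicator C) x))"
    by (subst step_eq_taboo) (simp add: step_cmult)
  finally show ?case
    by (simp add: sum.lessThan_Suc_shift mult_ac del: sum.lessThan_Suc)
qed simp

lemma first_entrance:
  assumes g: "dominated g"
  shows "(step ^^ n) g x =
    (taboo ^^ n) g x + (\<Sum>i<n. \<beta>t * (taboo ^^ i) (indicator C) x * nui ((step ^^ (n - Suc i)) g))"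
  using g
proof (induction n arbitrary: g)
  case (Suc n)
  have "(step ^^ Suc n) g x = (step ^^ n) (step g) x"
    by (simp add: funpow_swap1)
  also have "\<dots> = (taboo ^^ n) (step g) x
      + (\<Sum>i<n. \<beta>t * (taboo ^^ i) (indicator C) x * nui ((step ^^ (n - Suc i)) (step g)))"
    using Suc by auto
  also have "(taboo ^^ n) (step g) x = (taboo ^^ Suc n) g x + \<beta>t * nui g * (taboo ^^ n) (indicator C) x"
    using Suc.prems
    by (subst step_eq_taboo, subst taboo_pow_add)
      (auto simp: taboo_pow_cmult funpow_swap1 intro!: dominated_cmult)
  also have "(\<Sum>i<n. \<beta>t * (taboo ^^ i) (indicator C) x * nui ((step ^^ (n - Suc i)) (step g)))
      = (\<Sum>i<n. \<beta>t * (taboo ^^ i) (indicator C) x * nui ((step ^^ (Suc n - Suc i)) g))"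
  proof (rule sum.cong[OF refl])
    fix i assume "i \<in> {..<n}"
    then have "Suc n - Suc i = Suc (n - Suc i)" by auto
    then show "\<beta>t * (taboo ^^ i) (indicator C) x * nui ((step ^^ (n - Suc i)) (step g))
      = \<beta>t * (taboo ^^ i) (indicator C) x * nui ((step ^^ (Suc n - Suc i)) g)"
      by (simp add: funpow_swap1)
  qed
  finally show ?case by simp
qed simp

lemma taboo_pow_cong:
  "(\<And>x. x \<in> space S \<Longrightarrow> f x = g x) \<Longrightarrow> x \<in> space S \<Longrightarrow> (taboo ^^ n) f x = (taboo ^^ n) g x"
  by (cases n) (simp_all add: funpow_Suc_right taboo_cong[of f g] del: funpow.simps(2))

text \<open>No regeneration has occurred by time \<open>n\<close>, as a complementary probability.\<close>

lemma taboo_pow_one: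
  assumes x: "x \<in> space S"
  shows "(taboo ^^ n) (\<lambda>x. 1) x = 1 - (\<Sum>i<n. \<beta>t * (taboo ^^ i) (indicator C) x)"
proof (induction n)
  case (Suc n)
  have "(taboo ^^ Suc n) (\<lambda>x. 1) x = (taboo ^^ n) (taboo (\<lambda>x. 1)) x"
    by (simp add: funpow_swap1)
  also have "\<dots> = (taboo ^^ n) (\<lambda>x. 1 - \<beta>t * indicator C x) x"
    by (intro taboo_pow_cong taboo_one x)
  also have "\<dots> = (taboo ^^ n) (\<lambda>x. 1) x - \<beta>t * (taboo ^^ n) (indicator C) x"
    by (subst taboo_pow_diff) (auto simp: taboo_pow_cmult intro!: dominated_cmult)
  finally show ?case using Suc.IH by simp
qed simp

text \<open>
  A nonnegative supersolution of the potential equation \<open>W = f + r Q W\<close>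
  dominates the potential of \<open>f\<close>.
\<close>

lemma potential_le_supersolution:
  assumes f: "dominated f" and W: "dominated W" "\<And>x. x \<in> space S \<Longrightarrow> 0 \<le> W x" and r: "0 \<le> r"
    and super: "\<And>x. x \<in> space S \<Longrightarrow> f x + r * taboo W x \<le> W x"
    and x: "x \<in> space S"
  shows "(\<Sum>n<N. r ^ n * (taboo ^^ n) f x) \<le> W x"
  using x
proof (induction N arbitrary: x)
  case (Suc N)
  let ?T = "\<lambda>x. \<Sum>n<N. r ^ n * (taboo ^^ n) f x"
  have dT: "dominated ?T" using f by (intro dominated_sum dominated_cmult) auto
  have "(\<Sum>n<Suc N. r ^ n * (taboo ^^ n) f x) = f x + r * taboo ?T x"
    using f by (subst taboo_sum) (auto simp: sum.lessThan_Suc_shift taboo_cmult sum_distrib_left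
        mult.assoc intro!: dominated_cmult simp del: sum.lessThan_Suc)
  also have "\<dots> \<le> f x + r * taboo W x"
    using r Suc.prems by (intro add_left_mono mult_left_mono taboo_mono dT W Suc.IH) auto
  also have "\<dots> \<le> W x" by (rule super[OF Suc.prems])
  finally show ?case .
qed (use W in simp)

section \<open>Geometric potentials of the killed chain\<close>

text \<open>
  Jensen's inequality for the concave power \<open>t \<mapsto> t powr \<theta>\<close>, for a positive linear functional of mass
  at most \<open>q\<close>: by Young's inequality the power lies below its tangent line at \<open>m\<close>.
\<close>

lemma functional_power_mean:
  fixes L :: "('a \<Rightarrow> real) \<Rightarrow> real"
  assumes mono: "\<And>f g. dominated f \<Longrightarrow> dominated g \<Longrightarrow> (\<And>x. x \<in> space S \<Longrightarrow> f x \<le> g x) \<Longrightarrow> L f \<le> L g"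
    and add: "\<And>f g. dominated f \<Longrightarrow> dominated g \<Longrightarrow> L (\<lambda>x. f x + g x) = L f + L g"
    and cmult: "\<And>c f. L (\<lambda>x. c * f x) = c * L f"
    and mass: "L (\<lambda>x. 1) \<le> q"
    and W: "dominated W" "\<And>x. x \<in> space S \<Longrightarrow> 1 \<le> W x" "L W \<le> q * m"
    and m: "0 < m" and \<theta>: "0 \<le> \<theta>" "\<theta> \<le> 1"
  shows "L (\<lambda>x. W x powr \<theta>) \<le> q * m powr \<theta>"
proof -
  have Wm: "W \<in> borel_measurable S" by (rule dominated_meas[OF W(1)])
  have le: "W x powr \<theta> \<le> W x" if "x \<in> space S" for x
    using W(2)[OF that] \<theta> powr_mono[of \<theta> 1 "W x"] by simp
  have dW: "dominated (\<lambda>x. W x powr \<theta>)"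
    by (rule dominated_mono[OF W(1)]) (use Wm le in auto)
  have young: "m powr (1 - \<theta>) * W x powr \<theta> \<le> \<theta> * W x + (1 - \<theta>) * m * 1" if "x \<in> space S" for x
    using Youngs_inequality_0[of \<theta> "1 - \<theta>" "W x" m] \<theta> m W(2)[OF that] by (simp add: mult_ac)
  have "m powr (1 - \<theta>) * L (\<lambda>x. W x powr \<theta>) \<le> L (\<lambda>x. \<theta> * W x + (1 - \<theta>) * m * 1)"
    unfolding cmult[symmetric]
    by (rule mono[OF _ _ young]) (use W dW in \<open>auto intro!: dominated_cmult dominated_add\<close>)
  also have "\<dots> = \<theta> * L W + (1 - \<theta>) * m * L (\<lambda>x. 1)"
    using add[of "\<lambda>x. \<theta> * W x" "\<lambda>x. (1 - \<theta>) * m * 1"] W(1)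
      cmult[of \<theta> W] cmult[of "(1 - \<theta>) * m" "\<lambda>x. 1"]
    by (simp add: dominated_cmult)
  also have "\<dots> \<le> \<theta> * (q * m) + (1 - \<theta>) * m * q"
    using \<theta> m mass W(3) by (intro add_mono mult_left_mono) auto
  also have "\<dots> = m powr (1 - \<theta>) * (q * m powr \<theta>)"
    using m by (simp add: algebra_simps powr_add[symmetric])
  finally show ?thesis using m by simp
qed

text \<open>
  With $\sigma$ the first time in \<open>C\<close>, counted from \<open>0\<close>, the drift condition makes \<open>entry\<close> a bound for
  the expectation of \<open>(1 / lam)\<close>$^\sigma$.
\<close>

definition entry :: "'a \<Rightarrow> real" where
  "entry x = (if x \<in> C then 1 else V x)"

text \<open>
  The sum of \<open>r\<close>$^n$\<open> V\<close> up to the first visit to \<open>C\<close> is bounded by a multiple of \<open>V - 1\<close> off \<open>C\<close>. The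
  \<open>1\<close> can be subtracted because \<open>V \<ge> 1\<close>; it is the source of the numerator \<open>K - r lam\<close> in the bound
  for an excursion from \<open>C\<close>.
\<close>

definition off :: "'a \<Rightarrow> real" where
  "off x = (if x \<in> C then 0 else V x - 1)"

lemma entry_bounds: "x \<in> space S \<Longrightarrow> 1 \<le> entry x" "x \<in> space S \<Longrightarrow> entry x \<le> V x"
  using V_ge_1[of x] by (auto simp: entry_def)

lemma off_bounds: "x \<in> space S \<Longrightarrow> 0 \<le> off x" "x \<in> space S \<Longrightarrow> off x \<le> V x - 1"
  using V_ge_1[of x] by (auto simp: off_def)

lemma dominated_entry [simp, intro]: "dominated entry"
proof (rule dominated_mono[OF dominated_V])
  show "entry \<in> borel_measurable S" unfolding entry_def[abs_def] by measurable
  show "\<bar>entry x\<bar> \<le> V x" if "x \<in> space S" for x using entry_bounds[OF that] by simp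
qed

lemma dominated_off [simp, intro]: "dominated off"
proof (rule dominated_mono[OF dominated_V])
  show "off \<in> borel_measurable S" unfolding off_def[abs_def] by measurable
  show "\<bar>off x\<bar> \<le> V x" if "x \<in> space S" for x using off_bounds[OF that] by simp
qed

lemma step_off: 
  assumes "x \<in> space S" shows "step off x \<le> step V x - 1"
proof -
  have "step off x \<le> step (\<lambda>x. V x + (-1)) x"
    using off_bounds by (intro step_mono dominated_add) auto
  also have "\<dots> = step V x - 1"
    using assms step_const[of x "-1"] by (subst step_add) auto
  finally show ?thesis .
qed

lemma nui_off_nonneg: "0 \<le> nui off" and nui_V_ge_1: "1 \<le> nui V"
  using nui_nonneg[of off] off_bounds nui_mono[of "\<lambda>x. 1" V] V_ge_1 by auto

lemma nui_V_on_C: "\<beta>t * nui V \<le> K"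
proof -
  obtain x where x: "x \<in> C" using C_nonempty by blast
  have "0 \<le> taboo V x" using V_nonneg C_sub[OF x] by (intro taboo_nonneg) auto
  then show ?thesis using step_V_on_C[OF x] by (simp add: taboo_def x)
qed

text \<open>The exponent for which \<open>r = (1 / lam) powr theta r\<close>.\<close>

definition theta :: "real \<Rightarrow> real" where
  "theta r = ln r / ln (1 / lam)"

text \<open>By Jensen's inequality, a bound for the expectation of \<open>r\<close>$^\sigma$.\<close>

definition weight :: "real \<Rightarrow> 'a \<Rightarrow> real" where
  "weight r x = entry x powr theta r"

text \<open>
  The solution \<open>a\<close> of \<open>r lam (1 + a) = a\<close>, the multiple of \<open>off\<close> that bounds the sum of
  \<open>r\<close>$^n$\<open> V\<close> over an excursion started off \<open>C\<close>.
\<close>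

definition excursion :: "real \<Rightarrow> real" where
  "excursion r = r * lam / (1 - r * lam)"

context
  fixes r :: real
  assumes r1: "1 \<le> r" and rlam: "r * lam < 1"
begin

lemma theta_bounds: "0 \<le> theta r" "theta r \<le> 1"
proof -
  have "0 < ln (1 / lam)" using lam_pos lam_less_1 by simp
  moreover have "ln r \<le> ln (1 / lam)"
    using r1 rlam lam_pos by (simp add: field_simps)
  ultimately show "0 \<le> theta r" "theta r \<le> 1"
    using r1 by (auto simp: theta_def)
qed

lemma powr_theta: "0 < m \<Longrightarrow> m powr theta r = r powr (ln m / ln (1 / lam))"
  using r1 by (simp add: theta_def powr_def)

lemma lam_powr_theta: "lam powr theta r = 1 / r"
proof -
  have "ln (1 / lam) \<noteq> 0" using lam_pos lam_less_1 by simp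
  then have "ln lam / ln (1 / lam) = - 1"
    using lam_pos by (simp add: ln_div)
  then show ?thesis
    using powr_theta[OF lam_pos] r1 by (simp add: powr_minus divide_inverse)
qed

lemma weight_bounds:
  assumes "x \<in> space S" shows "1 \<le> weight r x" "weight r x \<le> V x" "x \<in> C \<Longrightarrow> weight r x = 1"
proof -
  show "1 \<le> weight r x"
    using entry_bounds[OF assms] theta_bounds by (simp add: weight_def ge_one_powr_ge_zero)
  show "weight r x \<le> V x"
    using entry_bounds[OF assms] theta_bounds powr_mono[of "theta r" 1 "entry x"]
    by (simp add: weight_def)
qed (simp add: weight_def entry_def)

lemma dominated_weight [simp, intro]: "dominated (weight r)"
proof (rule dominated_mono[OF dominated_V])
  show "weight r \<in> borel_measurable S"
    unfolding weight_def[abs_def] using dominated_meas[OF dominated_entry] by measurable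
  show "\<bar>weight r x\<bar> \<le> V x" if "x \<in> space S" for x using weight_bounds[OF that] by simp
qed

lemma step_weight_off_C:
  assumes x: "x \<in> space S" "x \<notin> C"
  shows "r * step (weight r) x \<le> weight r x"
proof -
  have "step entry x \<le> lam * V x"
    using step_mono[of entry V x] entry_bounds step_V_off_C[OF x] by auto
  then have "step (\<lambda>x. entry x powr theta r) x \<le> 1 * (lam * V x) powr theta r"
    using lam_pos V_ge_1[OF x(1)] theta_bounds entry_bounds
    by (intro functional_power_mean[where L="\<lambda>f. step f x"] step_mono)
       (auto simp: step_add step_cmult step_const[OF x(1)])
  also have "\<dots> = weight r x / r"
    using x lam_pos V_nonneg[OF x(1)] by (simp add: powr_mult lam_powr_theta weight_def entry_def)
  finally show ?thesis
    using r1 by (simp add: field_simps weight_def[abs_def])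
qed

lemma taboo_weight_on_C:
  assumes x: "x \<in> C" and bt: "\<beta>t < 1"
  shows "r * taboo (weight r) x \<le> (1 - \<beta>t) * r powr alpha1 lam K \<beta>t"
proof -
  let ?m = "(K - \<beta>t) / (1 - \<beta>t)"
  note xs = C_sub[OF x]
  have m: "0 < ?m" using bt K_ge_1 by simp
  have "taboo entry x \<le> taboo V x"
    using entry_bounds xs by (intro taboo_mono) auto
  also have "\<dots> \<le> K - \<beta>t"
  proof -
    have "\<beta>t \<le> \<beta>t * nui V" using bt_pos nui_V_ge_1 by simp
    then show ?thesis using step_V_on_C[OF x] by (simp add: taboo_def x)
  qed
  finally have "taboo (\<lambda>x. entry x powr theta r) x \<le> (1 - \<beta>t) * ?m powr theta r"
    using m theta_bounds entry_bounds bt xs x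
    by (intro functional_power_mean[where L="\<lambda>f. taboo f x"] taboo_mono)
       (auto simp: taboo_add taboo_cmult taboo_one[OF xs])
  then have "r * taboo (weight r) x \<le> r * ((1 - \<beta>t) * r powr (ln ?m / ln (1 / lam)))"
    using r1 powr_theta[OF m] by (simp add: weight_def[abs_def])
  also have "\<dots> = (1 - \<beta>t) * r powr alpha1 lam K \<beta>t"
    using r1 by (simp add: alpha1_def powr_add)
  finally show ?thesis .
qed

lemma nui_weight:
  assumes "nui entry \<le> m"
  shows "r * nui (weight r) \<le> r powr (1 + ln m / ln (1 / lam))"
proof -
  have "1 \<le> nui entry" using nui_mono[of "\<lambda>x. 1" entry] entry_bounds by auto
  then have m: "0 < m" using assms by linarith
  have "nui (\<lambda>x. entry x powr theta r) \<le> 1 * m powr theta r"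
    using m theta_bounds entry_bounds assms
    by (intro functional_power_mean[where L=nui] nui_mono)
       (auto simp: nui_add nui_cmult)
  then show ?thesis
    using r1 powr_theta[OF m] by (simp add: weight_def[abs_def] powr_add)
qed

lemma excursion_nonneg: "0 \<le> excursion r"
  using r1 rlam lam_pos by (simp add: excursion_def)

lemma excursion_off_C:
  assumes x: "x \<in> space S" "x \<notin> C"
  shows "r * step V x + excursion r * (r * step off x) \<le> excursion r * off x"
proof -
  let ?a = "excursion r"
  have a: "r * (1 + ?a) * lam = ?a"
    using rlam by (simp add: excursion_def field_simps)
  have "r * step V x + ?a * (r * step off x) \<le> r * step V x + ?a * (r * (step V x - 1))"
    using r1 excursion_nonneg step_off[OF x(1)] by (intro add_left_mono mult_left_mono) auto
  also have "\<dots> = r * (1 + ?a) * step V x - ?a * r" by (simp add: algebra_simps)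
  also have "\<dots> \<le> r * (1 + ?a) * (lam * V x) - ?a * 1"
    using r1 excursion_nonneg step_V_off_C[OF x]
    by (intro diff_mono mult_left_mono) auto
  also have "\<dots> = ?a * off x"
  proof -
    have "r * (1 + ?a) * (lam * V x) = ?a * V x" using a by (metis mult.assoc)
    then show ?thesis using x by (simp add: off_def right_diff_distrib)
  qed
  finally show ?thesis .
qed

lemma excursion_on_C:
  assumes x: "x \<in> C"
  shows "r * step V x + excursion r * (r * step off x) \<le> r * (K - r * lam) / (1 - r * lam)"
proof -
  let ?a = "excursion r"
  have "r * step V x + ?a * (r * step off x) \<le> r * K + ?a * (r * (K - 1))"
    using r1 excursion_nonneg step_off[OF C_sub[OF x]] step_V_on_C[OF x]
    by (intro add_mono mult_left_mono) auto
  also have "\<dots> = r * (K - r * lam) / (1 - r * lam)"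
    using rlam by (simp add: excursion_def field_simps)
  finally show ?thesis .
qed

end

end

text \<open>
  The residual part of \<open>P\<close> on \<open>C\<close> starts an excursion that returns to \<open>C\<close> without regeneration. Its
  return time has a moment of order \<open>r\<close> of at most \<open>1 - D\<close>, including the probability of this event, and
  the \<open>r\<close>-weighted sum of \<open>V\<close> over it is at most \<open>J D\<close>. The number of such excursions being
  geometric, \<open>1 / D\<close> bounds the total weight of the visits to \<open>C\<close>, and \<open>J\<close> bounds the weighted sum of \<open>V\<close>
  up to the next regeneration.
\<close>

locale killed_chain = drift_chain +
  fixes r D J :: real
  assumes r_gt_1: "1 < r" and r_lam: "r * lam < 1"
    and D_pos: "0 < D" and D_le: "D \<le> \<beta>t" and J_nonneg: "0 \<le> J"
    and weight_C: "\<And>x. x \<in> C \<Longrightarrow> r * taboo (weight r) x \<le> 1 - D"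
    and excursion_C: "\<And>x. x \<in> C \<Longrightarrow>
      r * taboo V x + excursion r * (r * taboo off x) \<le> J * D"
begin

lemma r_ge_1: "1 \<le> r"
  using r_gt_1 by simp

text \<open>The \<open>r\<close>-weighted distribution of the time of the first regeneration.\<close>

lemma entrance_potential:
  assumes x: "x \<in> space S"
  shows "(\<Sum>i<N. r ^ i * (\<beta>t * (taboo ^^ i) (indicator C) x)) \<le> \<beta>t / D * weight r x"
proof -
  let ?W = "\<lambda>x. 1 / D * weight r x"
  have dW: "dominated ?W" using r_ge_1 r_lam by (intro dominated_cmult) auto
  have W0: "0 \<le> ?W x" if "x \<in> space S" for x
    using weight_bounds(1)[OF r_ge_1 r_lam that] D_pos by (intro mult_nonneg_nonneg) auto
  have tW: "taboo ?W = (\<lambda>x. 1 / D * taboo (weight r) x)" by (rule taboo_cmult)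
  have super: "indicator C x + r * taboo ?W x \<le> ?W x" if x: "x \<in> space S" for x
  proof (cases "x \<in> C")
    case True
    have "r * taboo ?W x = (r * taboo (weight r) x) / D" unfolding tW by simp
    also have "\<dots> \<le> (1 - D) / D"
      using weight_C[OF True] D_pos by (intro divide_right_mono) auto
    finally show ?thesis
      using True weight_bounds(3)[OF r_ge_1 r_lam x True] D_pos by (simp add: diff_divide_distrib)
  next
    case False
    have "r * taboo ?W x = (r * step (weight r) x) / D"
      using False unfolding tW by (simp add: taboo_def)
    also have "\<dots> \<le> weight r x / D"
      using step_weight_off_C[OF r_ge_1 r_lam x False] D_pos by (intro divide_right_mono) auto
    finally show ?thesis using False by simp
  qed
  have "(\<Sum>i<N. r ^ i * (taboo ^^ i) (indicator C) x) \<le> ?W x"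
    by (rule potential_le_supersolution[OF _ dW W0 _ super x]) (use r_gt_1 in auto)
  then have "\<beta>t * (\<Sum>i<N. r ^ i * (taboo ^^ i) (indicator C) x) \<le> \<beta>t * ?W x"
    using bt_pos by (intro mult_left_mono) auto
  then show ?thesis by (simp add: sum_distrib_left mult_ac)
qed

lemma V_potential:
  assumes x: "x \<in> space S"
  shows "(\<Sum>n<N. r ^ n * (taboo ^^ n) (\<lambda>x. r * taboo V x) x) \<le> excursion r * off x + J * weight r x"
proof (rule potential_le_supersolution[OF _ _ _ _ _ x])
  let ?W = "\<lambda>x. excursion r * off x + J * weight r x"
  show "dominated ?W" using r_ge_1 r_lam by (intro dominated_add dominated_cmult) auto
  show "0 \<le> ?W x" if "x \<in> space S" for x
    using weight_bounds(1)[OF r_ge_1 r_lam that] off_bounds[OF that] J_nonneg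
      excursion_nonneg[OF r_ge_1 r_lam] by (intro add_nonneg_nonneg mult_nonneg_nonneg) auto
  have W: "taboo ?W = (\<lambda>x. excursion r * taboo off x + J * taboo (weight r) x)"
    using r_ge_1 r_lam by (subst taboo_add) (auto intro!: dominated_cmult simp: taboo_cmult)
  show "r * taboo V x + r * taboo ?W x \<le> ?W x" if x: "x \<in> space S" for x
  proof (cases "x \<in> C")
    case True
    have "J * (r * taboo (weight r) x) \<le> J * (1 - D)"
      using weight_C[OF True] J_nonneg by (rule mult_left_mono)
    then show ?thesis
      using excursion_C[OF True] weight_bounds(3)[OF r_ge_1 r_lam x True] True
      unfolding W by (simp add: off_def algebra_simps)
  next
    case False
    have "J * (r * step (weight r) x) \<le> J * weight r x"
      using step_weight_off_C[OF r_ge_1 r_lam x False] J_nonneg by (rule mult_left_mono)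
    then show ?thesis
      using excursion_off_C[OF r_ge_1 r_lam x False] False
      unfolding W by (simp add: taboo_def algebra_simps)
  qed
qed (use r_gt_1 in \<open>auto intro!: dominated_cmult\<close>)

lemma taboo_pow_shift: "(taboo ^^ n) (\<lambda>x. r * taboo V x) = (\<lambda>x. r * (taboo ^^ Suc n) V x)"
  by (simp add: taboo_pow_cmult funpow_swap1)

lemma killed_V_le:
  assumes x: "x \<in> space S"
  shows "r ^ Suc n * (taboo ^^ Suc n) V x \<le> excursion r * off x + J * weight r x"
proof -
  have "r ^ n * (taboo ^^ n) (\<lambda>x. r * taboo V x) x
      \<le> (\<Sum>n<Suc n. r ^ n * (taboo ^^ n) (\<lambda>x. r * taboo V x) x)"
    using r_gt_1 x V_nonneg
    by (intro member_le_sum mult_nonneg_nonneg taboo_pow_nonneg taboo_nonneg dominated_cmult) auto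
  also note V_potential[OF x]
  finally show ?thesis by (simp only: taboo_pow_shift) (simp add: mult_ac)
qed

text \<open>The bound for the \<open>r\<close>-weighted sum of \<open>V\<close> over a full cycle, which starts from \<open>\<nu>\<close>.\<close>

definition killed_total :: real where
  "killed_total = nui V + excursion r * nui off + J * nui (weight r)"

lemma killed_total_bound:
  "(\<Sum>l<N. r ^ l * nui ((taboo ^^ l) V)) \<le> killed_total"
proof (cases N)
  case 0
  have "0 \<le> nui (weight r)"
    using weight_bounds(1)[OF r_ge_1 r_lam] by (intro nui_nonneg) force
  then show ?thesis
    using 0 nui_V_ge_1 nui_off_nonneg J_nonneg excursion_nonneg[OF r_ge_1 r_lam]
    by (simp add: killed_total_def add_nonneg_nonneg)
next
  case (Suc M)
  have d: "dominated (\<lambda>x. r ^ n * (taboo ^^ n) (\<lambda>x. r * taboo V x) x)" for n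
    by (intro dominated_cmult dominated_taboo_pow) auto
  have "(\<Sum>l<Suc M. r ^ l * nui ((taboo ^^ l) V))
      = nui V + (\<Sum>n<M. r ^ n * nui ((taboo ^^ n) (\<lambda>x. r * taboo V x)))"
    by (simp add: sum.lessThan_Suc_shift taboo_pow_shift nui_cmult mult_ac del: sum.lessThan_Suc)
  also have "(\<Sum>n<M. r ^ n * nui ((taboo ^^ n) (\<lambda>x. r * taboo V x)))
      = nui (\<lambda>x. \<Sum>n<M. r ^ n * (taboo ^^ n) (\<lambda>x. r * taboo V x) x)"
    using d by (simp add: nui_sum nui_cmult)
  also have "\<dots> \<le> nui (\<lambda>x. excursion r * off x + J * weight r x)"
    using r_ge_1 r_lam
    by (intro nui_mono V_potential dominated_sum d dominated_add dominated_cmult) auto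
  also have "\<dots> = excursion r * nui off + J * nui (weight r)"
    using r_ge_1 r_lam by (subst nui_add) (auto intro!: dominated_cmult simp: nui_cmult)
  finally show ?thesis using Suc by (simp add: killed_total_def)
qed

lemma nui_killed_nonneg: "0 \<le> nui ((taboo ^^ l) V)"
  using V_nonneg by (intro nui_nonneg taboo_pow_nonneg) auto

lemma summable_killed: "summable (\<lambda>l. r ^ l * nui ((taboo ^^ l) V))"
  by (rule summableI_nonneg_bounded[where x=killed_total])
    (use r_gt_1 nui_killed_nonneg killed_total_bound in simp_all)

lemma entrance_nonneg: "x \<in> space S \<Longrightarrow> 0 \<le> \<beta>t * (taboo ^^ i) (indicator C) x"
  using bt_pos by (intro mult_nonneg_nonneg taboo_pow_nonneg) auto

lemma summable_entrance:
  "x \<in> space S \<Longrightarrow> summable (\<lambda>i. r ^ i * (\<beta>t * (taboo ^^ i) (indicator C) x))"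
  using r_gt_1 entrance_nonneg
  by (intro summableI_nonneg_bounded[OF _ entrance_potential]) (auto intro!: mult_nonneg_nonneg[of "r ^ _"])

text \<open>
  A crude multiple of \<open>V\<close> for the pointwise decay of the killed chain. The summand \<open>1\<close> is the
  value at time \<open>0\<close>, which the potential of \<open>r Q V\<close> omits.
\<close>

definition killed_const :: real where
  "killed_const = 1 + excursion r + J"

lemma killed_decay:
  assumes x: "x \<in> space S"
  shows "(taboo ^^ n) V x \<le> killed_const * V x * (1 / r) ^ n"
proof (cases n)
  case 0
  have "1 * V x \<le> killed_const * V x"
    using V_nonneg[OF x] J_nonneg excursion_nonneg[OF r_ge_1 r_lam]
    by (intro mult_right_mono) (auto simp: killed_const_def)
  then show ?thesis using 0 by simp
next
  case (Suc m)
  have "r ^ n * (taboo ^^ n) V x \<le> excursion r * off x + J * weight r x"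
    unfolding Suc by (rule killed_V_le[OF x])
  also have "\<dots> \<le> excursion r * V x + J * V x"
    using off_bounds[OF x] weight_bounds(2)[OF r_ge_1 r_lam x] J_nonneg excursion_nonneg[OF r_ge_1 r_lam]
    by (intro add_mono mult_left_mono) auto
  also have "\<dots> \<le> killed_const * V x"
    using V_nonneg[OF x] by (simp add: killed_const_def algebra_simps)
  finally have "r ^ n * (taboo ^^ n) V x \<le> killed_const * V x" .
  then show ?thesis using r_gt_1 by (simp add: field_simps power_one_over)
qed

lemma killed_tendsto_0:
  assumes f: "dominated f" and x: "x \<in> space S"
  shows "(\<lambda>n. (taboo ^^ n) f x) \<longlonglongrightarrow> 0"
proof -
  obtain c where c: "0 \<le> c" "\<And>x. x \<in> space S \<Longrightarrow> \<bar>f x\<bar> \<le> c * V x"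
    using f by (metis dominatedE)
  have le: "\<bar>(taboo ^^ n) f x\<bar> \<le> c * (killed_const * V x) * (1 / r) ^ n" for n
  proof -
    have "\<bar>(taboo ^^ n) f x\<bar> \<le> (taboo ^^ n) (\<lambda>x. c * V x) x"
      by (rule abs_taboo_pow_le) (use f c x in \<open>auto intro!: dominated_cmult\<close>)
    then show ?thesis
      using mult_left_mono[OF killed_decay[OF x, of n] c(1)] by (simp add: taboo_pow_cmult mult_ac)
  qed
  have "(\<lambda>n. c * (killed_const * V x) * (1 / r) ^ n) \<longlonglongrightarrow> 0"
    by (rule tendsto_mult_right_zero[OF LIMSEQ_realpow_zero]) (use r_gt_1 in auto)
  then show ?thesis
    by (rule Lim_null_comparison[rotated]) (simp add: le)
qed

text \<open>The chain regenerates almost surely.\<close>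

lemma entrance_sums_1:
  assumes x: "x \<in> space S"
  shows "(\<lambda>i. \<beta>t * (taboo ^^ i) (indicator C) x) sums 1"
proof -
  have "(\<lambda>n. 1 - (taboo ^^ n) (\<lambda>x. 1) x) \<longlonglongrightarrow> 1 - 0"
    by (intro tendsto_diff tendsto_const killed_tendsto_0 x dominated_const)
  then show ?thesis by (simp add: sums_def taboo_pow_one[OF x])
qed

text \<open>The expected sum of \<open>f\<close> over a cycle: up to a factor, the stationary distribution.\<close>

definition killed_mean :: "('a \<Rightarrow> real) \<Rightarrow> real" where
  "killed_mean f = (\<Sum>l. nui ((taboo ^^ l) f))"

lemma abs_nui_killed_le:
  assumes "dominated f" "\<And>x. x \<in> space S \<Longrightarrow> \<bar>f x\<bar> \<le> c * V x"
  shows "\<bar>nui ((taboo ^^ l) f)\<bar> \<le> c * nui ((taboo ^^ l) V)"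
proof -
  have "(taboo ^^ l) f x \<le> c * (taboo ^^ l) V x" "(-c) * (taboo ^^ l) V x \<le> (taboo ^^ l) f x"
    if "x \<in> space S" for x
    using abs_taboo_pow_le[of f "\<lambda>x. c * V x" x l] assms that
    by (auto simp: taboo_pow_cmult dominated_cmult)
  then have "nui ((taboo ^^ l) f) \<le> nui (\<lambda>x. c * (taboo ^^ l) V x)"
    "nui (\<lambda>x. (-c) * (taboo ^^ l) V x) \<le> nui ((taboo ^^ l) f)"
    using assms(1) by (intro nui_mono dominated_cmult dominated_taboo_pow; auto)+
  then show ?thesis unfolding nui_cmult by (simp add: abs_le_iff)
qed

lemma summable_nui_killed_V: "summable (\<lambda>l. nui ((taboo ^^ l) V))"
proof (rule summable_comparison_test'[OF summable_killed, of 0])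
  fix l :: nat
  have "1 * nui ((taboo ^^ l) V) \<le> r ^ l * nui ((taboo ^^ l) V)"
    using r_ge_1 nui_killed_nonneg by (intro mult_right_mono) auto
  then show "norm (nui ((taboo ^^ l) V)) \<le> r ^ l * nui ((taboo ^^ l) V)"
    using nui_killed_nonneg[of l] by simp
qed

lemma summable_nui_killed:
  assumes "dominated f" shows "summable (\<lambda>l. nui ((taboo ^^ l) f))"
proof -
  obtain c where c: "0 \<le> c" "\<And>x. x \<in> space S \<Longrightarrow> \<bar>f x\<bar> \<le> c * V x"
    using assms by (metis dominatedE)
  show ?thesis
    by (rule summable_comparison_test'[OF summable_mult[OF summable_nui_killed_V, of c], of 0])
      (simp add: abs_nui_killed_le[OF assms c(2)])
qed

end

section \<open>Measures from positive functionals\<close>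

text \<open>
  The bounded-measurable form of the Daniell representation. Additivity on disjoint sets comes from
  linearity, continuity at the empty set from bounded convergence; the integral formula follows by
  building functions from indicators.
\<close>

lemma functional_as_integral:
  fixes S :: "'a measure" and L :: "('a \<Rightarrow> real) \<Rightarrow> real"
  defines "bdd \<equiv> \<lambda>f c. f \<in> borel_measurable S \<and> (\<forall>x\<in>space S. \<bar>f x\<bar> \<le> (c::real))"
  assumes pos: "\<And>f c. bdd f c \<Longrightarrow> (\<And>x. x \<in> space S \<Longrightarrow> 0 \<le> f x) \<Longrightarrow> 0 \<le> L f"
    and add: "\<And>f g c. bdd f c \<Longrightarrow> bdd g c \<Longrightarrow> L (\<lambda>x. f x + g x) = L f + L g"
    and cmult: "\<And>f c a. bdd f c \<Longrightarrow> L (\<lambda>x. a * f x) = a * L f"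
    and one: "L (\<lambda>x. 1) = 1"
    and conv: "\<And>f g c. (\<And>i. bdd (f i) c) \<Longrightarrow> bdd g c \<Longrightarrow>
      (\<And>x. x \<in> space S \<Longrightarrow> (\<lambda>i::nat. f i x) \<longlonglongrightarrow> g x) \<Longrightarrow> (\<lambda>i. L (f i)) \<longlonglongrightarrow> L g"
  obtains \<mu> where "sets \<mu> = sets S" "prob_space \<mu>"
    "\<And>f c. bdd f c \<Longrightarrow> (\<And>x. 0 \<le> f x) \<Longrightarrow> (\<integral>x. f x \<partial>\<mu>) = L f"
proof -
  define \<mu> where "\<mu> = measure_of (space S) (sets S) (\<lambda>A. ennreal (L (indicator A)))"
  have bi: "bdd (indicator A) 1" if "A \<in> sets S" for A
    using that by (auto simp: bdd_def indicator_def)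
  have b0: "bdd (\<lambda>x. 0) 1" by (simp add: bdd_def)
  have L0: "L (\<lambda>x. 0) = 0" using cmult[OF b0, of 0] by simp
  have Li: "0 \<le> L (indicator A)" if "A \<in> sets S" for A
    using pos[OF bi[OF that]] by simp
  have em: "L (indicator {}) = 0"
    using L0 by (simp add: indicator_def[abs_def])
  have posi: "positive (sets S) (\<lambda>A. ennreal (L (indicator A)))"
    using em by (simp add: positive_def)
  have addi: "additive (sets S) (\<lambda>A. ennreal (L (indicator A)))"
    unfolding additive_def
  proof (intro ballI impI)
    fix A B assume AB: "A \<in> sets S" "B \<in> sets S" "A \<inter> B = {}"
    have "indicator (A \<union> B) = (\<lambda>x. indicator A x + indicator B x :: real)"
      using AB(3) by (intro ext) (auto simp: indicator_def)
    then show "ennreal (L (indicator (A \<union> B))) = ennreal (L (indicator A)) + ennreal (L (indicator B))"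
      using add[OF bi[OF AB(1)] bi[OF AB(2)]] Li AB by (simp add: ennreal_plus)
  qed
  have ca: "countably_additive (sets S) (\<lambda>A. ennreal (L (indicator A)))"
  proof (rule sets.empty_continuous_imp_countably_additive[OF posi addi])
    fix A :: "nat \<Rightarrow> 'a set" assume A: "range A \<subseteq> sets S" "decseq A" "(\<Inter>i. A i) = {}"
    have "(\<lambda>i. L (indicator (A i))) \<longlonglongrightarrow> L (\<lambda>x. 0)"
    proof (rule conv[OF _ b0])
      show "bdd (indicator (A i)) 1" for i using A(1) by (intro bi) auto
      show "(\<lambda>i. indicator (A i) x) \<longlonglongrightarrow> (0::real)" for x
        using LIMSEQ_indicator_decseq[OF A(2), of x] A(3) by simp
    qed
    then show "(\<lambda>i. ennreal (L (indicator (A i)))) \<longlonglongrightarrow> 0"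
      unfolding L0 by (simp add: tendsto_ennreal_iff[of _ _ 0, simplified] flip: ennreal_0)
  qed simp
  have sets: "sets \<mu> = sets S" by (simp add: \<mu>_def)
  then have space: "space \<mu> = space S" by (rule sets_eq_imp_space_eq)
  have em\<mu>: "emeasure \<mu> A = ennreal (L (indicator A))" if "A \<in> sets S" for A
    unfolding \<mu>_def by (rule emeasure_measure_of_sigma[OF sets.sigma_algebra_axioms posi ca that])
  have LS: "L (indicator (space S)) = 1"
  proof -
    have "(\<lambda>i::nat. L (indicator (space S))) \<longlonglongrightarrow> L (\<lambda>x. 1)"
      by (rule conv[of _ 1]) (auto simp: bdd_def)
    then show ?thesis using one LIMSEQ_unique[OF tendsto_const] by fastforce
  qed
  have prob: "prob_space \<mu>"
    by (rule prob_spaceI) (simp add: em\<mu> space LS)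
  interpret prob_space \<mu> by (rule prob)
  have int: "(\<integral>x. f x \<partial>\<mu>) = L f" if f: "bdd f c" and nn: "\<And>x. 0 \<le> f x" for f c
  proof -
    have "f \<in> borel_measurable S" using f by (simp add: bdd_def)
    then have "\<forall>c. bdd f c \<longrightarrow> (\<integral>x. f x \<partial>\<mu>) = L f"
      using nn
    proof (induction f rule: borel_measurable_induct_real)
      case (set A)
      then show ?case
        using em\<mu>[OF set] Li[OF set] sets by (simp add: measure_def space)
    next
      case (mult u a)
      show ?case
      proof (intro allI impI)
        fix c assume c: "bdd (\<lambda>x. a * u x) c"
        show "(\<integral>x. a * u x \<partial>\<mu>) = L (\<lambda>x. a * u x)"
        proof (cases "a = 0")
          case False
          with mult c have "bdd u (c / a)"
            by (auto simp: bdd_def abs_mult field_simps)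
          with mult cmult[OF this] show ?thesis by auto
        qed (simp add: L0)
      qed
    next
      case (add u v)
      show ?case
      proof (intro allI impI)
        fix c assume c: "bdd (\<lambda>x. v x + u x) c"
        have u: "u x \<le> v x + u x" "v x \<le> v x + u x" for x
          using add.hyps by auto
        have b: "bdd u c" "bdd v c"
          using c add.hyps unfolding bdd_def by (auto intro: order_trans[OF u(1)] order_trans[OF u(2)])
        then have "integrable \<mu> u" "integrable \<mu> v"
          using sets by (auto simp: bdd_def space cong: measurable_cong_sets
            intro!: integrable_const_bound[where B=c] AE_I2)
        then show "(\<integral>x. v x + u x \<partial>\<mu>) = L (\<lambda>x. v x + u x)"
          using add.IH b assms(3)[OF b(2,1)] by auto
      qed
    next
      case (seq U)
      show ?case
      proof (intro allI impI)
        fix c assume c: "bdd f c"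
        have Ule: "U i x \<le> f x" if "x \<in> space S" for i x
          using seq.hyps(3) seq.hyps(4)[OF that]
          by (intro incseq_le[of "\<lambda>i. U i x"]) (auto simp: incseq_def le_fun_def)
        have U: "bdd (U i) c" for i
          using c seq.hyps(1,2) Ule unfolding bdd_def by (fastforce intro: order_trans[OF Ule])
        have "(\<lambda>i. L (U i)) \<longlonglongrightarrow> L f" by (rule conv[OF U c]) (rule seq.hyps(4))
        moreover have "(\<lambda>i. \<integral>x. U i x \<partial>\<mu>) \<longlonglongrightarrow> (\<integral>x. f x \<partial>\<mu>)"
          by (rule integral_dominated_convergence[where w="\<lambda>x. c"])
            (use U c seq.hyps(4) sets in \<open>auto simp: bdd_def space intro!: AE_I2 cong: measurable_cong_sets\<close>)
        moreover have "(\<integral>x. U i x \<partial>\<mu>) = L (U i)" for i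
          using seq.IH[of i] U[of i] by blast
        ultimately show "(\<integral>x. f x \<partial>\<mu>) = L f"
          by (simp add: LIMSEQ_unique)
      qed
    qed
    with f show ?thesis by blast
  qed
  show ?thesis by (rule that[OF sets prob int])
qed

context drift_chain
begin

lemma integral_tendsto:
  assumes M: "sets M = sets S" "integrable M V"
    and f: "\<And>i. dominated (f i)" "dominated g"
    and le: "\<And>i x. x \<in> space S \<Longrightarrow> \<bar>f i x\<bar> \<le> c * V x"
    and lim: "\<And>x. x \<in> space S \<Longrightarrow> (\<lambda>i::nat. f i x) \<longlonglongrightarrow> g x"
  shows "(\<lambda>i. \<integral>x. f i x \<partial>M) \<longlonglongrightarrow> (\<integral>x. g x \<partial>M)"
proof (rule integral_dominated_convergence[where w="\<lambda>x. c * V x"])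
  note sp = sets_eq_imp_space_eq[OF M(1)]
  show "g \<in> borel_measurable M" "f i \<in> borel_measurable M" for i
    using f M(1) by (auto dest!: dominated_meas cong: measurable_cong_sets)
  show "integrable M (\<lambda>x. c * V x)" using M(2) by simp
  show "AE x in M. (\<lambda>i. f i x) \<longlonglongrightarrow> g x" using lim by (auto simp: sp)
  show "AE x in M. norm (f i x) \<le> c * V x" for i using le by (auto simp: sp)
qed

lemma nui_tendsto:
  assumes "\<And>i. dominated (f i)" "dominated g"
    "\<And>i x. x \<in> space S \<Longrightarrow> \<bar>f i x\<bar> \<le> c * V x"
    "\<And>x. x \<in> space S \<Longrightarrow> (\<lambda>i::nat. f i x) \<longlonglongrightarrow> g x"
  shows "(\<lambda>i. nui (f i)) \<longlonglongrightarrow> nui g"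
  unfolding nui_def by (rule integral_tendsto[OF sets_nu integrable_V_nu assms])

lemma taboo_tendsto:
  assumes "\<And>i. dominated (f i)" "dominated g"
    "\<And>i x. x \<in> space S \<Longrightarrow> \<bar>f i x\<bar> \<le> c * V x"
    "\<And>x. x \<in> space S \<Longrightarrow> (\<lambda>i::nat. f i x) \<longlonglongrightarrow> g x"
    and x: "x \<in> space S"
  shows "(\<lambda>i. taboo (f i) x) \<longlonglongrightarrow> taboo g x"
proof -
  have "(\<lambda>i. step (f i) x) \<longlonglongrightarrow> step g x"
    using integral_tendsto[OF sets_P[OF x] integrable_V_P[OF x] assms(1-4)] x by (simp add: step_def)
  then show ?thesis
    unfolding taboo_def by (intro tendsto_intros nui_tendsto[OF assms(1-4)])
qed

end

context killed_chain
begin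

lemma taboo_pow_tendsto:
  assumes f: "\<And>i. dominated (f i)" "dominated g"
    and le: "\<And>i x. x \<in> space S \<Longrightarrow> \<bar>f i x\<bar> \<le> c * V x"
    and lim: "\<And>x. x \<in> space S \<Longrightarrow> (\<lambda>i::nat. f i x) \<longlonglongrightarrow> g x"
    and x: "x \<in> space S"
  shows "(\<lambda>i. (taboo ^^ n) (f i) x) \<longlonglongrightarrow> (taboo ^^ n) g x"
  using x
proof (induction n arbitrary: x)
  case (Suc n)
  have c: "0 \<le> c" using le[OF Suc.prems, of 0] V_ge_1[OF Suc.prems]
    by (smt (verit) mult_less_0_iff)
  have "\<bar>(taboo ^^ n) (f i) y\<bar> \<le> c * killed_const * V y" if y: "y \<in> space S" for i y
  proof -
    have "\<bar>(taboo ^^ n) (f i) y\<bar> \<le> (taboo ^^ n) (\<lambda>x. c * V x) y"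
      by (rule abs_taboo_pow_le) (use f le y in \<open>auto intro!: dominated_cmult\<close>)
    also have "\<dots> \<le> c * (killed_const * V y * (1 / r) ^ n)"
      unfolding taboo_pow_cmult using killed_decay[OF y] c by (intro mult_left_mono) auto
    also have "\<dots> \<le> c * (killed_const * V y * 1)"
      using V_nonneg[OF y] c J_nonneg excursion_nonneg[OF r_ge_1 r_lam] r_gt_1
      by (intro mult_left_mono power_le_one mult_nonneg_nonneg) (auto simp: killed_const_def)
    finally show ?thesis by (simp add: mult_ac)
  qed
  then show ?case
    using f Suc by (simp, intro taboo_tendsto[where c="c * killed_const"]) auto
qed (use lim in simp)

lemma killed_mean_tendsto:
  assumes f: "\<And>i. dominated (f i)" "dominated g"
    and le: "\<And>i x. x \<in> space S \<Longrightarrow> \<bar>f i x\<bar> \<le> c * V x"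
    and lim: "\<And>x. x \<in> space S \<Longrightarrow> (\<lambda>i::nat. f i x) \<longlonglongrightarrow> g x"
  shows "(\<lambda>i. killed_mean (f i)) \<longlonglongrightarrow> killed_mean g"
  unfolding killed_mean_def
proof (rule tannerys_theorem[THEN conjunct2, THEN conjunct2])
  obtain x where x: "x \<in> space S" using C_nonempty C_sub by blast
  have c: "0 \<le> c" using le[OF x, of 0] V_ge_1[OF x] by (smt (verit) mult_less_0_iff)
  show "eventually (\<lambda>(l, i). norm (nui ((taboo ^^ l) (f i))) \<le> c * nui ((taboo ^^ l) V))
      (at_top \<times>\<^sub>F sequentially)"
    using abs_nui_killed_le[OF f(1) le] by (intro always_eventually) auto
  show "summable (\<lambda>l. c * nui ((taboo ^^ l) V))"
    by (intro summable_mult summable_nui_killed_V)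
  fix l
  show "(\<lambda>i. nui ((taboo ^^ l) (f i))) \<longlonglongrightarrow> nui ((taboo ^^ l) g)"
  proof (rule nui_tendsto)
    fix i y assume y: "y \<in> space S"
    have "\<bar>(taboo ^^ l) (f i) y\<bar> \<le> (taboo ^^ l) (\<lambda>x. c * V x) y"
      by (rule abs_taboo_pow_le) (use f le y in \<open>auto intro!: dominated_cmult\<close>)
    also have "\<dots> \<le> c * (killed_const * V y * (1 / r) ^ l)"
      unfolding taboo_pow_cmult using killed_decay[OF y] c by (intro mult_left_mono) auto
    finally show "\<bar>(taboo ^^ l) (f i) y\<bar> \<le> (c * killed_const * (1 / r) ^ l) * V y"
      by (simp add: mult_ac)
  qed (use f taboo_pow_tendsto[OF f le lim] in auto)
qed simp

lemma killed_mean_cmult: "dominated f \<Longrightarrow> killed_mean (\<lambda>x. a * f x) = a * killed_mean f"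
  unfolding killed_mean_def taboo_pow_cmult nui_cmult by (rule suminf_mult[OF summable_nui_killed])

lemma killed_mean_add:
  "dominated f \<Longrightarrow> dominated g \<Longrightarrow> killed_mean (\<lambda>x. f x + g x) = killed_mean f + killed_mean g"
  unfolding killed_mean_def
  by (simp add: taboo_pow_add nui_add suminf_add summable_nui_killed)

lemma killed_mean_nonneg:
  "dominated f \<Longrightarrow> (\<And>x. x \<in> space S \<Longrightarrow> 0 \<le> f x) \<Longrightarrow> 0 \<le> killed_mean f"
  unfolding killed_mean_def
  by (intro suminf_nonneg summable_nui_killed nui_nonneg taboo_pow_nonneg)

lemma killed_mean_cong:
  "(\<And>x. x \<in> space S \<Longrightarrow> f x = g x) \<Longrightarrow> killed_mean f = killed_mean g"
  unfolding killed_mean_def using nui_cong taboo_pow_cong by (metis (no_types, lifting))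

lemma killed_mean_mono:
  assumes "dominated f" "dominated g" "\<And>x. x \<in> space S \<Longrightarrow> f x \<le> g x"
  shows "killed_mean f \<le> killed_mean g"
  unfolding killed_mean_def using assms
  by (intro suminf_le summable_nui_killed nui_mono taboo_pow_mono) auto

lemma killed_mean_1: "1 \<le> killed_mean (\<lambda>x. 1)"
proof -
  have "(\<Sum>l<1. nui ((taboo ^^ l) (\<lambda>x. 1))) \<le> killed_mean (\<lambda>x. 1)"
    unfolding killed_mean_def
    by (intro sum_le_suminf summable_nui_killed ballI nui_nonneg taboo_pow_nonneg) auto
  then show ?thesis by simp
qed

text \<open>
  One step of the chain removes the start of the cycle from the sum and adds, at each regeneration, a start of
  the next cycle.
\<close>

lemma killed_mean_step:
  assumes f: "dominated f"
  shows "killed_mean (step f) = killed_mean f - nui f + \<beta>t * nui f * killed_mean (indicator C)"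
proof -
  have "killed_mean (step f) = killed_mean (taboo f) + \<beta>t * nui f * killed_mean (indicator C)"
    using f by (subst step_eq_taboo, subst killed_mean_add)
      (auto simp: killed_mean_cmult intro!: dominated_cmult)
  moreover have "killed_mean (taboo f) = killed_mean f - nui f"
    using suminf_split_head[OF summable_nui_killed[OF f]]
    by (simp add: killed_mean_def funpow_swap1)
  ultimately show ?thesis by simp
qed

text \<open>A cycle contains exactly one regeneration; compare the two sides of the last lemma at \<open>f = 1\<close>.\<close>

lemma killed_mean_C: "\<beta>t * killed_mean (indicator C) = 1"
  using killed_mean_step[of "\<lambda>x. 1"] killed_mean_cong[of "step (\<lambda>x. 1)" "\<lambda>x. 1"]
  by (simp add: step_const)

end

section \<open>The stationary distribution\<close>

context drift_chain
begin

lemma abs_step_le: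
  assumes f: "f \<in> borel_measurable S" "\<And>x. x \<in> space S \<Longrightarrow> \<bar>f x\<bar> \<le> c" and x: "x \<in> space S"
  shows "\<bar>step f x\<bar> \<le> c"
proof -
  have d: "dominated f" by (rule dominated_bounded[OF f])
  have *: "f y \<le> c" "- c \<le> f y" if "y \<in> space S" for y
    using f(2)[OF that] by auto
  have "step f x \<le> step (\<lambda>x. c) x" "step (\<lambda>x. - c) x \<le> step f x"
    by (rule step_mono, use d * in auto)+
  then show ?thesis using step_const[OF x] by (simp add: abs_le_iff)
qed

lemma abs_step_pow_le:
  assumes f: "f \<in> borel_measurable S" "\<And>x. x \<in> space S \<Longrightarrow> \<bar>f x\<bar> \<le> c" and x: "x \<in> space S"
  shows "\<bar>(step ^^ n) f x\<bar> \<le> c"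
  using x
proof (induction n arbitrary: x)
  case (Suc n)
  have "(step ^^ n) f \<in> borel_measurable S"
    using dominated_meas[OF dominated_step_pow[OF dominated_bounded[OF f]]] .
  then show ?case using Suc by (simp add: abs_step_le)
qed (use f in simp)

lemma abs_taboo_pow_bounded:
  assumes f: "f \<in> borel_measurable S" "\<And>x. x \<in> space S \<Longrightarrow> \<bar>f x\<bar> \<le> c" and x: "x \<in> space S"
  shows "\<bar>(taboo ^^ n) f x\<bar> \<le> c"
proof -
  have "0 \<le> c" using f(2)[OF x] by simp
  have "\<bar>(taboo ^^ n) f x\<bar> \<le> (taboo ^^ n) (\<lambda>x. c * 1) x"
    by (rule abs_taboo_pow_le) (use f dominated_bounded[OF f] x in auto)
  also have "\<dots> = c * (taboo ^^ n) (\<lambda>x. 1) x" by (rule fun_cong[OF taboo_pow_cmult])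
  also have "(taboo ^^ n) (\<lambda>x. 1) x \<le> 1"
    unfolding taboo_pow_one[OF x] using bt_pos x
    by (simp add: sum_nonneg taboo_pow_nonneg)
  finally show ?thesis using \<open>0 \<le> c\<close> by (simp add: mult_left_mono)
qed

end

context killed_chain
begin

lemma killed_mean_step_eq: "dominated f \<Longrightarrow> killed_mean (step f) = killed_mean f"
  using killed_mean_step[of f] killed_mean_C by (metis add.commute diff_add_cancel mult.assoc mult.commute mult.right_neutral)

text \<open>
  The normalised expected occupation of a cycle, started from \<open>\<nu>\<close> and ended by the next
  regeneration, is invariant: shifting a cycle by one step exchanges its two regeneration times.
\<close>

lemma stationary_exists: "\<exists>\<pi>. stationary S P \<pi>"
proof -
  let ?m = "killed_mean (\<lambda>x. 1)"
  have m: "0 < ?m" using killed_mean_1 by simp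
  obtain \<pi> where \<pi>: "sets \<pi> = sets S" "prob_space \<pi>" and
    int: "\<And>f c. f \<in> borel_measurable S \<and> (\<forall>x\<in>space S. \<bar>f x\<bar> \<le> c) \<Longrightarrow> (\<And>x. 0 \<le> f x) \<Longrightarrow>
      (\<integral>x. f x \<partial>\<pi>) = killed_mean f / ?m"
  proof (rule functional_as_integral[where S=S and L="\<lambda>f. killed_mean f / ?m"])
    fix f :: "'a \<Rightarrow> real" and c
    assume f: "f \<in> borel_measurable S \<and> (\<forall>x\<in>space S. \<bar>f x\<bar> \<le> c)"
    then have d: "dominated f" by (intro dominated_bounded[of f c]) auto
    show "0 \<le> killed_mean f / ?m" if "\<And>x. x \<in> space S \<Longrightarrow> 0 \<le> f x"
      using killed_mean_nonneg[OF d that] m by simp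
    show "killed_mean (\<lambda>x. a * f x) / ?m = a * (killed_mean f / ?m)" for a
      by (simp add: killed_mean_cmult[OF d])
  next
    fix f g :: "'a \<Rightarrow> real" and c
    assume f: "f \<in> borel_measurable S \<and> (\<forall>x\<in>space S. \<bar>f x\<bar> \<le> c)"
      and g: "g \<in> borel_measurable S \<and> (\<forall>x\<in>space S. \<bar>g x\<bar> \<le> c)"
    have "dominated f" by (rule dominated_bounded[of f c]) (use f in auto)
    moreover have "dominated g" by (rule dominated_bounded[of g c]) (use g in auto)
    ultimately show "killed_mean (\<lambda>x. f x + g x) / ?m = killed_mean f / ?m + killed_mean g / ?m"
      by (simp add: killed_mean_add add_divide_distrib)
  next
    fix f :: "nat \<Rightarrow> 'a \<Rightarrow> real" and g :: "'a \<Rightarrow> real" and c :: real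
    assume f: "\<And>i. f i \<in> borel_measurable S \<and> (\<forall>x\<in>space S. \<bar>f i x\<bar> \<le> c)"
      and g: "g \<in> borel_measurable S \<and> (\<forall>x\<in>space S. \<bar>g x\<bar> \<le> c)"
      and lim: "\<And>x. x \<in> space S \<Longrightarrow> (\<lambda>i. f i x) \<longlonglongrightarrow> g x"
    have d: "dominated (f i)" for i by (rule dominated_bounded[of _ c]) (use f in auto)
    have dg: "dominated g" by (rule dominated_bounded[of _ c]) (use g in auto)
    have le: "\<bar>f i x\<bar> \<le> max 0 c * V x" if x: "x \<in> space S" for i x
    proof -
      have "\<bar>f i x\<bar> \<le> max 0 c * 1" using f[of i] x by auto
      also have "\<dots> \<le> max 0 c * V x" using V_ge_1[OF x] by (intro mult_left_mono) auto
      finally show ?thesis .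
    qed
    show "(\<lambda>i. killed_mean (f i) / ?m) \<longlonglongrightarrow> killed_mean g / ?m"
      using m by (intro tendsto_divide tendsto_const killed_mean_tendsto[OF d dg le lim]) auto
  next
    show "?m / ?m = 1" using m by simp
  qed (rule that, assumption, assumption, blast)
  have "emeasure \<pi> A = (\<integral>\<^sup>+x. emeasure (P x) A \<partial>\<pi>)" if A: "A \<in> sets S" for A
  proof -
    interpret \<pi>: prob_space \<pi> by (rule \<pi>(2))
    note sp = sets_eq_imp_space_eq[OF \<pi>(1)]
    have bA: "\<bar>step (indicator A) x\<bar> \<le> 1" if "x \<in> space S" for x
      using A by (intro abs_step_le that) (auto simp: indicator_def)
    have mA: "step (indicator A) \<in> borel_measurable S" using A by (intro step_meas) auto
    have nA: "0 \<le> step (indicator A) x" for x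
      by (simp add: step_def)
    have "(\<integral>\<^sup>+x. emeasure (P x) A \<partial>\<pi>) = (\<integral>\<^sup>+x. ennreal (step (indicator A) x) \<partial>\<pi>)"
    proof (rule nn_integral_cong)
      fix x assume "x \<in> space \<pi>"
      then have x: "x \<in> space S" by (simp add: sp)
      interpret p: prob_space "P x" by (rule prob_P[OF x])
      have "A \<inter> space (P x) = A" using A sets.sets_into_space space_P[OF x] by blast
      then show "emeasure (P x) A = ennreal (step (indicator A) x)"
        using A x by (simp add: step_def p.emeasure_eq_measure)
    qed
    also have "\<dots> = ennreal (\<integral>x. step (indicator A) x \<partial>\<pi>)"
      using bA mA nA \<pi>(1)
      by (intro nn_integral_eq_integral \<pi>.integrable_const_bound[where B=1])
        (auto simp: sp cong: measurable_cong_sets intro!: AE_I2)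
    also have "(\<integral>x. step (indicator A) x \<partial>\<pi>) = killed_mean (step (indicator A)) / ?m"
      using bA mA nA by (intro int[of _ 1]) auto
    also have "\<dots> = killed_mean (indicator A) / ?m"
      using A by (simp add: killed_mean_step_eq dominated_indicator)
    also have "\<dots> = (\<integral>x. indicator A x \<partial>\<pi>)"
      using A by (intro int[symmetric, of _ 1]) (auto simp: indicator_def)
    also have "\<dots> = measure \<pi> A"
      using A sets.sets_into_space[OF A] by (simp add: sp Int_absorb2)
    finally show ?thesis by (simp add: \<pi>.emeasure_eq_measure)
  qed
  then have "stationary S P \<pi>"
    using \<pi> by (simp add: stationary_def space_prob_algebra)
  then show ?thesis ..
qed

end

locale stationary_chain = killed_chain +
  fixes \<pi> :: "'a measure"
  assumes stat: "stationary S P \<pi>"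
begin

lemma sets_pi: "sets \<pi> = sets S" and prob_pi: "prob_space \<pi>"
  using stat by (auto simp: stationary_def space_prob_algebra)

lemma space_pi: "space \<pi> = space S"
  using sets_pi sets_eq_imp_space_eq by blast

sublocale pi: prob_space \<pi>
  by (rule prob_pi)

lemma pi_meas: "f \<in> borel_measurable \<pi> \<longleftrightarrow> f \<in> borel_measurable S"
  using sets_pi by (simp cong: measurable_cong_sets)

lemma pi_integrable:
  fixes f :: "'a \<Rightarrow> real"
  shows "f \<in> borel_measurable S \<Longrightarrow> (\<And>x. x \<in> space S \<Longrightarrow> \<bar>f x\<bar> \<le> c) \<Longrightarrow> integrable \<pi> f"
  by (rule pi.integrable_const_bound[where B=c]) (auto simp: pi_meas space_pi)

lemma pi_step:
  assumes f: "f \<in> borel_measurable S" "\<And>x. x \<in> space S \<Longrightarrow> \<bar>f x\<bar> \<le> c"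
  shows "(\<integral>x. step f x \<partial>\<pi>) = (\<integral>x. f x \<partial>\<pi>)"
proof -
  have ker: "P \<in> \<pi> \<rightarrow>\<^sub>M subprob_algebra S"
    using measurable_prob_algebraD[OF kernel] measurable_cong_sets[OF sets_pi refl] by blast
  have ne: "space \<pi> \<noteq> {}" by (rule pi.not_empty)
  have "\<pi> \<bind> P = \<pi>"
  proof (rule measure_eqI)
    show sb: "sets (\<pi> \<bind> P) = sets \<pi>"
      using sets_bind[OF sets_P[unfolded space_pi[symmetric]] ne] sets_pi by simp
    fix A assume "A \<in> sets (\<pi> \<bind> P)"
    then have A: "A \<in> sets S" using sb sets_pi by simp
    show "emeasure (\<pi> \<bind> P) A = emeasure \<pi> A"
      using emeasure_bind[OF ne ker A] stat A by (simp add: stationary_def)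
  qed
  then have "(\<integral>x. f x \<partial>\<pi>) = (\<integral>x. f x \<partial>(\<pi> \<bind> P))" by simp
  also have "\<dots> = (\<integral>x. (\<integral>y. f y \<partial>P x) \<partial>\<pi>)"
  proof (rule integral_bind[OF f(1) _ ker _ AE_I2[of _ _]])
    show "\<bar>f x\<bar> \<le> c" if "x \<in> space S" for x by (rule f(2)[OF that])
    show "finite_measure \<pi>" by unfold_locales
    show "emeasure (P x) (space (P x)) \<le> ennreal 1" if "x \<in> space \<pi>" for x
      using prob_space.emeasure_space_1[OF prob_P] that by (simp add: space_pi)
  qed
  also have "\<dots> = (\<integral>x. step f x \<partial>\<pi>)"
    by (rule Bochner_Integration.integral_cong) (auto simp: step_def space_pi)
  finally show ?thesis by simp
qed

definition piC :: real where
  "piC = measure \<pi> C"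

lemma pi_indC: "(\<integral>x. indicator C x \<partial>\<pi>) = piC"
  using sets.sets_into_space[OF C_sets] by (simp add: piC_def space_pi Int_absorb2)

lemma pi_taboo_step:
  assumes f: "f \<in> borel_measurable S" "\<And>x. x \<in> space S \<Longrightarrow> \<bar>f x\<bar> \<le> c"
  shows "(\<integral>x. f x \<partial>\<pi>) = (\<integral>x. taboo f x \<partial>\<pi>) + \<beta>t * piC * nui f"
proof -
  have d: "dominated f" by (rule dominated_bounded[OF f])
  have i1: "integrable \<pi> (taboo f)"
    using abs_taboo_pow_bounded[OF f, of _ 1] dominated_meas[OF dominated_taboo[OF d]]
    by (intro pi_integrable) auto
  have i2: "integrable \<pi> (indicator C :: 'a \<Rightarrow> real)"
    by (rule pi_integrable[where c=1]) (auto simp: indicator_def)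
  have "(\<integral>x. f x \<partial>\<pi>) = (\<integral>x. taboo f x + \<beta>t * nui f * indicator C x \<partial>\<pi>)"
    using pi_step[OF f] by (simp add: step_eq_taboo)
  also have "\<dots> = (\<integral>x. taboo f x \<partial>\<pi>) + \<beta>t * nui f * piC"
    using i1 i2 pi_indC by simp
  finally show ?thesis by simp
qed

text \<open>
  Iterating \<open>\<pi> = \<pi> Q + \<beta>t \<pi>(C) \<nu>\<close> identifies every stationary distribution: what is left of
  \<open>\<pi> Q\<^sup>n\<close> disappears in the limit.
\<close>

lemma pi_killed_sum:
  assumes f: "f \<in> borel_measurable S" "\<And>x. x \<in> space S \<Longrightarrow> \<bar>f x\<bar> \<le> c"
  shows "(\<integral>x. f x \<partial>\<pi>) =
    (\<integral>x. (taboo ^^ n) f x \<partial>\<pi>) + \<beta>t * piC * (\<Sum>k<n. nui ((taboo ^^ k) f))"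
proof (induction n)
  case (Suc n)
  have "(\<integral>x. (taboo ^^ n) f x \<partial>\<pi>) = (\<integral>x. taboo ((taboo ^^ n) f) x \<partial>\<pi>) + \<beta>t * piC * nui ((taboo ^^ n) f)"
    by (rule pi_taboo_step[OF dominated_meas[OF dominated_taboo_pow[OF dominated_bounded[OF f]]]
          abs_taboo_pow_bounded[OF f]])
  then show ?case using Suc by (simp add: algebra_simps)
qed simp

lemma pi_bounded_eq:
  assumes f: "f \<in> borel_measurable S" "\<And>x. x \<in> space S \<Longrightarrow> \<bar>f x\<bar> \<le> c"
  shows "(\<integral>x. f x \<partial>\<pi>) = \<beta>t * piC * killed_mean f"
proof -
  have d: "dominated f" by (rule dominated_bounded[OF f])
  have "(\<lambda>n. \<integral>x. (taboo ^^ n) f x \<partial>\<pi>) \<longlonglongrightarrow> (\<integral>x. 0 \<partial>\<pi>)"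
    by (rule integral_dominated_convergence[where w="\<lambda>x. c"])
      (use dominated_meas[OF dominated_taboo_pow[OF d]] abs_taboo_pow_bounded[OF f] killed_tendsto_0[OF d]
        in \<open>auto simp: pi_meas space_pi\<close>)
  moreover have "(\<lambda>n. \<Sum>k<n. nui ((taboo ^^ k) f)) \<longlonglongrightarrow> killed_mean f"
    unfolding killed_mean_def by (rule summable_LIMSEQ[OF summable_nui_killed[OF d]])
  ultimately have "(\<lambda>n. (\<integral>x. (taboo ^^ n) f x \<partial>\<pi>) + \<beta>t * piC * (\<Sum>k<n. nui ((taboo ^^ k) f)))
      \<longlonglongrightarrow> (\<integral>x. 0 \<partial>\<pi>) + \<beta>t * piC * killed_mean f"
    by (intro tendsto_intros)
  moreover have "(\<lambda>n. (\<integral>x. (taboo ^^ n) f x \<partial>\<pi>) + \<beta>t * piC * (\<Sum>k<n. nui ((taboo ^^ k) f)))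
      = (\<lambda>n. \<integral>x. f x \<partial>\<pi>)"
    using pi_killed_sum[OF f] by simp
  ultimately show ?thesis by (simp add: LIMSEQ_const_iff)
qed

lemma pi_normalised: "\<beta>t * piC * killed_mean (\<lambda>x. 1) = 1"
  using pi_bounded_eq[of "\<lambda>x. 1" 1] pi.prob_space by simp

lemma piC_bounds: "0 < piC" "piC \<le> 1"
proof -
  have "0 \<le> piC" by (simp add: piC_def)
  moreover have "piC \<noteq> 0" using pi_normalised by auto
  ultimately show "0 < piC" by simp
qed (simp add: piC_def)

lemma measure_pi: 
  assumes A: "A \<in> sets S"
  shows "measure \<pi> A = killed_mean (indicator A) / killed_mean (\<lambda>x. 1)"
proof -
  have "measure \<pi> A = (\<integral>x. indicator A x \<partial>\<pi>)"
    using sets.sets_into_space[OF A] by (simp add: space_pi Int_absorb2)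
  also have "\<dots> = \<beta>t * piC * killed_mean (indicator A)"
    using A by (intro pi_bounded_eq[where c=1]) (auto simp: indicator_def)
  also have "\<dots> = killed_mean (indicator A) / killed_mean (\<lambda>x. 1)"
    using pi_normalised killed_mean_1 by (simp add: field_simps)
  finally show ?thesis .
qed

text \<open>
  The formula for bounded functions applies to the truncations of \<open>V\<close>, uniformly in the level of truncation.
\<close>

lemma nn_integral_V_pi: "(\<integral>\<^sup>+x. ennreal (V x) \<partial>\<pi>) < \<infinity>"
proof -
  have bound: "(\<integral>\<^sup>+x. ennreal (min (V x) (real m)) \<partial>\<pi>) \<le> ennreal (\<beta>t * piC * killed_mean V)" for m :: nat
  proof -
    have le: "\<bar>min (V x) (real m)\<bar> \<le> real m" if "x \<in> space S" for x
      using V_nonneg[OF that] by auto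
    have meas: "(\<lambda>x. min (V x) (real m)) \<in> borel_measurable S" by measurable
    have "(\<integral>\<^sup>+x. ennreal (min (V x) (real m)) \<partial>\<pi>) = ennreal (\<integral>x. min (V x) (real m) \<partial>\<pi>)"
      using V_nonneg by (intro nn_integral_eq_integral pi_integrable[OF meas le]) (auto simp: space_pi)
    also have "\<dots> = ennreal (\<beta>t * piC * killed_mean (\<lambda>x. min (V x) (real m)))"
      by (subst pi_bounded_eq[OF meas le]) auto
    also have "\<dots> \<le> ennreal (\<beta>t * piC * killed_mean V)"
      using bt_pos piC_bounds
      by (intro ennreal_leI mult_left_mono killed_mean_mono dominated_bounded[OF meas le]) auto
    finally show ?thesis .
  qed
  have "(\<integral>\<^sup>+x. ennreal (V x) \<partial>\<pi>) = (\<integral>\<^sup>+x. (SUP m::nat. ennreal (min (V x) (real m))) \<partial>\<pi>)"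
  proof (rule nn_integral_cong)
    fix x assume "x \<in> space \<pi>"
    obtain m :: nat where "V x \<le> real m" using real_arch_simple by blast
    then show "ennreal (V x) = (SUP m::nat. ennreal (min (V x) (real m)))"
      by (intro antisym SUP_upper2[of m] SUP_least ennreal_leI) auto
  qed
  also have "\<dots> = (SUP m::nat. \<integral>\<^sup>+x. ennreal (min (V x) (real m)) \<partial>\<pi>)"
    by (rule nn_integral_monotone_convergence_SUP)
      (auto simp: incseq_def le_fun_def pi_meas intro!: ennreal_leI)
  also have "\<dots> \<le> ennreal (\<beta>t * piC * killed_mean V)"
    by (intro SUP_least bound)
  finally show ?thesis by (auto intro: le_less_trans)
qed

lemma pi_integrable_V: "integrable \<pi> V"
  by (rule integrableI_nonneg) (use nn_integral_V_pi V_nonneg in \<open>auto simp: pi_meas space_pi\<close>)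

lemma pi_dominated: "dominated f \<Longrightarrow> integrable \<pi> f"
  by (rule integrable_dominated[OF _ sets_pi pi_integrable_V])

lemma pi_eq:
  assumes f: "dominated f"
  shows "(\<integral>x. f x \<partial>\<pi>) = \<beta>t * piC * killed_mean f"
proof -
  let ?f = "\<lambda>m x. max (- real m) (min (f x) (real m))"
  have meas: "?f m \<in> borel_measurable S" for m using dominated_meas[OF f] by measurable
  have le: "\<bar>?f m x\<bar> \<le> real m" for m x by auto
  have d: "dominated (?f m)" for m by (rule dominated_bounded[OF meas le])
  obtain c where c: "\<And>x. x \<in> space S \<Longrightarrow> \<bar>f x\<bar> \<le> c * V x"
    using f by (metis dominatedE)
  have le': "\<bar>?f m x\<bar> \<le> c * V x" if "x \<in> space S" for m x
    using c[OF that] by auto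
  have lim: "(\<lambda>m. ?f m x) \<longlonglongrightarrow> f x" for x
  proof (rule tendsto_eventually)
    obtain M :: nat where "\<bar>f x\<bar> \<le> real M" using real_arch_simple by blast
    then show "\<forall>\<^sub>F m in sequentially. ?f m x = f x"
      by (intro eventually_sequentiallyI[of M]) (auto simp: max_def min_def abs_le_iff)
  qed
  have "(\<lambda>m. \<integral>x. ?f m x \<partial>\<pi>) \<longlonglongrightarrow> (\<integral>x. f x \<partial>\<pi>)"
    by (rule integral_tendsto[OF sets_pi pi_integrable_V d f le' lim])
  moreover have "(\<lambda>m. \<integral>x. ?f m x \<partial>\<pi>) \<longlonglongrightarrow> \<beta>t * piC * killed_mean f"
    unfolding pi_bounded_eq[OF meas le]
    by (intro tendsto_intros killed_mean_tendsto[OF d f le' lim])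
  ultimately show ?thesis by (rule LIMSEQ_unique)
qed

end

context killed_chain
begin

lemma stationary_unique:
  assumes "stationary S P \<pi>" "stationary S P \<pi>'"
  shows "\<pi> = \<pi>'"
proof -
  interpret s: stationary_chain S P C \<nu> V \<beta>t lam K r D J \<pi>
    by unfold_locales (fact assms)
  interpret s': stationary_chain S P C \<nu> V \<beta>t lam K r D J \<pi>'
    by unfold_locales (fact assms)
  show ?thesis
    using s.sets_pi s'.sets_pi s.measure_pi s'.measure_pi
    by (intro measure_eqI) (auto simp: s.pi.emeasure_eq_measure s'.pi.emeasure_eq_measure)
qed

end

section \<open>Sequences\<close>

text \<open>
  The ratios of a log-convex sequence increase, so a single ratio above \<open>q\<close> would force growth
  faster than \<open>q ^ n\<close>. Thus an exponential bound holds with the constant \<open>s 0\<close>.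
\<close>

lemma log_convex_decay:
  fixes s :: "nat \<Rightarrow> real"
  assumes nn: "\<And>n. 0 \<le> s n"
    and lc: "\<And>n. (s (Suc n))\<^sup>2 \<le> s n * s (Suc (Suc n))"
    and q: "0 < q" and bound: "\<And>n. s n \<le> B * q ^ n"
  shows "s n \<le> s 0 * q ^ n"
proof -
  have ratio: "s (Suc m) \<le> q * s m" for m
  proof (rule ccontr)
    assume "\<not> ?thesis"
    then have gt: "q * s m < s (Suc m)" by simp
    have sm: "0 < s m"
    proof (rule ccontr)
      assume "\<not> 0 < s m"
      then have "s m = 0" using nn[of m] by simp
      then have "(s (Suc m))\<^sup>2 \<le> 0" using lc[of m] by simp
      then show False using gt \<open>s m = 0\<close> by simp
    qed
    define t where "t = s (Suc m) / s m"
    have t: "q < t" using gt sm by (simp add: t_def field_simps)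
    have step: "0 < s (m + j) \<and> t * s (m + j) \<le> s (m + Suc j)" for j
    proof (induction j)
      case 0
      then show ?case using sm by (simp add: t_def)
    next
      case (Suc j)
      let ?a = "s (m + j)" and ?b = "s (m + Suc j)" and ?c = "s (m + Suc (Suc j))"
      have a: "0 < ?a" "t * ?a \<le> ?b" using Suc by auto
      then have b: "0 < ?b" using q t by (smt (verit) mult_pos_pos)
      have "(t * ?b) * ?a \<le> ?b * ?b" using a b by (simp add: mult_ac)
      also have "\<dots> \<le> ?c * ?a" using lc[of "m + j"] by (simp add: power2_eq_square mult_ac)
      finally show ?case using a b by simp
    qed
    have pow: "t ^ j * s m \<le> s (m + j)" for j
    proof (induction j)
      case (Suc j)
      have "t * (t ^ j * s m) \<le> t * s (m + j)" using Suc q t by (intro mult_left_mono) auto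
      then show ?case using step[of j] by (simp add: mult_ac)
    qed simp
    have "1 < t / q" using t q by simp
    then obtain j where j: "B * q ^ m / s m < (t / q) ^ j" using real_arch_pow by blast
    have "t ^ j * s m \<le> B * q ^ (m + j)" using pow[of j] bound[of "m + j"] by simp
    then have "(t / q) ^ j * s m \<le> B * q ^ m"
      using q by (simp add: power_divide power_add field_simps)
    then show False using j sm by (simp add: field_simps)
  qed
  show ?thesis
  proof (induction n)
    case (Suc n)
    have "q * s n \<le> q * (s 0 * q ^ n)" using Suc q by (intro mult_left_mono) auto
    then show ?case using ratio[of n] by (simp add: mult_ac)
  qed simp
qed

lemma quadratic_nonneg_imp:
  fixes a b c :: real
  assumes "\<And>t. 0 \<le> a - 2 * t * b + t\<^sup>2 * c" and "0 \<le> c"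
  shows "b\<^sup>2 \<le> a * c"
proof (cases "c = 0")
  case True
  have "b = 0"
  proof (rule ccontr)
    assume "b \<noteq> 0"
    then show False
      using assms(1)[of "(a + 1) / (2 * b)"] True by simp
  qed
  then show ?thesis using True by simp
next
  case False
  have "0 \<le> c * (a - 2 * (b / c) * b + (b / c)\<^sup>2 * c)"
    by (rule mult_nonneg_nonneg[OF assms(2) assms(1)])
  also have "\<dots> = a * c - b\<^sup>2" using False by (simp add: field_simps power2_eq_square)
  finally show ?thesis by simp
qed

text \<open>
  The weighted error of \<open>w * G\<close> against its limit consists of the products \<open>(w j - w\<^sub>\<infinity>) G k\<close> with
  \<open>j + k = n\<close> and of the tail \<open>w\<^sub>\<infinity> G k\<close>, \<open>k > n\<close>. Each \<open>G k\<close> occurs in one of the two only, so that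
  the two errors do not add up.
\<close>

lemma weighted_convolution_error:
  fixes G w :: "nat \<Rightarrow> real"
  assumes r: "1 \<le> r"
    and G: "\<And>k. \<bar>G k\<bar> \<le> H k" "summable (\<lambda>k. r ^ k * H k)" "(\<Sum>k. r ^ k * H k) \<le> A"
    and g: "G sums g"
    and w: "\<And>j. r ^ j * \<bar>w j - w_inf\<bar> \<le> E" and w_inf: "\<bar>w_inf\<bar> \<le> E"
  shows "r ^ n * \<bar>(\<Sum>k\<le>n. w (n - k) * G k) - w_inf * g\<bar> \<le> A * E"
proof -
  have E0: "0 \<le> E" using w_inf by simp
  have G': "r ^ k * \<bar>G k\<bar> \<le> r ^ k * H k" for k using G(1) r by (intro mult_left_mono) auto
  have sG: "summable (\<lambda>k. r ^ k * \<bar>G k\<bar>)"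
    by (rule summable_comparison_test'[OF G(2), of 0]) (use G' r in auto)
  have total: "(\<Sum>k. r ^ k * \<bar>G k\<bar>) \<le> A"
    using suminf_le[OF G' sG G(2)] G(3) by simp
  let ?tail = "\<Sum>k. r ^ (k + Suc n) * \<bar>G (k + Suc n)\<bar>"
  have st: "summable (\<lambda>k. r ^ (k + Suc n) * \<bar>G (k + Suc n)\<bar>)"
    using summable_ignore_initial_segment[OF sG, of "Suc n"] by simp
  have split: "(\<Sum>k. r ^ k * \<bar>G k\<bar>) = (\<Sum>k\<le>n. r ^ k * \<bar>G k\<bar>) + ?tail"
    using suminf_split_initial_segment[OF sG, of "Suc n"] by (simp add: lessThan_Suc_atMost)
  have gtail: "g = (\<Sum>k\<le>n. G k) + (\<Sum>k. G (k + Suc n))"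
    using suminf_split_initial_segment[OF sums_summable[OF g], of "Suc n"] sums_unique[OF g]
    by (simp add: lessThan_Suc_atMost)
  have tail: "r ^ n * \<bar>\<Sum>k. G (k + Suc n)\<bar> \<le> ?tail"
  proof -
    have le: "r ^ n * \<bar>G (k + Suc n)\<bar> \<le> r ^ (k + Suc n) * \<bar>G (k + Suc n)\<bar>" for k
      using r by (intro mult_right_mono power_increasing) auto
    have s: "summable (\<lambda>k. r ^ n * \<bar>G (k + Suc n)\<bar>)"
      by (rule summable_comparison_test'[OF st, of 0]) (use le r in auto)
    then have s': "summable (\<lambda>k. \<bar>G (k + Suc n)\<bar>)"
      using r by (simp add: summable_cmult_iff)
    have "r ^ n * \<bar>\<Sum>k. G (k + Suc n)\<bar> \<le> r ^ n * (\<Sum>k. \<bar>G (k + Suc n)\<bar>)"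
      using r by (intro mult_left_mono summable_rabs s') auto
    also have "\<dots> = (\<Sum>k. r ^ n * \<bar>G (k + Suc n)\<bar>)" by (rule suminf_mult[OF s', symmetric])
    also have "\<dots> \<le> ?tail" by (rule suminf_le[OF le s st])
    finally show ?thesis .
  qed
  have "(\<Sum>k\<le>n. w (n - k) * G k) - w_inf * g
      = (\<Sum>k\<le>n. (w (n - k) - w_inf) * G k) - w_inf * (\<Sum>k. G (k + Suc n))"
    unfolding gtail by (simp add: algebra_simps sum_subtractf sum_distrib_left)
  then have "r ^ n * \<bar>(\<Sum>k\<le>n. w (n - k) * G k) - w_inf * g\<bar>
      \<le> r ^ n * (\<bar>\<Sum>k\<le>n. (w (n - k) - w_inf) * G k\<bar> + \<bar>w_inf\<bar> * \<bar>\<Sum>k. G (k + Suc n)\<bar>)"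
    using r by (simp add: abs_mult[symmetric] abs_triangle_ineq4 mult_left_mono)
  also have "\<dots> = r ^ n * \<bar>\<Sum>k\<le>n. (w (n - k) - w_inf) * G k\<bar> + \<bar>w_inf\<bar> * (r ^ n * \<bar>\<Sum>k. G (k + Suc n)\<bar>)"
    by (simp add: algebra_simps)
  also have "r ^ n * \<bar>\<Sum>k\<le>n. (w (n - k) - w_inf) * G k\<bar> \<le> (\<Sum>k\<le>n. E * (r ^ k * \<bar>G k\<bar>))"
  proof -
    have "r ^ n * \<bar>\<Sum>k\<le>n. (w (n - k) - w_inf) * G k\<bar> \<le> r ^ n * (\<Sum>k\<le>n. \<bar>(w (n - k) - w_inf) * G k\<bar>)"
      using r by (intro mult_left_mono sum_abs) auto
    also have "\<dots> = (\<Sum>k\<le>n. (r ^ (n - k) * \<bar>w (n - k) - w_inf\<bar>) * (r ^ k * \<bar>G k\<bar>))"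
      unfolding sum_distrib_left
    proof (rule sum.cong[OF refl])
      fix k assume "k \<in> {..n}"
      then have "r ^ n = r ^ (n - k) * r ^ k" by (simp add: power_add[symmetric])
      then show "r ^ n * \<bar>(w (n - k) - w_inf) * G k\<bar>
          = (r ^ (n - k) * \<bar>w (n - k) - w_inf\<bar>) * (r ^ k * \<bar>G k\<bar>)"
        by (simp add: abs_mult mult_ac)
    qed
    also have "\<dots> \<le> (\<Sum>k\<le>n. E * (r ^ k * \<bar>G k\<bar>))"
      using r by (intro sum_mono mult_right_mono w) auto
    finally show ?thesis .
  qed
  also have "\<bar>w_inf\<bar> * (r ^ n * \<bar>\<Sum>k. G (k + Suc n)\<bar>) \<le> E * ?tail"
    using w_inf tail r by (intro mult_mono) auto
  also have "(\<Sum>k\<le>n. E * (r ^ k * \<bar>G k\<bar>)) + E * ?tail = E * (\<Sum>k. r ^ k * \<bar>G k\<bar>)"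
    unfolding split by (simp add: sum_distrib_left distrib_left)
  also have "\<dots> \<le> E * A" using total E0 by (rule mult_left_mono)
  finally show ?thesis by (simp add: mult.commute)
qed

section \<open>Reversibility, positivity and the renewal sequence\<close>

context stationary_chain
begin

definition bounded_fun :: "('a \<Rightarrow> real) \<Rightarrow> bool" where
  "bounded_fun f \<longleftrightarrow> f \<in> borel_measurable S \<and> (\<exists>c. \<forall>x\<in>space S. \<bar>f x\<bar> \<le> c)"

definition ip :: "('a \<Rightarrow> real) \<Rightarrow> ('a \<Rightarrow> real) \<Rightarrow> real" where
  "ip f g = (\<integral>x. f x * g x \<partial>\<pi>)"

lemma bounded_funE:
  assumes "bounded_fun f"
  obtains c where "f \<in> borel_measurable S" "\<And>x. x \<in> space S \<Longrightarrow> \<bar>f x\<bar> \<le> c"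
  using assms by (auto simp: bounded_fun_def)

lemma bounded_funI:
  "f \<in> borel_measurable S \<Longrightarrow> (\<And>x. x \<in> space S \<Longrightarrow> \<bar>f x\<bar> \<le> c) \<Longrightarrow> bounded_fun f"
  unfolding bounded_fun_def by blast

lemma bounded_fun_dominated: "bounded_fun f \<Longrightarrow> dominated f"
  by (metis bounded_funE dominated_bounded)

lemma bounded_fun_step_pow:
  assumes "bounded_fun f" shows "bounded_fun ((step ^^ n) f)"
proof -
  obtain c where c: "f \<in> borel_measurable S" "\<And>x. x \<in> space S \<Longrightarrow> \<bar>f x\<bar> \<le> c"
    using assms by (metis bounded_funE)
  show ?thesis
    by (rule bounded_funI[OF dominated_meas abs_step_pow_le[OF c]])
      (use bounded_fun_dominated[OF assms] in auto)
qed

lemma bounded_fun_const: "bounded_fun (\<lambda>x. c)"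
  by (rule bounded_funI[of _ "\<bar>c\<bar>"]) auto

lemma bounded_fun_indC: "bounded_fun (indicator C)"
  by (rule bounded_funI[of _ 1]) (auto simp: indicator_def)

lemma bounded_fun_mult:
  assumes "bounded_fun f" "bounded_fun g" shows "bounded_fun (\<lambda>x. f x * g x)"
proof -
  obtain c where c: "f \<in> borel_measurable S" "\<And>x. x \<in> space S \<Longrightarrow> \<bar>f x\<bar> \<le> c"
    using assms(1) by (metis bounded_funE)
  obtain d where d: "g \<in> borel_measurable S" "\<And>x. x \<in> space S \<Longrightarrow> \<bar>g x\<bar> \<le> d"
    using assms(2) by (metis bounded_funE)
  have "\<bar>f x * g x\<bar> \<le> \<bar>c\<bar> * \<bar>d\<bar>" if "x \<in> space S" for x
    using c(2)[OF that] d(2)[OF that] unfolding abs_mult by (intro mult_mono) auto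
  then show ?thesis using c(1) d(1) by (intro bounded_funI[of _ "\<bar>c\<bar> * \<bar>d\<bar>"]) auto
qed

lemma bounded_fun_lin:
  assumes "bounded_fun f" "bounded_fun g" shows "bounded_fun (\<lambda>x. f x - t * g x)"
proof -
  obtain c where c: "f \<in> borel_measurable S" "\<And>x. x \<in> space S \<Longrightarrow> \<bar>f x\<bar> \<le> c"
    using assms(1) by (metis bounded_funE)
  obtain d where d: "g \<in> borel_measurable S" "\<And>x. x \<in> space S \<Longrightarrow> \<bar>g x\<bar> \<le> d"
    using assms(2) by (metis bounded_funE)
  have "\<bar>f x - t * g x\<bar> \<le> c + \<bar>t\<bar> * d" if "x \<in> space S" for x
  proof -
    have "\<bar>f x - t * g x\<bar> \<le> \<bar>f x\<bar> + \<bar>t * g x\<bar>" by (rule abs_triangle_ineq4)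
    also have "\<dots> \<le> c + \<bar>t\<bar> * d"
      unfolding abs_mult using c(2)[OF that] d(2)[OF that] by (intro add_mono mult_left_mono) auto
    finally show ?thesis .
  qed
  then show ?thesis using c(1) d(1) by (intro bounded_funI) auto
qed

lemma bounded_integrable: "bounded_fun f \<Longrightarrow> integrable \<pi> f"
  by (rule pi_dominated[OF bounded_fun_dominated])

lemma bounded_L2:
  assumes "bounded_fun f" shows "f \<in> L2 \<pi>"
  using assms bounded_integrable[OF bounded_fun_mult[OF assms assms]]
  by (auto simp: L2_def pi_meas bounded_fun_def power2_eq_square)

lemma integral_trans_op:
  "(\<integral>x. trans_op P f x * g x \<partial>\<pi>) = ip (step f) g"
  unfolding ip_def by (rule Bochner_Integration.integral_cong) (auto simp: trans_op_def step_def space_pi)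

lemma ip_commute: "ip f g = ip g f"
  by (simp add: ip_def mult.commute)

lemma ip_self_nonneg: "0 \<le> ip f f"
  unfolding ip_def by (rule Bochner_Integration.integral_nonneg) simp

lemma ip_Cauchy_Schwarz:
  assumes f: "bounded_fun f" and g: "bounded_fun g"
  shows "(ip f g)\<^sup>2 \<le> ip f f * ip g g"
proof (rule quadratic_nonneg_imp[OF _ ip_self_nonneg])
  fix t
  have "0 \<le> ip (\<lambda>x. f x - t * g x) (\<lambda>x. f x - t * g x)" by (rule ip_self_nonneg)
  also have "\<dots> = (\<integral>x. f x * f x - 2 * t * (f x * g x) + t\<^sup>2 * (g x * g x) \<partial>\<pi>)"
    unfolding ip_def by (rule Bochner_Integration.integral_cong) (auto simp: algebra_simps power2_eq_square)
  also have "\<dots> = ip f f - 2 * t * ip f g + t\<^sup>2 * ip g g"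
    using bounded_integrable[OF bounded_fun_mult[OF f f]] bounded_integrable[OF bounded_fun_mult[OF f g]]
      bounded_integrable[OF bounded_fun_mult[OF g g]]
    by (simp add: ip_def)
  finally show "0 \<le> ip f f - 2 * t * ip f g + t\<^sup>2 * ip g g" .
qed

lemma nui_square_le:
  assumes f: "bounded_fun f" shows "(nui f)\<^sup>2 \<le> nui (\<lambda>x. f x * f x)"
proof -
  have d: "dominated f" "dominated (\<lambda>x. f x * f x)"
    using f by (auto intro: bounded_fun_dominated bounded_fun_mult)
  define m where "m = - 2 * nui f"
  have "0 \<le> nui (\<lambda>x. (f x - nui f)\<^sup>2)" by (rule nui_nonneg) simp
  also have "\<dots> = nui (\<lambda>x. (f x * f x + m * f x) + (nui f)\<^sup>2)"
    by (rule nui_cong) (simp add: m_def power2_eq_square algebra_simps)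
  also have "\<dots> = nui (\<lambda>x. f x * f x) + m * nui f + (nui f)\<^sup>2"
    using d by (simp add: nui_add nui_cmult dominated_add dominated_cmult)
  finally show ?thesis by (simp add: m_def power2_eq_square)
qed

text \<open>Minorization and invariance give \<open>\<beta>t \<pi>(C) \<nu> \<le> \<pi>\<close>.\<close>

lemma nui_le_pi:
  assumes f: "bounded_fun f" and nn: "\<And>x. x \<in> space S \<Longrightarrow> 0 \<le> f x"
  shows "\<beta>t * piC * nui f \<le> (\<integral>x. f x \<partial>\<pi>)"
proof -
  obtain c where c: "f \<in> borel_measurable S" "\<And>x. x \<in> space S \<Longrightarrow> \<bar>f x\<bar> \<le> c"
    using f by (metis bounded_funE)
  have "0 \<le> (\<integral>x. taboo f x \<partial>\<pi>)"
    using taboo_nonneg[OF bounded_fun_dominated[OF f] nn]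
    by (intro integral_nonneg_AE AE_I2) (simp add: space_pi)
  then show ?thesis using pi_taboo_step[OF c] by simp
qed

text \<open>
  For a reversible chain the covariances \<open>cov k\<close> are the moments of the spectral measure of
  \<open>centred\<close>.
\<close>

definition centred :: "'a \<Rightarrow> real" where
  "centred x = indicator C x - piC"

definition cov :: "nat \<Rightarrow> real" where
  "cov k = ip ((step ^^ k) centred) centred"

lemma bounded_centred: "bounded_fun ((step ^^ k) centred)"
  by (rule bounded_fun_step_pow)
    (use bounded_fun_lin[OF bounded_fun_indC bounded_fun_const[of 1], of piC]
      in \<open>simp add: centred_def[abs_def]\<close>)

lemma step_pow_centred:
  assumes "x \<in> space S"
  shows "(step ^^ k) centred x = (step ^^ k) (indicator C) x - piC"
  using assms
proof (induction k arbitrary: x)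
  case (Suc k)
  have "step ((step ^^ k) centred) = step (\<lambda>x. (step ^^ k) (indicator C) x + (- piC))"
    using Suc.IH by (intro step_cong) simp
  also have "\<dots> = (\<lambda>x. step ((step ^^ k) (indicator C)) x + step (\<lambda>x. - piC) x)"
    by (rule step_add) auto
  finally show ?case using Suc.prems by (simp add: step_const)
qed (simp add: centred_def)

lemma prob_C_Int [simp]: "measure \<pi> (C \<inter> space \<pi>) = piC"
  using pi_indC by simp

lemma pi_step_pow_indC: "(\<integral>x. (step ^^ k) (indicator C) x \<partial>\<pi>) = piC"
proof (induction k)
  case (Suc k)
  obtain c where "(step ^^ k) (indicator C) \<in> borel_measurable S"
    "\<And>x. x \<in> space S \<Longrightarrow> \<bar>(step ^^ k) (indicator C) x\<bar> \<le> c"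
    using bounded_fun_step_pow[OF bounded_fun_indC] by (metis bounded_funE)
  from pi_step[OF this] Suc show ?case by simp
qed (simp add: pi_indC)

lemma cov_eq: "ip ((step ^^ k) (indicator C)) (indicator C) = piC\<^sup>2 + cov k"
proof -
  let ?f = "(step ^^ k) (indicator C)"
  have i: "integrable \<pi> (\<lambda>x. ?f x * indicator C x)" "integrable \<pi> ?f" "integrable \<pi> (indicator C :: 'a \<Rightarrow> real)"
    using bounded_fun_step_pow[OF bounded_fun_indC] bounded_fun_indC bounded_fun_mult
    by (blast intro: bounded_integrable)+
  have "cov k = (\<integral>x. (?f x * indicator C x - piC * ?f x) - piC * indicator C x + piC * piC \<partial>\<pi>)"
    unfolding cov_def ip_def
    by (rule Bochner_Integration.integral_cong)
      (auto simp: step_pow_centred space_pi centred_def algebra_simps)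
  also have "\<dots> = (\<integral>x. ?f x * indicator C x \<partial>\<pi>) - piC * piC - piC * piC + piC * piC"
    using i by (simp add: pi_step_pow_indC pi_indC pi.prob_space)
  finally show ?thesis by (simp add: ip_def power2_eq_square)
qed

end

context killed_chain
begin

lemma step_pow_one: "x \<in> space S \<Longrightarrow> (step ^^ n) (\<lambda>x. 1) x = 1"
proof (induction n arbitrary: x)
  case (Suc n)
  have "step ((step ^^ n) (\<lambda>x. 1)) = step (\<lambda>x. 1)" by (rule step_cong) (rule Suc.IH)
  then show ?case using Suc.prems by (simp add: step_const)
qed simp

lemma killed_one_le_V: "0 \<le> nui ((taboo ^^ j) (\<lambda>x. 1))" "nui ((taboo ^^ j) (\<lambda>x. 1)) \<le> nui ((taboo ^^ j) V)"
  using V_ge_1 by (auto intro!: nui_nonneg nui_mono taboo_pow_nonneg taboo_pow_mono)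

lemma killed_total_suminf: "(\<Sum>l. r ^ l * nui ((taboo ^^ l) V)) \<le> killed_total"
  by (rule suminf_le_const[OF summable_killed killed_total_bound])

lemma killed_total_nonneg: "0 \<le> killed_total"
  using killed_total_bound[of 0] by simp

lemma killed_one_tail:
  "(\<Sum>j. nui ((taboo ^^ (j + Suc n)) (\<lambda>x. 1))) \<le> killed_total * (1 / r) ^ n"
proof -
  let ?B = "\<lambda>j. nui ((taboo ^^ j) (\<lambda>x. 1))"
  let ?W = "\<lambda>l. r ^ l * nui ((taboo ^^ l) V)"
  have s: "summable (\<lambda>j. ?W (j + Suc n))" by (rule summable_ignore_initial_segment[OF summable_killed])
  have le: "?B (j + Suc n) \<le> (1 / r) ^ n * ?W (j + Suc n)" for j
  proof -
    have "1 * ?B (j + Suc n) \<le> r ^ (j + 1) * nui ((taboo ^^ (j + Suc n)) V)"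
      by (rule mult_mono[OF one_le_power[OF r_ge_1] killed_one_le_V(2)])
        (use r_gt_1 killed_one_le_V(1)[of "j + Suc n"] in auto)
    also have "r ^ (j + 1) = (1 / r) ^ n * r ^ (j + Suc n)"
      using r_gt_1 by (simp add: power_add power_one_over field_simps)
    finally show ?thesis by (simp add: mult.assoc)
  qed
  have "(\<Sum>j. ?B (j + Suc n)) \<le> (\<Sum>j. (1 / r) ^ n * ?W (j + Suc n))"
    by (rule suminf_le[OF le summable_ignore_initial_segment[OF summable_nui_killed[OF dominated_const]]
          summable_mult[OF s]])
  also have "\<dots> = (1 / r) ^ n * (\<Sum>j. ?W (j + Suc n))" by (rule suminf_mult[OF s])
  also have "(\<Sum>j. ?W (j + Suc n)) \<le> (\<Sum>l. ?W l)"
    using suminf_split_initial_segment[OF summable_killed, of "Suc n"] r_gt_1 nui_killed_nonneg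
    by (simp add: sum_nonneg del: sum.lessThan_Suc)
  also have "\<dots> \<le> killed_total" by (rule killed_total_suminf)
  finally show ?thesis using r_gt_1 by (simp add: mult_ac mult_right_mono)
qed

end

locale reversible_chain = stationary_chain +
  assumes rev: "reversible P \<pi>" and posit: "positive_chain P \<pi>"
begin

lemma limit_bounds: "0 \<le> \<beta>t * piC" "\<beta>t * piC \<le> 1"
  using bt_pos bt_le_1 piC_bounds by (auto intro: mult_le_one)

lemma ip_step:
  assumes "bounded_fun f" "bounded_fun g" shows "ip (step f) g = ip f (step g)"
proof -
  have "ip (step f) g = (\<integral>x. f x * trans_op P g x \<partial>\<pi>)"
    using rev bounded_L2[OF assms(1)] bounded_L2[OF assms(2)]
    unfolding reversible_def integral_trans_op by blast
  also have "\<dots> = (\<integral>x. trans_op P g x * f x \<partial>\<pi>)" by (simp only: mult.commute)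
  finally show ?thesis unfolding integral_trans_op by (simp add: ip_commute)
qed

lemma ip_step_nonneg: "bounded_fun f \<Longrightarrow> 0 \<le> ip (step f) f"
  using posit bounded_L2[of f] unfolding positive_chain_def integral_trans_op by blast

lemma ip_centred: "ip ((step ^^ i) centred) ((step ^^ j) centred) = cov (i + j)"
proof (induction j arbitrary: i)
  case (Suc j)
  have "ip ((step ^^ i) centred) ((step ^^ Suc j) centred)
      = ip ((step ^^ Suc i) centred) ((step ^^ j) centred)"
    using ip_step[OF bounded_centred[of i] bounded_centred[of j]] by simp
  then show ?case using Suc[of "Suc i"] by simp
qed (simp add: cov_def)

text \<open>
  Even covariances are squared norms by reversibility; the odd ones are values of the quadratic form of
  the positive operator.
\<close>

lemma cov_nonneg: "0 \<le> cov k"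
proof (cases "even k")
  case True
  then obtain m where "k = m + m" by (metis evenE mult_2)
  then show ?thesis using ip_self_nonneg[of "(step ^^ m) centred"] by (simp add: ip_centred)
next
  case False
  then obtain m where "k = Suc m + m" by (metis oddE add_Suc mult_2 Suc_eq_plus1)
  then show ?thesis
    using ip_step_nonneg[OF bounded_centred[of m]] ip_centred[of "Suc m" m] by simp
qed

lemma cov_log_convex: "(cov (2 * Suc n))\<^sup>2 \<le> cov (2 * n) * cov (2 * Suc (Suc n))"
  using ip_Cauchy_Schwarz[OF bounded_centred[of n] bounded_centred[of "n + 2"]]
    ip_centred[of n "n + 2"] ip_centred[of n n] ip_centred[of "n + 2" "n + 2"]
  by (simp add: mult_2)

text \<open>
  Decompose the event that the chain has regenerated by time \<open>n\<close> according to the last regeneration and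
  integrate over \<open>C\<close>. In the limit the identity is the normalisation of \<open>\<pi>\<close>; what remains is an
  upper bound for a convolution of \<open>cov\<close> with nonnegative weights, by a geometrically small tail.
  Since \<open>cov\<close> is nonnegative, its last term alone is bounded by that tail.
\<close>

lemma cov_decay: "cov n \<le> killed_total * (1 / r) ^ n"
proof -
  let ?B = "\<lambda>j. nui ((taboo ^^ j) (\<lambda>x. 1))"
  let ?p = "\<lambda>k. (step ^^ k) (indicator C)"
  have i: "integrable \<pi> (\<lambda>x. ?p k x * indicator C x)" for k
    by (intro bounded_integrable bounded_fun_mult bounded_fun_step_pow bounded_fun_indC)
  have pt: "(\<Sum>k\<le>n. \<beta>t * ?B (n - k) * (?p k x * indicator C x)) \<le> indicator C x" if x: "x \<in> space S" for x
  proof -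
    have "1 = (taboo ^^ Suc n) (\<lambda>x. 1) x + (\<Sum>k<Suc n. \<beta>t * ?p k x * ?B (Suc n - Suc k))"
      using last_exit[OF dominated_const, of x "Suc n" 1] step_pow_one[OF x, of "Suc n"] x by simp
    moreover have "0 \<le> (taboo ^^ Suc n) (\<lambda>x. 1) x" by (rule taboo_pow_nonneg) (use x in auto)
    ultimately have "(\<Sum>k\<le>n. \<beta>t * ?p k x * ?B (n - k)) \<le> 1"
      by (simp only: lessThan_Suc_atMost diff_Suc_Suc)
    then show ?thesis by (cases "x \<in> C") (simp_all add: mult_ac)
  qed
  have "(\<Sum>k\<le>n. \<beta>t * ?B (n - k) * (piC\<^sup>2 + cov k))
      = (\<integral>x. (\<Sum>k\<le>n. \<beta>t * ?B (n - k) * (?p k x * indicator C x)) \<partial>\<pi>)"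
    using i by (simp add: cov_eq[symmetric] ip_def)
  also have "\<dots> \<le> (\<integral>x. indicator C x \<partial>\<pi>)"
    using pt i bounded_integrable[OF bounded_fun_indC]
    by (intro integral_mono) (auto simp: space_pi)
  finally have le: "(\<Sum>k\<le>n. \<beta>t * ?B (n - k) * (piC\<^sup>2 + cov k)) \<le> piC" by (simp add: pi_indC)
  have "\<beta>t * ?B 0 * cov n = \<beta>t * ?B (n - n) * cov n" by simp
  also have "\<dots> \<le> (\<Sum>k\<le>n. \<beta>t * ?B (n - k) * cov k)"
    using bt_pos killed_one_le_V(1) cov_nonneg
    by (intro member_le_sum[of n "{..n}" "\<lambda>k. \<beta>t * ?B (n - k) * cov k"]) auto
  also have "\<dots> \<le> piC - piC\<^sup>2 * \<beta>t * (\<Sum>k\<le>n. ?B (n - k))"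
  proof -
    have "(\<Sum>k\<le>n. \<beta>t * ?B (n - k) * (piC\<^sup>2 + cov k))
        = piC\<^sup>2 * \<beta>t * (\<Sum>k\<le>n. ?B (n - k)) + (\<Sum>k\<le>n. \<beta>t * ?B (n - k) * cov k)"
      unfolding distrib_left sum.distrib sum_distrib_left by (simp add: mult_ac)
    then show ?thesis using le by simp
  qed
  also have "(\<Sum>k\<le>n. ?B (n - k)) = (\<Sum>k\<le>n. ?B k)"
    by (rule sum.nat_diff_reindex[of ?B "Suc n", simplified lessThan_Suc_atMost diff_Suc_Suc, simplified])
  also have "\<dots> = killed_mean (\<lambda>x. 1) - (\<Sum>j. ?B (j + Suc n))"
    using suminf_split_initial_segment[OF summable_nui_killed[OF dominated_const[of 1]], of "Suc n"]
    by (simp add: killed_mean_def lessThan_Suc_atMost)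
  also have "piC - piC\<^sup>2 * \<beta>t * (killed_mean (\<lambda>x. 1) - (\<Sum>j. ?B (j + Suc n)))
      = piC - piC * (\<beta>t * piC * killed_mean (\<lambda>x. 1)) + \<beta>t * (piC\<^sup>2 * (\<Sum>j. ?B (j + Suc n)))"
    by (simp add: algebra_simps power2_eq_square)
  also have "\<dots> = \<beta>t * (piC\<^sup>2 * (\<Sum>j. ?B (j + Suc n)))" by (simp add: pi_normalised)
  finally have "cov n \<le> piC\<^sup>2 * (\<Sum>j. ?B (j + Suc n))" using bt_pos by simp
  also have "\<dots> \<le> 1 * (killed_total * (1 / r) ^ n)"
  proof (rule mult_mono[OF _ killed_one_tail])
    show "piC\<^sup>2 \<le> 1" using piC_bounds by (simp add: power_le_one)
    show "0 \<le> (\<Sum>j. ?B (j + Suc n))"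
      by (intro suminf_nonneg killed_one_le_V summable_ignore_initial_segment summable_nui_killed) auto
  qed simp
  finally show ?thesis by simp
qed

text \<open>
  Log-convexity trades the constant of \<open>cov_decay\<close> for \<open>cov 0 \<le> \<pi>(C)\<close>. This factor cancels the
  one in \<open>\<nu> \<le> \<pi> / (\<beta>t \<pi>(C))\<close>, so that the rate carries an explicit constant.
\<close>

lemma cov_even_decay: "cov (2 * n) \<le> piC * (1 / r) ^ (2 * n)"
proof -
  have "cov (2 * n) \<le> cov (2 * 0) * ((1 / r)\<^sup>2) ^ n"
  proof (rule log_convex_decay[where s="\<lambda>n. cov (2 * n)" and B=killed_total])
    show "cov (2 * n) \<le> killed_total * ((1 / r)\<^sup>2) ^ n" for n
      using cov_decay[of "2 * n"] by (simp add: power_mult)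
  qed (use cov_nonneg cov_log_convex r_gt_1 in auto)
  also have "\<dots> \<le> piC * ((1 / r)\<^sup>2) ^ n"
  proof (rule mult_right_mono)
    have "ip (indicator C) (indicator C) = piC"
      by (simp add: ip_def pi_indC flip: indicator_inter_arith)
    then have "cov 0 = piC - piC\<^sup>2" using cov_eq[of 0] by simp
    then show "cov (2 * 0) \<le> piC" by simp
  qed simp
  finally show ?thesis by (simp add: power_mult)
qed

text \<open>The probability of a regeneration \<open>j\<close> steps after a given one.\<close>

definition renewal :: "nat \<Rightarrow> real" where
  "renewal j = (case j of 0 \<Rightarrow> 1 | Suc k \<Rightarrow> \<beta>t * nui ((step ^^ k) (indicator C)))"

text \<open>
  The renewal sequence is not itself a sequence of moments, but the density of \<open>\<nu>\<close> with
  respect to \<open>\<pi>\<close> is bounded by \<open>1 / (\<beta>t \<pi>(C))\<close>, and the norm of the centred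
  indicator decays. The factors \<open>\<pi>(C)\<close> cancel and the square root of \<open>\<beta>t\<close> remains.
\<close>

lemma renewal_error:
  assumes E: "1 \<le> E" "r * sqrt \<beta>t \<le> E"
  shows "r ^ j * \<bar>renewal j - \<beta>t * piC\<bar> \<le> E"
proof (cases j)
  case 0
  then show ?thesis using E limit_bounds by (simp add: renewal_def)
next
  case (Suc k)
  let ?f = "(step ^^ k) centred"
  have "nui ?f = nui (\<lambda>x. (step ^^ k) (indicator C) x - piC)"
    by (rule nui_cong) (rule step_pow_centred)
  also have "\<dots> = nui ((step ^^ k) (indicator C)) - piC" by (subst nui_diff) auto
  finally have u: "renewal j - \<beta>t * piC = \<beta>t * nui ?f"
    by (simp add: renewal_def Suc right_diff_distrib)
  have "\<beta>t * piC * (nui ?f)\<^sup>2 \<le> \<beta>t * piC * nui (\<lambda>x. ?f x * ?f x)"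
    using bt_pos piC_bounds by (intro mult_left_mono nui_square_le bounded_centred) auto
  also have "\<dots> \<le> ip ?f ?f"
    unfolding ip_def by (intro nui_le_pi bounded_fun_mult bounded_centred) simp
  also have "\<dots> = cov (2 * k)" by (simp add: ip_centred mult_2)
  also have "\<dots> \<le> piC * (1 / r) ^ (2 * k)" by (rule cov_even_decay)
  finally have "\<beta>t * (nui ?f)\<^sup>2 \<le> ((1 / r) ^ k)\<^sup>2"
    using piC_bounds by (simp add: mult_ac power_mult power2_eq_square power_mult_distrib)
  then have "sqrt (\<beta>t * (nui ?f)\<^sup>2) \<le> (1 / r) ^ k"
    using r_gt_1 by (intro real_le_lsqrt) auto
  then have n: "sqrt \<beta>t * \<bar>nui ?f\<bar> \<le> (1 / r) ^ k" by (simp add: real_sqrt_mult)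
  have "r ^ j * \<bar>renewal j - \<beta>t * piC\<bar> = r * r ^ k * (sqrt \<beta>t * (sqrt \<beta>t * \<bar>nui ?f\<bar>))"
  proof -
    have "\<bar>renewal j - \<beta>t * piC\<bar> = sqrt \<beta>t * (sqrt \<beta>t * \<bar>nui ?f\<bar>)"
      unfolding u abs_mult using bt_pos by (simp flip: mult.assoc)
    then show ?thesis by (simp only: Suc power_Suc)
  qed
  also have "\<dots> \<le> r * r ^ k * (sqrt \<beta>t * (1 / r) ^ k)"
    using n r_gt_1 bt_pos by (intro mult_left_mono) auto
  also have "\<dots> = r * sqrt \<beta>t" using r_gt_1 by (simp add: power_one_over)
  finally show ?thesis using E by simp
qed

lemma regeneration_probability:
  "\<beta>t * (step ^^ k) (indicator C) x = (\<Sum>i\<le>k. renewal (k - i) * (\<beta>t * (taboo ^^ i) (indicator C) x))"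
proof -
  have "\<beta>t * (step ^^ k) (indicator C) x = \<beta>t * (taboo ^^ k) (indicator C) x
      + (\<Sum>i<k. \<beta>t * nui ((step ^^ (k - Suc i)) (indicator C)) * (\<beta>t * (taboo ^^ i) (indicator C) x))"
    by (subst first_entrance) (simp_all add: distrib_left sum_distrib_left mult_ac)
  also have "(\<Sum>i<k. \<beta>t * nui ((step ^^ (k - Suc i)) (indicator C)) * (\<beta>t * (taboo ^^ i) (indicator C) x))
      = (\<Sum>i<k. renewal (k - i) * (\<beta>t * (taboo ^^ i) (indicator C) x))"
  proof (rule sum.cong[OF refl])
    fix i assume "i \<in> {..<k}"
    then have "k - i = Suc (k - Suc i)" by auto
    then show "\<beta>t * nui ((step ^^ (k - Suc i)) (indicator C)) * (\<beta>t * (taboo ^^ i) (indicator C) x)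
        = renewal (k - i) * (\<beta>t * (taboo ^^ i) (indicator C) x)"
      by (simp add: renewal_def)
  qed
  finally show ?thesis by (simp add: lessThan_Suc_atMost[symmetric] renewal_def)
qed

text \<open>
  The probability of a regeneration at time \<open>k\<close>, from \<open>x\<close>, is the renewal sequence convolved with the
  distribution of the first regeneration time.
\<close>

lemma regeneration_error:
  assumes E: "1 \<le> E" "r * sqrt \<beta>t \<le> E" and x: "x \<in> space S"
  shows "r ^ k * \<bar>\<beta>t * (step ^^ k) (indicator C) x - \<beta>t * piC\<bar> \<le> \<beta>t / D * weight r x * E"
proof -
  have "r ^ k * \<bar>(\<Sum>i\<le>k. renewal (k - i) * (\<beta>t * (taboo ^^ i) (indicator C) x)) - \<beta>t * piC * 1\<bar>
      \<le> \<beta>t / D * weight r x * E"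
  proof (rule weighted_convolution_error[OF r_ge_1 _ summable_entrance[OF x] _ entrance_sums_1[OF x]
        renewal_error[OF E]])
    show "(\<Sum>i. r ^ i * (\<beta>t * (taboo ^^ i) (indicator C) x)) \<le> \<beta>t / D * weight r x"
      by (rule suminf_le_const[OF summable_entrance[OF x] entrance_potential[OF x]])
    show "\<bar>\<beta>t * piC\<bar> \<le> E" using limit_bounds E by simp
  qed (use entrance_nonneg[OF x] in simp)
  then show ?thesis unfolding regeneration_probability by simp
qed

text \<open>
  By the last-exit decomposition \<open>P\<^sup>n g\<close> is \<open>Q\<^sup>n g\<close> plus the convolution of the regeneration
  probabilities with \<open>\<nu> Q\<^sup>l g\<close>, whose sum over \<open>l\<close> is \<open>\<integral> g d\<pi>\<close> up to the factor
  \<open>\<beta>t \<pi>(C)\<close>. The step from the regeneration at time \<open>n - 1 - l\<close> to the new start accounts for the additional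
  factor \<open>r\<close>. The maximum with \<open>V x\<close> covers \<open>n = 0\<close>.
\<close>

lemma geometric_error:
  assumes g: "g \<in> borel_measurable S" "\<And>y. y \<in> space S \<Longrightarrow> \<bar>g y\<bar> \<le> V y"
    and E: "1 \<le> E" "r * sqrt \<beta>t \<le> E" and x: "x \<in> space S"
  shows "r ^ n * \<bar>(step ^^ n) g x - (\<integral>y. g y \<partial>\<pi>)\<bar> \<le>
    max (V x) (excursion r * off x + J * weight r x) + r * killed_total * (\<beta>t / D * weight r x * E)"
proof -
  have d: "dominated g" by (rule dominatedI[of g 1]) (use g in auto)
  let ?phi = "\<lambda>l. nui ((taboo ^^ l) g)"
  let ?A = "\<beta>t / D * weight r x * E"
  have phi: "\<bar>?phi l\<bar> \<le> nui ((taboo ^^ l) V)" for l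
    using abs_nui_killed_le[OF d, of 1 l] g(2) by simp
  have pi: "(\<integral>y. g y \<partial>\<pi>) = \<beta>t * piC * killed_mean g" by (rule pi_eq[OF d])
  note w0 = limit_bounds
  have A1: "1 \<le> ?A"
  proof -
    have "1 * 1 * 1 \<le> \<beta>t / D * weight r x * E"
      using D_pos D_le E(1) weight_bounds(1)[OF r_ge_1 r_lam x] bt_pos
      by (intro mult_mono) auto
    then show ?thesis by simp
  qed
  have sums: "?phi sums killed_mean g"
    unfolding killed_mean_def by (rule summable_sums[OF summable_nui_killed[OF d]])
  have tot: "killed_total \<le> r * killed_total" 
    using killed_total_nonneg r_gt_1 by (simp add: mult_le_cancel_right1)
  have tb: "\<bar>(taboo ^^ n) g x\<bar> \<le> (taboo ^^ n) V x"
    by (rule abs_taboo_pow_le[OF d dominated_V g(2) x])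
  show ?thesis
  proof (cases n)
    case 0
    have "\<bar>killed_mean g\<bar> \<le> killed_total"
    proof -
      have "\<bar>killed_mean g\<bar> \<le> (\<Sum>l. r ^ l * nui ((taboo ^^ l) V))"
      proof -
        have le: "\<bar>?phi l\<bar> \<le> r ^ l * nui ((taboo ^^ l) V)" for l
        proof -
          have "1 * nui ((taboo ^^ l) V) \<le> r ^ l * nui ((taboo ^^ l) V)"
            using nui_killed_nonneg r_ge_1 by (intro mult_right_mono) auto
          then show ?thesis using phi[of l] by simp
        qed
        have s: "summable (\<lambda>l. \<bar>?phi l\<bar>)"
          by (rule summable_comparison_test'[OF summable_killed, of 0]) (use le in simp)
        show ?thesis
          unfolding killed_mean_def
          using summable_rabs[OF s] suminf_le[OF le s summable_killed] by simp
      qed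
      then show ?thesis using killed_total_suminf by simp
    qed
    then have "\<bar>\<integral>y. g y \<partial>\<pi>\<bar> \<le> 1 * killed_total"
      unfolding pi abs_mult[of "\<beta>t * piC"] using w0 by (intro mult_mono) auto
    also have "\<dots> \<le> r * killed_total * ?A"
      using mult_mono[OF tot A1] killed_total_nonneg r_gt_1 by simp
    finally show ?thesis using 0 g(2)[OF x] by simp
  next
    case (Suc m)
    have conv: "r ^ m * \<bar>(\<Sum>k\<le>m. (\<beta>t * (step ^^ (m - k)) (indicator C) x) * ?phi k)
        - \<beta>t * piC * killed_mean g\<bar> \<le> killed_total * ?A"
      by (rule weighted_convolution_error[OF r_ge_1 phi summable_killed killed_total_suminf sums
            regeneration_error[OF E x]]) (use w0 A1 in simp)
    have "(step ^^ n) g x - (\<integral>y. g y \<partial>\<pi>) = (taboo ^^ n) g x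
        + ((\<Sum>k\<le>m. (\<beta>t * (step ^^ (m - k)) (indicator C) x) * ?phi k) - \<beta>t * piC * killed_mean g)"
    proof -
      have "(\<Sum>k<n. \<beta>t * (step ^^ k) (indicator C) x * ?phi (n - Suc k))
          = (\<Sum>k\<le>m. \<beta>t * (step ^^ (m - k)) (indicator C) x * ?phi k)"
        unfolding Suc lessThan_Suc_atMost
        by (rule sum.reindex_bij_witness[of _ "\<lambda>k. m - k" "\<lambda>k. m - k"]) auto
      then show ?thesis using last_exit[OF d x, of n] pi by simp
    qed
    then have "r ^ n * \<bar>(step ^^ n) g x - (\<integral>y. g y \<partial>\<pi>)\<bar>
        \<le> r ^ n * (\<bar>(taboo ^^ n) g x\<bar> + \<bar>(\<Sum>k\<le>m. (\<beta>t * (step ^^ (m - k)) (indicator C) x) * ?phi k)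
          - \<beta>t * piC * killed_mean g\<bar>)"
      using r_gt_1 by (auto intro!: mult_left_mono abs_triangle_ineq)
    also have "\<dots> = r ^ n * \<bar>(taboo ^^ n) g x\<bar> + r * (r ^ m * \<bar>(\<Sum>k\<le>m. (\<beta>t * (step ^^ (m - k)) (indicator C) x)
          * ?phi k) - \<beta>t * piC * killed_mean g\<bar>)"
      by (simp add: Suc distrib_left mult_ac)
    also have "r ^ n * \<bar>(taboo ^^ n) g x\<bar> \<le> r ^ n * (taboo ^^ n) V x"
      using tb r_gt_1 by (intro mult_left_mono) auto
    also have "\<dots> \<le> excursion r * off x + J * weight r x"
      unfolding Suc by (rule killed_V_le[OF x])
    also have "\<dots> \<le> max (V x) (excursion r * off x + J * weight r x)" by simp
    also have "r * (r ^ m * \<bar>(\<Sum>k\<le>m. (\<beta>t * (step ^^ (m - k)) (indicator C) x) * ?phi k)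
          - \<beta>t * piC * killed_mean g\<bar>) \<le> r * (killed_total * ?A)"
      using conv r_gt_1 by (intro mult_left_mono) auto
    finally show ?thesis by (simp add: mult.assoc)
  qed
qed

end

section \<open>The explicit constants\<close>

context drift_chain
begin

text \<open>On an atom every visit is a regeneration, so there are no residual excursions.\<close>

lemma killed_chain_atom:
  assumes atom: "is_atom P C" "atom_convention P C \<beta>t \<nu>" and r: "1 < r" "r * lam < 1"
  shows "killed_chain S P C \<nu> V \<beta>t lam K r 1 0"
proof -
  have bt: "\<beta>t = 1" and nu: "\<And>x. x \<in> C \<Longrightarrow> \<nu> = P x"
    using atom by (auto simp: atom_convention_def)
  have "taboo f x = 0" if x: "x \<in> C" for f x
  proof -
    have "nui f = (\<integral>y. f y \<partial>P x)"
      unfolding nui_def by (rule arg_cong[OF nu[OF x], where f="\<lambda>M. \<integral>y. f y \<partial>M"])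
    moreover have "\<beta>t * nui f = nui f" using bt by (metis mult_1)
    ultimately show ?thesis unfolding taboo_def using x C_sub[OF x] by (simp add: step_def)
  qed
  then show ?thesis using r bt by unfold_locales simp_all
qed

lemma alpha1_ge_1:
  assumes "\<beta>t < 1" shows "1 \<le> alpha1 lam K \<beta>t"
proof -
  have "0 \<le> ln ((K - \<beta>t) / (1 - \<beta>t))"
    using assms K_ge_1 by (intro ln_ge_zero) (simp add: field_simps)
  moreover have "0 \<le> ln (1 / lam)" using lam_pos lam_less_1 by (intro ln_ge_zero) simp
  ultimately show ?thesis by (simp add: alpha1_def)
qed

text \<open>
  The bound, weighted by \<open>\<beta>t\<close>, for the sum of \<open>r\<close>$^n$\<open> V\<close> over the excursion that follows a regeneration.
\<close>

definition nu_excursion :: "real \<Rightarrow> real" where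
  "nu_excursion r = \<beta>t * (r * nui V + excursion r * (r * nui off))"

lemma nu_excursion_ge:
  assumes "1 \<le> r" "r * lam < 1" shows "\<beta>t * r \<le> nu_excursion r"
proof -
  have "r * 1 + 0 \<le> r * nui V + excursion r * (r * nui off)"
    using assms nui_V_ge_1 nui_off_nonneg excursion_nonneg[OF assms]
    by (intro add_mono mult_left_mono mult_nonneg_nonneg) auto
  then show ?thesis using bt_pos by (simp add: nu_excursion_def)
qed

text \<open>
  The excursion that follows a regeneration and the one of the residual chain share the drift bound
  for \<open>P\<close>: what the former uses up is subtracted from the bound for the latter.
\<close>

lemma taboo_excursion_on_C:
  assumes r: "1 \<le> r" "r * lam < 1" and x: "x \<in> C"
  shows "r * taboo V x + excursion r * (r * taboo off x)
    \<le> r * (K - r * lam) / (1 - r * lam) - nu_excursion r"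
  using excursion_on_C[OF r x] x by (simp add: taboo_def nu_excursion_def algebra_simps)

lemma killed_chain_nonatom:
  fixes r
  defines "D \<equiv> 1 - (1 - \<beta>t) * r powr alpha1 lam K \<beta>t"
  assumes bt: "\<beta>t < 1" and r: "1 < r" "r * lam < 1" and D: "0 < D"
  shows "killed_chain S P C \<nu> V \<beta>t lam K r D
    ((r * (K - r * lam) / (1 - r * lam) - nu_excursion r) / D)"
proof unfold_locales
  have r1: "1 \<le> r" using r by simp
  have "1 \<le> r powr alpha1 lam K \<beta>t"
    using r alpha1_ge_1[OF bt] by (intro ge_one_powr_ge_zero) auto
  then have "(1 - \<beta>t) * 1 \<le> (1 - \<beta>t) * r powr alpha1 lam K \<beta>t"
    using bt by (intro mult_left_mono) auto
  then show "D \<le> \<beta>t" by (simp add: D_def)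
  show "r * taboo (weight r) x \<le> 1 - D" if "x \<in> C" for x
    using taboo_weight_on_C[OF r1 r(2) that bt] by (simp add: D_def)
  show "r * taboo V x + excursion r * (r * taboo off x)
      \<le> (r * (K - r * lam) / (1 - r * lam) - nu_excursion r) / D * D" if "x \<in> C" for x
    using taboo_excursion_on_C[OF r1 r(2) that] D by simp
  obtain x where x: "x \<in> C" using C_nonempty by blast
  have "0 \<le> taboo V x" "0 \<le> taboo off x"
    using V_nonneg off_bounds(1) C_sub[OF x] by (auto intro: taboo_nonneg)
  then have "0 \<le> r * taboo V x + excursion r * (r * taboo off x)"
    using r excursion_nonneg[OF r1 r(2)] by simp
  then show "0 \<le> (r * (K - r * lam) / (1 - r * lam) - nu_excursion r) / D"
    using taboo_excursion_on_C[OF r1 r(2) x] D by simp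
qed (use r D in auto)

lemma nui_entry_nn:
  "ennreal (nui entry) = emeasure \<nu> C + (\<integral>\<^sup>+x\<in>space S - C. ennreal (V x) \<partial>\<nu>)"
proof -
  have "ennreal (nui entry) = (\<integral>\<^sup>+x. ennreal (entry x) \<partial>\<nu>)"
    unfolding nui_def using entry_bounds(1)
    by (intro nn_integral_eq_integral[symmetric] integrable_nu dominated_entry AE_I2)
      (force simp: space_nu)
  also have "\<dots> = (\<integral>\<^sup>+x. indicator C x + ennreal (V x) * indicator (space S - C) x \<partial>\<nu>)"
    by (intro nn_integral_cong) (auto simp: entry_def space_nu indicator_def)
  also have "\<dots> = emeasure \<nu> C + (\<integral>\<^sup>+x\<in>space S - C. ennreal (V x) \<partial>\<nu>)"
    by (subst nn_integral_add) (auto simp: sets_nu)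
  finally show ?thesis .
qed

text \<open>
  All choices of \<open>\<alpha>2\<close> come from an upper bound \<open>m\<close> for the mean of \<open>entry\<close> under \<open>\<nu>\<close>: \<open>K / \<beta>t\<close>
  from the minorization, \<open>1\<close> if \<open>\<nu>\<close> is concentrated on \<open>C\<close>, or the given constant.
\<close>

lemma alpha2_choiceE:
  assumes "alpha2_choice S C V lam K \<beta>t \<nu> \<alpha>2"
  obtains m where "nui entry \<le> m" "\<alpha>2 = 1 + ln m / ln (1 / lam)"
proof -
  consider "\<alpha>2 = 1 + ln (K / \<beta>t) / ln (1 / lam)" | "measure \<nu> C = 1" "\<alpha>2 = 1"
    | Kt where "emeasure \<nu> C + (\<integral>\<^sup>+x\<in>space S - C. ennreal (V x) \<partial>\<nu>) \<le> ennreal Kt"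
      "\<alpha>2 = 1 + ln Kt / ln (1 / lam)"
    using assms by (auto simp: alpha2_choice_def)
  then show ?thesis
  proof cases
    case 1
    have "nui entry \<le> nui V" by (rule nui_mono) (auto simp: entry_bounds)
    also have "\<dots> \<le> K / \<beta>t" using nui_V_on_C bt_pos by (simp add: field_simps)
    finally show ?thesis using that 1 by blast
  next
    case 2
    interpret n: prob_space \<nu> by (rule prob_nu)
    have "AE x in \<nu>. x \<in> C" using n.prob_eq_1[of C] 2(1) by (simp add: sets_nu)
    then have "nui entry = (\<integral>x. 1 \<partial>\<nu>)"
      unfolding nui_def using dominated_meas[OF dominated_entry]
      by (intro integral_cong_AE) (auto simp: entry_def cong: measurable_cong_sets)
    then show ?thesis using that[of 1] 2 n.prob_space by simp
  next
    case 3
    have e1: "1 \<le> nui entry" using nui_mono[of "\<lambda>x. 1" entry] entry_bounds by auto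
    have "ennreal (nui entry) \<le> ennreal Kt" using 3(1) by (simp add: nui_entry_nn)
    moreover from this have "0 \<le> Kt" using e1 by (cases "0 \<le> Kt") (auto simp: ennreal_neg)
    ultimately have "nui entry \<le> Kt" by simp
    then show ?thesis using that 3(2) by blast
  qed
qed

lemma alpha2_ge_1:
  assumes "nui entry \<le> m" shows "1 \<le> 1 + ln m / ln (1 / lam)"
proof -
  have "1 \<le> nui entry" using nui_mono[of "\<lambda>x. 1" entry] entry_bounds by auto
  then have "0 \<le> ln m" using assms by (intro ln_ge_zero) simp
  moreover have "0 \<le> ln (1 / lam)" using lam_pos lam_less_1 by (intro ln_ge_zero) simp
  ultimately show ?thesis by simp
qed

end

lemma gamma_fractions:
  fixes \<gamma> lam K \<beta>t :: real
  assumes "0 < lam" "lam < \<gamma>"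
  shows "1 / \<gamma> * (K - 1 / \<gamma> * lam) / (1 - 1 / \<gamma> * lam) = (K - lam / \<gamma>) / (\<gamma> - lam)"
    and "1 / \<gamma> * lam / (1 - 1 / \<gamma> * lam) = lam / (\<gamma> - lam)"
  using assms by (auto simp: field_simps)

lemma first_term_bounds:
  fixes \<gamma> lam K :: real
  assumes "0 < lam" "lam < \<gamma>" "\<gamma> < 1" "1 \<le> K"
  shows "1 \<le> max lam (K - lam / \<gamma>) / (\<gamma> - lam)" "lam / (\<gamma> - lam) \<le> max lam (K - lam / \<gamma>) / (\<gamma> - lam)"
proof -
  have "\<gamma> * (\<gamma> - lam) \<le> 1 * (\<gamma> - lam)" using assms by (intro mult_right_mono) auto
  then have "\<gamma> - lam \<le> 1 - lam / \<gamma>" using assms by (simp add: field_simps)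
  then have "\<gamma> - lam \<le> max lam (K - lam / \<gamma>)" using assms by simp
  then show "1 \<le> max lam (K - lam / \<gamma>) / (\<gamma> - lam)" using assms by simp
  show "lam / (\<gamma> - lam) \<le> max lam (K - lam / \<gamma>) / (\<gamma> - lam)"
    using assms by (intro divide_right_mono) auto
qed

text \<open>
  The explicit constants, bounded from below in the form in which the error estimate produces its
  terms: the path before the first regeneration, and the cycle multiplied by the renewal error. A factor
  \<open>K / \<gamma> \<ge> 1\<close> makes up the difference in the terms that are compared.
\<close>

lemma M_at_ge:
  assumes "0 < lam" "lam < \<gamma>" "\<gamma> < 1" "1 \<le> K" "0 \<le> \<kappa>"
  shows "max lam (K - lam / \<gamma>) / (\<gamma> - lam) + (K - lam / \<gamma>) / (\<gamma> - lam) * \<kappa> \<le> M_at lam K \<gamma> \<kappa>"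
proof -
  have lg: "lam / \<gamma> < 1" using assms by simp
  then have lgK: "lam / \<gamma> \<le> K" using assms(4) by linarith
  have q: "0 \<le> (K - lam / \<gamma>) / (\<gamma> - lam)" using assms lg by (intro divide_nonneg_nonneg) linarith+
  have "1 \<le> K / \<gamma>" using assms by (simp add: field_simps)
  then have "1 * ((K - lam / \<gamma>) / (\<gamma> - lam) * \<kappa>) \<le> K / \<gamma> * ((K - lam / \<gamma>) / (\<gamma> - lam) * \<kappa>)"
    by (rule mult_right_mono[OF _ mult_nonneg_nonneg[OF q assms(5)]])
  also have "\<dots> = K * (K - lam / \<gamma>) / (\<gamma> * (\<gamma> - lam)) * \<kappa>" by simp
  finally have "(K - lam / \<gamma>) / (\<gamma> - lam) * \<kappa> \<le> K * (K - lam / \<gamma>) / (\<gamma> * (\<gamma> - lam)) * \<kappa>" by simp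
  moreover have "0 \<le> (K - lam / \<gamma>) * max lam (K - lam) / ((\<gamma> - lam) * (1 - lam))"
    using assms lgK by (intro divide_nonneg_nonneg mult_nonneg_nonneg) auto
  moreover have "0 \<le> lam * (K - 1) / ((\<gamma> - lam) * (1 - lam))"
    using assms by (intro divide_nonneg_nonneg mult_nonneg_nonneg) auto
  ultimately show ?thesis unfolding M_at_def by linarith
qed

lemma M_non_ge:
  fixes lam K \<beta>t \<alpha>2 \<gamma> \<kappa> :: real
  defines "D \<equiv> D_non lam K \<beta>t \<gamma>"
  assumes lam: "0 < lam" "lam < \<gamma>" "\<gamma> < 1" and K: "1 \<le> K" and \<kappa>: "0 \<le> \<kappa>"
    and bt: "0 < \<beta>t" "\<beta>t < 1" and D: "0 < D" and \<alpha>: "0 \<le> alpha1 lam K \<beta>t" "0 \<le> \<alpha>2"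
  shows "max lam (K - lam / \<gamma>) / (\<gamma> - lam)
      + ((K - lam / \<gamma>) / (\<gamma> - lam) - \<beta>t / \<gamma>) / D
      + \<gamma> powr (- \<alpha>2) * ((K - lam / \<gamma>) / (\<gamma> - lam)) / D * (\<beta>t / D) * \<kappa>
    \<le> M_non lam K \<beta>t \<alpha>2 \<gamma> \<kappa>"
proof -
  have g0: "0 < \<gamma>" using lam by simp
  have Kg: "1 \<le> K / \<gamma>" using lam K by (simp add: field_simps)
  have "1 * \<gamma> \<le> K * \<gamma>" using K g0 by (intro mult_right_mono) auto
  then have g: "lam < K * \<gamma>" and g': "\<gamma> \<le> K * \<gamma>" using lam by linarith+
  have p1: "1 \<le> \<gamma> powr (- alpha1 lam K \<beta>t)" and p2: "1 \<le> \<gamma> powr (- \<alpha>2)"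
    using lam \<alpha> powr_mono'[of "- alpha1 lam K \<beta>t" 0 \<gamma>] powr_mono'[of "- \<alpha>2" 0 \<gamma>] by auto
  have inv: "1 < 1 / \<gamma>" using lam by simp
  have E: "(K - lam / \<gamma>) / (\<gamma> - lam) = (K * \<gamma> - lam) / (\<gamma> * (\<gamma> - lam))"
    using g0 lam by (simp add: field_simps)
  have q: "0 \<le> (K - lam / \<gamma>) / (\<gamma> - lam)" unfolding E using g lam by simp
  have R: "(K - lam / \<gamma>) / (\<gamma> - lam) - \<beta>t / \<gamma> = (K * \<gamma> - lam - \<beta>t * (\<gamma> - lam)) / (\<gamma> * (\<gamma> - lam))"
    unfolding E using g0 lam by (simp add: field_simps)
  have "\<beta>t * (\<gamma> - lam) \<le> 1 * (\<gamma> - lam)" using bt lam by (intro mult_right_mono) auto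
  then have Rn: "0 \<le> K * \<gamma> - lam - \<beta>t * (\<gamma> - lam)" using g' by simp
  have "1 * (((K - lam / \<gamma>) / (\<gamma> - lam) - \<beta>t / \<gamma>) / D)
      \<le> K / \<gamma> * (((K - lam / \<gamma>) / (\<gamma> - lam) - \<beta>t / \<gamma>) / D)"
    unfolding R using Kg Rn g0 lam D by (intro mult_right_mono) auto
  also have "\<dots> = K * (K * \<gamma> - lam - \<beta>t * (\<gamma> - lam)) / (\<gamma>\<^sup>2 * (\<gamma> - lam) * D)"
    unfolding R by (simp add: power2_eq_square mult_ac)
  finally have T2: "((K - lam / \<gamma>) / (\<gamma> - lam) - \<beta>t / \<gamma>) / D
      \<le> K * (K * \<gamma> - lam - \<beta>t * (\<gamma> - lam)) / (\<gamma>\<^sup>2 * (\<gamma> - lam) * D)" by simp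
  have pw: "\<gamma> powr (- \<alpha>2 - 2) = \<gamma> powr (- \<alpha>2) / \<gamma>\<^sup>2" "\<gamma> powr (- \<alpha>2 - 1) = \<gamma> powr (- \<alpha>2) / \<gamma>"
    using g0 by (simp_all add: powr_diff powr_numeral)
  have "1 * (\<gamma> powr (- \<alpha>2) * ((K - lam / \<gamma>) / (\<gamma> - lam)) / D * (\<beta>t / D) * \<kappa>)
      \<le> K / \<gamma> * (\<gamma> powr (- \<alpha>2) * ((K - lam / \<gamma>) / (\<gamma> - lam)) / D * (\<beta>t / D) * \<kappa>)"
    using Kg q bt D \<kappa>
    by (intro mult_right_mono mult_nonneg_nonneg[of "_ / _"] mult_nonneg_nonneg[OF _ q]
        mult_nonneg_nonneg[OF _ \<kappa>] divide_nonneg_pos[OF mult_nonneg_nonneg[OF _ q]]) auto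
  also have "\<dots> = \<beta>t * \<gamma> powr (- \<alpha>2 - 2) * K * (K * \<gamma> - lam) / ((\<gamma> - lam) * D\<^sup>2) * \<kappa>"
    unfolding E pw by (simp add: power2_eq_square mult_ac)
  finally have T3: "\<gamma> powr (- \<alpha>2) * ((K - lam / \<gamma>) / (\<gamma> - lam)) / D * (\<beta>t / D) * \<kappa>
      \<le> \<beta>t * \<gamma> powr (- \<alpha>2 - 2) * K * (K * \<gamma> - lam) / ((\<gamma> - lam) * D\<^sup>2) * \<kappa>" by simp
  have T4: "0 \<le> \<gamma> powr (- \<alpha>2 - 1) * (K * \<gamma> - lam) / ((\<gamma> - lam) * D\<^sup>2)
         * (\<beta>t * max lam (K - lam) / (1 - lam)
            + (1 - \<beta>t) * (\<gamma> powr (- alpha1 lam K \<beta>t) - 1) / (1 / \<gamma> - 1))"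
    using g lam bt p1 inv
    by (intro mult_nonneg_nonneg divide_nonneg_nonneg add_nonneg_nonneg) auto
  have T5: "0 \<le> \<gamma> powr (- \<alpha>2) * lam * (K - 1) / ((1 - lam) * (\<gamma> - lam) * D)"
    using lam K D by (intro mult_nonneg_nonneg divide_nonneg_nonneg) auto
  have "\<beta>t * (1 - lam) \<le> 1 * (1 - lam)" using bt lam by (intro mult_right_mono) auto
  then have "0 \<le> K - lam - \<beta>t * (1 - lam)" using K by simp
  then have T6: "0 \<le> (K - lam - \<beta>t * (1 - lam)) / ((1 - lam) * (1 - \<gamma>) * D)
         * ((\<gamma> powr (- \<alpha>2) - 1) + (1 - \<beta>t) * (\<gamma> powr (- alpha1 lam K \<beta>t) - 1) / \<beta>t)"
    using lam bt D p1 p2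
    by (intro mult_nonneg_nonneg divide_nonneg_nonneg add_nonneg_nonneg) auto
  show ?thesis
    unfolding M_non_def Let_def D_def[symmetric] using T2 T3 T4 T5 T6 by linarith
qed

section \<open>The rate of convergence\<close>

lemma powr_minus_eq: "0 < x \<Longrightarrow> x powr (- a) = (1 / x) powr a" for x :: real
  by (simp add: powr_def ln_div)

context drift_chain
begin

lemma reversible_chainI:
  assumes "killed_chain S P C \<nu> V \<beta>t lam K r D J" "stationary S P \<pi>" "reversible P \<pi>" "positive_chain P \<pi>"
  shows "reversible_chain S P C \<nu> V \<beta>t lam K r D J \<pi>"
  using assms
  by (intro reversible_chain.intro stationary_chain.intro stationary_chain_axioms.intro
      reversible_chain_axioms.intro)

text \<open>The two conditions that \<open>geometric_error\<close> imposes on its constant \<open>E\<close>.\<close>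

lemma kappa_bounds:
  fixes b :: real
  assumes "0 \<le> \<rho>" "\<rho> < \<gamma>" "0 \<le> b" 
  shows "1 \<le> 1 + b / (\<gamma> - \<rho>)" "1 / \<gamma> * b \<le> 1 + b / (\<gamma> - \<rho>)"
proof -
  show "1 \<le> 1 + b / (\<gamma> - \<rho>)" using assms by simp
  have "1 / \<gamma> * b \<le> b / (\<gamma> - \<rho>)"
    using assms frac_le[of b b "\<gamma> - \<rho>" \<gamma>] by simp
  then show "1 / \<gamma> * b \<le> 1 + b / (\<gamma> - \<rho>)" by simp
qed

lemma geometric_rate_atom:
  assumes atom: "is_atom P C" "atom_convention P C \<beta>t \<nu>" and \<gamma>: "lam < \<gamma>" "\<gamma> < 1"
    and \<pi>: "stationary S P \<pi>" "reversible P \<pi>" "positive_chain P \<pi>"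
    and g: "g \<in> borel_measurable S" "\<And>y. y \<in> space S \<Longrightarrow> \<bar>g y\<bar> \<le> V y" and x: "x \<in> space S"
  shows "\<bar>(step ^^ n) g x - (\<integral>y. g y \<partial>\<pi>)\<bar> \<le> M_at lam K \<gamma> (1 + 1 / (\<gamma> - lam)) * V x * \<gamma> ^ n"
proof -
  define r where "r = 1 / \<gamma>"
  have g0: "0 < \<gamma>" using \<gamma> lam_pos by simp
  have r: "1 < r" "r * lam < 1" using g0 \<gamma> by (simp_all add: r_def)
  have r1: "1 \<le> r" using r by simp
  have bt: "\<beta>t = 1" using atom by (simp add: atom_convention_def)
  interpret R: reversible_chain S P C \<nu> V \<beta>t lam K r 1 0 \<pi>
    by (rule reversible_chainI[OF killed_chain_atom[OF atom r] \<pi>])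
  let ?\<kappa> = "1 + 1 / (\<gamma> - lam)"
  let ?E = "(K - lam / \<gamma>) / (\<gamma> - lam)" and ?T = "max lam (K - lam / \<gamma>) / (\<gamma> - lam)"
  have V0: "0 \<le> V x" by (rule V_nonneg[OF x])
  have \<kappa>: "1 \<le> ?\<kappa>" "r * sqrt \<beta>t \<le> ?\<kappa>"
    using kappa_bounds[of lam \<gamma> 1] lam_pos \<gamma> by (simp_all add: r_def bt)
  have ex: "excursion r = lam / (\<gamma> - lam)"
    unfolding excursion_def r_def by (rule gamma_fractions[OF lam_pos \<gamma>(1)])
  obtain y where y: "y \<in> C" using C_nonempty by blast
  have "r * R.killed_total = 1 * (r * nui V + excursion r * (r * nui off))"
    unfolding R.killed_total_def by (simp add: distrib_left mult_ac)
  also have "\<dots> = nu_excursion r" unfolding nu_excursion_def by (simp only: bt)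
  also have "\<dots> \<le> ?E"
  proof -
    have "0 \<le> taboo V y" "0 \<le> taboo off y"
      using V_nonneg off_bounds(1) C_sub[OF y] by (auto intro: taboo_nonneg)
    then have "0 \<le> r * taboo V y + excursion r * (r * taboo off y)"
      using r1 excursion_nonneg[OF r1 r(2)] by simp
    moreover have "r * (K - r * lam) / (1 - r * lam) = ?E"
      unfolding r_def by (rule gamma_fractions[OF lam_pos \<gamma>(1)])
    ultimately show ?thesis using taboo_excursion_on_C[OF r1 r(2) y] by linarith
  qed
  finally have tot: "r * R.killed_total \<le> ?E" .
  have E0: "0 \<le> ?E" using tot R.killed_total_nonneg r by (smt (verit) mult_nonneg_nonneg)
  have "r * R.killed_total * (\<beta>t / 1 * weight r x * ?\<kappa>) \<le> ?E * (\<beta>t / 1 * V x * ?\<kappa>)"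
    using tot weight_bounds[OF r1 r(2) x] \<kappa>(1) E0 bt_pos
    by (intro mult_mono mult_right_mono mult_left_mono mult_nonneg_nonneg) auto
  moreover have "max (V x) (excursion r * off x + 0 * weight r x) \<le> ?T * V x"
  proof -
    have "1 * V x \<le> ?T * V x"
      using first_term_bounds(1)[OF lam_pos \<gamma> K_ge_1] V0 by (rule mult_right_mono)
    moreover have "excursion r * off x \<le> ?T * V x"
      unfolding ex using first_term_bounds[OF lam_pos \<gamma> K_ge_1] off_bounds[OF x]
      by (intro mult_mono) auto
    ultimately show ?thesis by simp
  qed
  moreover have "?T * V x + ?E * (\<beta>t / 1 * V x * ?\<kappa>) = (?T + ?E * ?\<kappa>) * V x"
    by (simp only: bt) (simp add: algebra_simps)
  moreover have "(?T + ?E * ?\<kappa>) * V x \<le> M_at lam K \<gamma> ?\<kappa> * V x"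
    using M_at_ge[OF lam_pos \<gamma> K_ge_1, of ?\<kappa>] \<kappa>(1) V0 by (intro mult_right_mono) auto
  ultimately have "r ^ n * \<bar>(step ^^ n) g x - (\<integral>y. g y \<partial>\<pi>)\<bar> \<le> M_at lam K \<gamma> ?\<kappa> * V x"
    using R.geometric_error[OF g \<kappa> x, of n] by linarith
  then show ?thesis using g0 by (simp add: r_def power_one_over field_simps)
qed

lemma R0_bounds:
  assumes bt: "\<beta>t < 1"
  shows "1 < R0 lam K \<beta>t" "R0 lam K \<beta>t \<le> 1 / lam"
    and "0 < r \<Longrightarrow> r < R0 lam K \<beta>t \<Longrightarrow> 0 < 1 - (1 - \<beta>t) * r powr alpha1 lam K \<beta>t"
proof -
  let ?a = "alpha1 lam K \<beta>t"
  have a: "0 < ?a" using alpha1_ge_1[OF bt] by simp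
  have q: "0 < 1 - \<beta>t" "1 - \<beta>t < 1" using bt bt_pos by auto
  have "1 < (1 - \<beta>t) powr (- 1 / ?a)"
    using q a powr_less_mono2_neg[of "- 1 / ?a" "1 - \<beta>t" 1] by simp
  then show "1 < R0 lam K \<beta>t" using lam_pos lam_less_1 by (simp add: R0_def)
  show "R0 lam K \<beta>t \<le> 1 / lam" by (simp add: R0_def)
  assume r: "0 < r" "r < R0 lam K \<beta>t"
  then have "r powr ?a < ((1 - \<beta>t) powr (- 1 / ?a)) powr ?a"
    using a by (intro powr_less_mono2) (auto simp: R0_def)
  also have "\<dots> = 1 / (1 - \<beta>t)"
    unfolding powr_powr using a q by (simp add: powr_minus_divide)
  finally show "0 < 1 - (1 - \<beta>t) * r powr ?a" using q by (simp add: field_simps)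
qed

text \<open>The conditions under which the killed chain has geometric moments, in terms of \<open>\<gamma>\<close>.\<close>

lemma nonatom_conditions:
  assumes bt: "\<beta>t < 1" and \<gamma>: "inverse (R0 lam K \<beta>t) < \<gamma>" "\<gamma> < 1"
  shows "lam < \<gamma>" "1 < 1 / \<gamma>" "1 / \<gamma> * lam < 1" "0 < D_non lam K \<beta>t \<gamma>"
    "D_non lam K \<beta>t \<gamma> = 1 - (1 - \<beta>t) * (1 / \<gamma>) powr alpha1 lam K \<beta>t"
proof -
  have R: "1 < R0 lam K \<beta>t" "R0 lam K \<beta>t \<le> 1 / lam" by (rule R0_bounds[OF bt])+
  have "lam \<le> inverse (R0 lam K \<beta>t)"
    using R lam_pos le_imp_inverse_le[OF R(2)] by simp
  then show lg: "lam < \<gamma>" using \<gamma> by simp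
  have g0: "0 < \<gamma>" using lg lam_pos by simp
  show "1 < 1 / \<gamma>" "1 / \<gamma> * lam < 1" using g0 \<gamma> lg by simp_all
  show eq: "D_non lam K \<beta>t \<gamma> = 1 - (1 - \<beta>t) * (1 / \<gamma>) powr alpha1 lam K \<beta>t"
    using g0 by (simp add: D_non_def powr_minus_eq)
  have "1 / \<gamma> < R0 lam K \<beta>t"
    using \<gamma>(1) g0 R(1) by (simp add: field_simps inverse_eq_divide)
  then show "0 < D_non lam K \<beta>t \<gamma>" unfolding eq using g0 by (intro R0_bounds(3)[OF bt]) auto
qed

text \<open>
  Residual excursions share the drift bound with the excursion after a regeneration, so
  \<open>J = (E - nu_excursion r) / D\<close> with the drift bound \<open>E\<close> for both. In the total over a cycle
  \<open>nu_excursion r\<close> then cancels, since \<open>1 / \<beta>t\<close>, the weight with which it enters, is at most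
  the factor \<open>\<gamma> powr (- \<alpha>2) / D\<close> of \<open>J D\<close>.
\<close>

lemma geometric_rate_nonatom:
  fixes \<gamma> :: real
  defines "\<rho> \<equiv> inverse (R0 lam K \<beta>t)"
  assumes bt: "\<beta>t < 1" and \<gamma>: "\<rho> < \<gamma>" "\<gamma> < 1" and \<alpha>2: "alpha2_choice S C V lam K \<beta>t \<nu> \<alpha>2"
    and \<pi>: "stationary S P \<pi>" "reversible P \<pi>" "positive_chain P \<pi>"
    and g: "g \<in> borel_measurable S" "\<And>y. y \<in> space S \<Longrightarrow> \<bar>g y\<bar> \<le> V y" and x: "x \<in> space S"
  shows "\<bar>(step ^^ n) g x - (\<integral>y. g y \<partial>\<pi>)\<bar>
    \<le> M_non lam K \<beta>t \<alpha>2 \<gamma> (1 + sqrt \<beta>t / (\<gamma> - \<rho>)) * V x * \<gamma> ^ n"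
proof -
  define r where "r = 1 / \<gamma>"
  define D where "D = D_non lam K \<beta>t \<gamma>"
  let ?E = "(K - lam / \<gamma>) / (\<gamma> - lam)" and ?T = "max lam (K - lam / \<gamma>) / (\<gamma> - lam)"
  define J where "J = (?E - nu_excursion r) / D"
  note c = nonatom_conditions[OF bt \<gamma>[unfolded \<rho>_def]]
  have g0: "0 < \<gamma>" using c lam_pos by simp
  have r: "1 < r" "r * lam < 1" and D: "0 < D" using c by (simp_all add: r_def D_def)
  have r1: "1 \<le> r" using r by simp
  have D_eq: "D = 1 - (1 - \<beta>t) * r powr alpha1 lam K \<beta>t" using c by (simp add: r_def D_def)
  have E_eq: "r * (K - r * lam) / (1 - r * lam) = ?E"
    unfolding r_def by (rule gamma_fractions[OF lam_pos c(1)])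
  have "killed_chain S P C \<nu> V \<beta>t lam K r D J"
    using killed_chain_nonatom[OF bt r] D unfolding D_eq[symmetric] E_eq J_def by blast
  then interpret R: reversible_chain S P C \<nu> V \<beta>t lam K r D J \<pi>
    by (rule reversible_chainI[OF _ \<pi>])
  obtain m where m: "nui entry \<le> m" "\<alpha>2 = 1 + ln m / ln (1 / lam)"
    by (rule alpha2_choiceE[OF \<alpha>2])
  have a2: "1 \<le> \<alpha>2" using alpha2_ge_1[OF m(1)] m(2) by simp
  let ?p = "\<gamma> powr (- \<alpha>2)"
  have p: "?p = r powr \<alpha>2" using g0 by (simp add: r_def powr_minus_eq)
  have p1: "1 \<le> ?p" unfolding p using r a2 by (intro ge_one_powr_ge_zero) auto
  have nw: "r * nui (weight r) \<le> ?p" using nui_weight[OF r1 r(2) m(1)] m(2) p by simp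
  have V0: "0 \<le> V x" by (rule V_nonneg[OF x])
  have \<rho>0: "0 \<le> \<rho>" using R0_bounds(1)[OF bt] by (simp add: \<rho>_def)
  let ?\<kappa> = "1 + sqrt \<beta>t / (\<gamma> - \<rho>)"
  have \<kappa>: "1 \<le> ?\<kappa>" "r * sqrt \<beta>t \<le> ?\<kappa>"
    using kappa_bounds[OF \<rho>0 \<gamma>(1), of "sqrt \<beta>t"] bt_pos by (simp_all add: r_def)
  have ex: "excursion r = lam / (\<gamma> - lam)"
    unfolding excursion_def r_def by (rule gamma_fractions[OF lam_pos c(1)])
  have ne: "\<beta>t * r \<le> nu_excursion r" by (rule nu_excursion_ge[OF r1 r(2)])
  then have ne0: "0 \<le> nu_excursion r" using bt_pos r by (smt (verit) mult_nonneg_nonneg)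
  have tot: "r * R.killed_total \<le> ?p * ?E / D"
  proof -
    have "nu_excursion r / \<beta>t = r * nui V + excursion r * (r * nui off)"
      unfolding nu_excursion_def using bt_pos by (intro nonzero_mult_div_cancel_left) simp
    then have "r * R.killed_total = nu_excursion r / \<beta>t + J * (r * nui (weight r))"
      unfolding R.killed_total_def by (simp add: distrib_left mult_ac)
    also have "\<dots> \<le> nu_excursion r * (?p / D) + J * ?p"
    proof (rule add_mono)
      have "1 / \<beta>t \<le> ?p / D"
        using R.D_le D bt_pos p1 by (intro frac_le) auto
      then show "nu_excursion r / \<beta>t \<le> nu_excursion r * (?p / D)"
        using ne0 mult_left_mono by fastforce
      show "J * (r * nui (weight r)) \<le> J * ?p" by (rule mult_left_mono[OF nw R.J_nonneg])
    qed
    also have "\<dots> = ?p * ?E / D" unfolding J_def using D by (simp add: field_simps)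
    finally show ?thesis .
  qed
  have tE0: "0 \<le> ?p * ?E / D" using tot R.killed_total_nonneg r by (smt (verit) mult_nonneg_nonneg)
  have third: "r * R.killed_total * (\<beta>t / D * weight r x * ?\<kappa>) \<le> ?p * ?E / D * (\<beta>t / D * V x * ?\<kappa>)"
    using tot weight_bounds[OF r1 r(2) x] \<kappa>(1) tE0 bt_pos D
    by (intro mult_mono mult_right_mono mult_left_mono mult_nonneg_nonneg) auto
  have JR: "J \<le> (?E - \<beta>t / \<gamma>) / D"
    unfolding J_def using ne D by (intro divide_right_mono) (auto simp: r_def)
  have J0: "0 \<le> (?E - \<beta>t / \<gamma>) / D" using JR R.J_nonneg by simp
  have first: "max (V x) (excursion r * off x + J * weight r x) \<le> (?T + (?E - \<beta>t / \<gamma>) / D) * V x"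
  proof -
    have "1 * V x \<le> (?T + (?E - \<beta>t / \<gamma>) / D) * V x"
      using first_term_bounds(1)[OF lam_pos c(1) \<gamma>(2) K_ge_1] V0 J0 by (intro mult_right_mono) auto
    moreover have "excursion r * off x + J * weight r x \<le> ?T * V x + (?E - \<beta>t / \<gamma>) / D * V x"
      unfolding ex using first_term_bounds[OF lam_pos c(1) \<gamma>(2) K_ge_1] off_bounds[OF x] JR J0
        weight_bounds[OF r1 r(2) x]
      by (intro add_mono mult_mono) auto
    ultimately show ?thesis by (simp add: distrib_right)
  qed
  have arith: "A * v + e * (b * v * k) = (A + e * b * k) * v" for A v e b k :: real
    by (simp add: algebra_simps)
  have "(?T + (?E - \<beta>t / \<gamma>) / D) * V x + ?p * ?E / D * (\<beta>t / D * V x * ?\<kappa>)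
      = (?T + (?E - \<beta>t / \<gamma>) / D + ?p * ?E / D * (\<beta>t / D) * ?\<kappa>) * V x"
    by (rule arith)
  moreover have "\<dots> \<le> M_non lam K \<beta>t \<alpha>2 \<gamma> ?\<kappa> * V x"
  proof (rule mult_right_mono[OF _ V0])
    show "?T + (?E - \<beta>t / \<gamma>) / D + ?p * ?E / D * (\<beta>t / D) * ?\<kappa> \<le> M_non lam K \<beta>t \<alpha>2 \<gamma> ?\<kappa>"
      unfolding D_def using \<kappa>(1) D alpha1_ge_1[OF bt] a2
      by (intro M_non_ge lam_pos c K_ge_1 \<gamma> bt bt_pos) auto
  qed
  ultimately have "r ^ n * \<bar>(step ^^ n) g x - (\<integral>y. g y \<partial>\<pi>)\<bar> \<le> M_non lam K \<beta>t \<alpha>2 \<gamma> ?\<kappa> * V x"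
    using R.geometric_error[OF g \<kappa> x, of n] first third by linarith
  then show ?thesis using g0 by (simp add: r_def power_one_over field_simps)
qed

lemma trans_op_pow:
  "x \<in> space S \<Longrightarrow> (trans_op P ^^ n) g x = (step ^^ n) g x"
proof (induction n arbitrary: x)
  case (Suc n)
  have "(trans_op P ^^ Suc n) g x = (\<integral>y. (trans_op P ^^ n) g y \<partial>P x)"
    by (simp add: trans_op_def[of P "(trans_op P ^^ n) g"])
  also have "\<dots> = (\<integral>y. (step ^^ n) g y \<partial>P x)"
    by (rule Bochner_Integration.integral_cong) (auto simp: space_P Suc)
  also have "\<dots> = (step ^^ Suc n) g x"
    by (simp add: step_def[of "(step ^^ n) g"] Suc.prems)
  finally show ?case .
qed simp

lemma rate_less_1:
  assumes "atom_convention P C \<beta>t \<nu>" shows "0 < rate P C lam K \<beta>t" "rate P C lam K \<beta>t < 1"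
proof -
  have "1 < R0 lam K \<beta>t" if "\<not> is_atom P C"
    using assms that by (intro R0_bounds) (simp add: atom_convention_def)
  then show "0 < rate P C lam K \<beta>t" "rate P C lam K \<beta>t < 1"
    using lam_pos lam_less_1 by (auto simp: rate_def inverse_less_1_iff less_trans[OF zero_less_one])
qed

lemma killed_chain_exists:
  assumes ac: "atom_convention P C \<beta>t \<nu>"
  shows "\<exists>r D J. killed_chain S P C \<nu> V \<beta>t lam K r D J"
proof -
  obtain \<gamma> where \<gamma>: "rate P C lam K \<beta>t < \<gamma>" "\<gamma> < 1" using rate_less_1(2)[OF ac] dense by blast
  show ?thesis
  proof (cases "is_atom P C")
    case True
    then have "1 < 1 / \<gamma>" "1 / \<gamma> * lam < 1" using \<gamma> lam_pos by (auto simp: rate_def field_simps)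
    from killed_chain_atom[OF True ac this] show ?thesis by blast
  next
    case False
    then have bt: "\<beta>t < 1" and "inverse (R0 lam K \<beta>t) < \<gamma>"
      using ac \<gamma> by (auto simp: atom_convention_def rate_def)
    from nonatom_conditions[OF this \<gamma>(2)] show ?thesis
      using killed_chain_nonatom[OF bt, of "1 / \<gamma>"] by auto
  qed
qed

lemma bound_const_cases:
  assumes ac: "atom_convention P C \<beta>t \<nu>" and \<gamma>: "rate P C lam K \<beta>t < \<gamma>" "\<gamma> < 1"
  shows "bound_const P C lam K \<beta>t \<alpha>2 \<gamma> = ereal (if is_atom P C then M_at lam K \<gamma> (1 + 1 / (\<gamma> - lam))
    else M_non lam K \<beta>t \<alpha>2 \<gamma> (1 + sqrt \<beta>t / (\<gamma> - inverse (R0 lam K \<beta>t))))"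
proof (cases "is_atom P C")
  case True
  then show ?thesis using \<gamma> lam_pos lam_less_1 by (simp add: bound_const_def rate_def)
next
  case False
  then have bt: "\<beta>t < 1" and g: "inverse (R0 lam K \<beta>t) < \<gamma>"
    using ac \<gamma> by (auto simp: atom_convention_def rate_def)
  note c = nonatom_conditions[OF bt g \<gamma>(2)]
  then show ?thesis using False g \<gamma> lam_pos lam_less_1 bt_pos by (simp add: bound_const_def rate_def)
qed

end

theorem theorem1p3:
  fixes S :: "'a measure" and P :: "'a \<Rightarrow> 'a measure" and C :: "'a set"
    and \<nu> :: "'a measure" and V :: "'a \<Rightarrow> real" and \<beta>t lam K \<alpha>2 :: real
  assumes kernel: "P \<in> S \<rightarrow>\<^sub>M prob_algebra S"
    and A1: "minorization S P C \<beta>t \<nu>"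
    and A2: "drift S P C V lam K"
    and A3: "strong_aperiodicity C \<beta>t \<nu>"
    and atom: "atom_convention P C \<beta>t \<nu>"
    and alpha2: "\<not> is_atom P C \<Longrightarrow> alpha2_choice S C V lam K \<beta>t \<nu> \<alpha>2"
  shows "(\<exists>!\<pi>. stationary S P \<pi>) \<and>
    (\<forall>\<pi>. stationary S P \<pi> \<longrightarrow>
      (\<integral>\<^sup>+x. ennreal (V x) \<partial>\<pi>) < \<infinity> \<and>
      (reversible P \<pi> \<and> positive_chain P \<pi> \<longrightarrow>
        rate P C lam K \<beta>t < 1 \<and>
        (\<forall>\<gamma>. rate P C lam K \<beta>t < \<gamma> \<and> \<gamma> < 1 \<longrightarrow>
          bound_const P C lam K \<beta>t \<alpha>2 \<gamma> < \<infinity> \<and>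
          (\<forall>x\<in>space S. \<forall>n::nat.
            (SUP g\<in>{g \<in> borel_measurable S. \<forall>y\<in>space S. \<bar>g y\<bar> \<le> V y}.
               ereal \<bar>(trans_op P ^^ n) g x - (\<integral>y. g y \<partial>\<pi>)\<bar>)
            \<le> bound_const P C lam K \<beta>t \<alpha>2 \<gamma> * ereal (V x) * ereal (\<gamma> ^ n))) \<and>
        (\<forall>g\<in>borel_measurable S. bdd_above ((\<lambda>x. \<bar>g x\<bar> / V x) ` space S) \<longrightarrow>
          (\<forall>x\<in>space S. \<forall>n::nat. integrable (P x) ((trans_op P ^^ n) g)) \<and>
          integrable \<pi> g)))"
proof -
  have bt: "\<beta>t \<le> 1" using atom by (auto simp: atom_convention_def split: if_splits)
  have nuC: "0 < measure \<nu> C"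
    using A1 A3 by (auto simp: minorization_def strong_aperiodicity_def zero_less_mult_iff
        dest: less_le_trans)
  interpret drift_chain S P C \<nu> V \<beta>t lam K
    by unfold_locales (fact kernel A1 A2 nuC bt)+
  \<comment> \<open>Stationarity does not depend on \<open>\<gamma>\<close>: any admissible \<open>r\<close> serves.\<close>
  obtain r D J where kc: "killed_chain S P C \<nu> V \<beta>t lam K r D J"
    using killed_chain_exists[OF atom] by blast
  interpret kc: killed_chain S P C \<nu> V \<beta>t lam K r D J by (rule kc)
  have ex1: "\<exists>!\<pi>. stationary S P \<pi>"
    using kc.stationary_exists kc.stationary_unique by blast
  show ?thesis
  proof (intro conjI allI impI ballI)
    show "\<exists>!\<pi>. stationary S P \<pi>" by (rule ex1)
  next
    fix \<pi> assume \<pi>: "stationary S P \<pi>"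
    interpret s: stationary_chain S P C \<nu> V \<beta>t lam K r D J \<pi>
      by unfold_locales (rule \<pi>)
    show "(\<integral>\<^sup>+x. ennreal (V x) \<partial>\<pi>) < \<infinity>" by (rule s.nn_integral_V_pi)
  next
    show "rate P C lam K \<beta>t < 1" by (rule rate_less_1[OF atom])
  next
    fix \<gamma> assume \<gamma>: "rate P C lam K \<beta>t < \<gamma> \<and> \<gamma> < 1"
    show "bound_const P C lam K \<beta>t \<alpha>2 \<gamma> < \<infinity>"
      using bound_const_cases[OF atom, of \<gamma> \<alpha>2] \<gamma> by simp
  next
    fix \<pi> \<gamma> x and n :: nat
    assume \<pi>: "stationary S P \<pi>" "reversible P \<pi> \<and> positive_chain P \<pi>"
      and \<gamma>: "rate P C lam K \<beta>t < \<gamma> \<and> \<gamma> < 1" and x: "x \<in> space S"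
    define M where "M = (if is_atom P C then M_at lam K \<gamma> (1 + 1 / (\<gamma> - lam))
      else M_non lam K \<beta>t \<alpha>2 \<gamma> (1 + sqrt \<beta>t / (\<gamma> - inverse (R0 lam K \<beta>t))))"
    have M: "bound_const P C lam K \<beta>t \<alpha>2 \<gamma> = ereal M"
      unfolding M_def using \<gamma> by (intro bound_const_cases[OF atom]) auto
    have "\<bar>(trans_op P ^^ n) g x - (\<integral>y. g y \<partial>\<pi>)\<bar> \<le> M * V x * \<gamma> ^ n"
      if g: "g \<in> borel_measurable S" "\<And>y. y \<in> space S \<Longrightarrow> \<bar>g y\<bar> \<le> V y" for g
    proof (cases "is_atom P C")
      case True
      then show ?thesis
        using geometric_rate_atom[OF True atom _ _ _ _ _ g x] \<pi> \<gamma>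
        by (simp add: trans_op_pow[OF x] M_def rate_def)
    next
      case False
      then have "\<beta>t < 1" using atom by (simp add: atom_convention_def)
      with False show ?thesis
        using geometric_rate_nonatom[OF _ _ _ alpha2[OF False] _ _ _ g x] \<pi> \<gamma>
        by (simp add: trans_op_pow[OF x] M_def rate_def)
    qed
    then show "(SUP g\<in>{g \<in> borel_measurable S. \<forall>y\<in>space S. \<bar>g y\<bar> \<le> V y}.
        ereal \<bar>(trans_op P ^^ n) g x - (\<integral>y. g y \<partial>\<pi>)\<bar>)
      \<le> bound_const P C lam K \<beta>t \<alpha>2 \<gamma> * ereal (V x) * ereal (\<gamma> ^ n)"
      unfolding M by (intro SUP_least) auto
  next
    fix \<pi> and g :: "'a \<Rightarrow> real" 
    assume \<pi>: "stationary S P \<pi>" and g: "g \<in> borel_measurable S"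
      and "bdd_above ((\<lambda>x. \<bar>g x\<bar> / V x) ` space S)"
    then obtain c where c: "\<And>x. x \<in> space S \<Longrightarrow> \<bar>g x\<bar> / V x \<le> c"
      by (auto simp: bdd_above_def)
    have d: "dominated g"
    proof (rule dominatedI[OF g])
      fix x assume x: "x \<in> space S"
      then show "\<bar>g x\<bar> \<le> c * V x" using c[OF x] V_ge_1[OF x] by (simp add: field_simps)
    qed
    interpret s: stationary_chain S P C \<nu> V \<beta>t lam K r D J \<pi>
      by unfold_locales (rule \<pi>)
    show "integrable \<pi> g" by (rule s.pi_dominated[OF d])
    fix x and n :: nat
    assume x: "x \<in> space S"
    show "integrable (P x) ((trans_op P ^^ n) g)"
      using integrable_P[OF x dominated_step_pow[OF d, of n]]
      by (rule Bochner_Integration.integrable_cong[THEN iffD1, rotated -1])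
        (simp_all add: space_P[OF x] trans_op_pow)
  qed
qed

end
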